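(* Let $A^1,A^2$ be compact metric spaces, let $b:\mathbb T^d\times A^1\times A^2\times\mathcal P(\mathbb T^d)\to\mathbb R^d$ and $L:\mathbb T^d\times A^1\times A^2\times\mathcal P(\mathbb T^d)\to\mathbb R$ be continuous, and Lipschitz in $(x,m)$ uniformly in $(a^1,a^2)$, and let $G:\mathcal P(\mathbb T^d)\to\mathbb R$ be Lipschitz. For $(x,p,m)\in\mathbb T^d\times\mathbb R^d\times\mathcal P(\mathbb T^d)$ set $$H^-(x,p,m)=\min_{a^1\in A^1}\max_{a^2\in A^2}\{-L(x,a^1,a^2,m)-b(x,a^1,a^2,m)\cdot p\},\qquad H^+(x,p,m)=\max_{a^2\in A^2}\min_{a^1\in A^1}\{-L(x,a^1,a^2,m)-b(x,a^1,a^2,m)\cdot p\}.$$ If $H^+=H^-$ (the Isaacs condition), then the upper and lower mean field value functions defined in the context coincide: $U^+=U^-$.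
   Context: Fix $d\ge1$, $T>0$. $\mathbb T^d=\mathbb R^d/\mathbb Z^d$; $\mathcal P(\mathbb T^d)$ is the set of Borel probability measures on $\mathbb T^d$ with the 1-Wasserstein distance $\mathbf d_1(\mu,\nu)=\sup\{\int\varphi\,d(\mu-\nu):\varphi\text{ 1-Lipschitz}\}$, with respect to which Lipschitz continuity in $m$ is understood. $\mathcal L(X)$ is the law of $X$. Fix a filtered probability space $(\Omega,\mathcal F,\mathbb F,\mathbb P)$ satisfying the usual conditions and hosting a $d$-dimensional Brownian motion $W$, with $\mathcal F_0$ atomless and $\mathbb F$ the augmentation of the filtration generated by $\mathcal F_0$ and $W$. For $t_0\in[0,T]$, $\mathcal A^i_{t_0}$ ($i=1,2$) is the set of progressive $A^i$-valued processes on $[t_0,T]$. For $\xi$ $\mathcal F_0$-measurable and $\mathbb T^d$-valued, and $\alpha^i\in\mathcal A^i_{t_0}$, let $$dX_t=b(X_t,\alpha^1_t,\alpha^2_t,\mathcal L(X_t))\,dt+\sqrt2\,dW_t,\quad X_{t_0}=\xi,\qquad J(t_0,\xi,\alpha^1,\alpha^2)=\mathbb E\Big[\int_{t_0}^TL(X_t,\alpha^1_t,\alpha^2_t,\mathcal L(X_t))\,dt+G(\mathcal L(X_T))\Big].$$ A strategy for player 1, $\alpha^{1,s}\in\mathcal A^{1,s}_{t_0}$, is a map $\mathcal A^2_{t_0}\to\mathcal A^1_{t_0}$ that is non-anticipative: for every $t$, if $\mathbb P[\alpha^2_r=\overline{\alpha}^2_r\text{ for a.e. }r\in[t_0,t]]=1$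 then $\mathbb P[\alpha^{1,s}[\alpha^2]_r=\alpha^{1,s}[\overline{\alpha}^2]_r\text{ for a.e. }r\in[t_0,t]]=1$. Strategies $\mathcal A^{2,s}_{t_0}$ for player 2 are defined symmetrically (non-anticipative maps $\mathcal A^1_{t_0}\to\mathcal A^2_{t_0}$). For $(t_0,m_0)\in[0,T]\times\mathcal P(\mathbb T^d)$ and any $\mathcal F_0$-measurable $\xi$ with law $m_0$ (the values do not depend on the choice of $\xi$), $$U^-(t_0,m_0)=\inf_{\alpha^{2,s}\in\mathcal A^{2,s}_{t_0}}\sup_{\alpha^1\in\mathcal A^1_{t_0}}J(t_0,\xi,\alpha^1,\alpha^{2,s}[\alpha^1]),\qquad U^+(t_0,m_0)=\sup_{\alpha^{1,s}\in\mathcal A^{1,s}_{t_0}}\inf_{\alpha^2\in\mathcal A^2_{t_0}}J(t_0,\xi,\alpha^{1,s}[\alpha^2],\alpha^2).$$ *)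

theory Defs
  imports "HOL-Probability.Probability"
begin

section \<open>The flat torus\<close>

quotient_type (overloaded) 'n torus = "real ^ 'n::finite" /
    "\<lambda>x y. \<forall>i. x $ i - y $ i \<in> \<int>"
  morphisms rep_torus to_torus
proof (rule equivpI)
  show "reflp (\<lambda>x y :: real ^ 'n. \<forall>i. x $ i - y $ i \<in> \<int>)"
    by (auto simp: reflp_def)
  show "symp (\<lambda>x y :: real ^ 'n. \<forall>i. x $ i - y $ i \<in> \<int>)"
    unfolding symp_def by (metis Ints_minus minus_diff_eq)
  show "transp (\<lambda>x y :: real ^ 'n. \<forall>i. x $ i - y $ i \<in> \<int>)"
  proof (intro transpI allI)
    fix x y z :: "real ^ 'n" and i
    assume "\<forall>i. x $ i - y $ i \<in> \<int>" "\<forall>i. y $ i - z $ i \<in> \<int>"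
    then have "(x $ i - y $ i) + (y $ i - z $ i) \<in> \<int>" by (intro Ints_add) auto
    then show "x $ i - z $ i \<in> \<int>" by simp
  qed
qed

instantiation torus :: (finite) ab_group_add
begin

lift_definition zero_torus :: "'a torus" is "0" .

lift_definition plus_torus :: "'a torus \<Rightarrow> 'a torus \<Rightarrow> 'a torus" is "(+)"
proof -
  fix x y z w :: "real ^ 'a" and i
  assume "\<And>i. x $ i - y $ i \<in> \<int>" "\<And>i. z $ i - w $ i \<in> \<int>"
  then have "(x $ i - y $ i) + (z $ i - w $ i) \<in> \<int>" by (intro Ints_add)
  then show "(x + z) $ i - (y + w) $ i \<in> \<int>" by (simp add: algebra_simps)
qed

lift_definition minus_torus :: "'a torus \<Rightarrow> 'a torus \<Rightarrow> 'a torus" is "(-)"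
proof -
  fix x y z w :: "real ^ 'a" and i
  assume "\<And>i. x $ i - y $ i \<in> \<int>" "\<And>i. z $ i - w $ i \<in> \<int>"
  then have "(x $ i - y $ i) - (z $ i - w $ i) \<in> \<int>" by (rule Ints_diff)
  then show "(x - z) $ i - (y - w) $ i \<in> \<int>" by (simp add: algebra_simps)
qed

lift_definition uminus_torus :: "'a torus \<Rightarrow> 'a torus" is "uminus"
proof -
  fix x y :: "real ^ 'a" and i
  assume "\<And>i. x $ i - y $ i \<in> \<int>"
  then have "- (x $ i - y $ i) \<in> \<int>" by (intro Ints_minus)
  then show "(- x) $ i - (- y) $ i \<in> \<int>" by (simp add: algebra_simps)
qed

instance
proof
  fix X Y Z :: "'a torus"
  show "X + Y + Z = X + (Y + Z)" by transfer simp
  show "X + Y = Y + X" by transfer simp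
  show "0 + X = X" by transfer simp
  show "- X + X = 0" by transfer simp
  show "X - Y = X + - Y" by transfer simp
qed

end

lemma to_torus_surj: "\<exists>x. to_torus x = X"
  by (rule exI) (rule Quotient3_abs_rep[OF Quotient3_torus])

lemma to_torus_obtain: obtains x where "to_torus x = X"
  using to_torus_surj[of X] by (elim exE)

lemma to_torus_fibre_nonempty: "{z. to_torus z = X} \<noteq> {}"
  using to_torus_surj[of X] by simp

lemma to_torus_add: "to_torus (x + y) = to_torus x + to_torus y"
  by transfer simp

lemma to_torus_diff: "to_torus (x - y) = to_torus x - to_torus y"
  by transfer simp

lemma to_torus_eq_iff: "to_torus x = to_torus y \<longleftrightarrow> (\<forall>i. x $ i - y $ i \<in> \<int>)"
  by (rule torus.abs_eq_iff)

instantiation torus :: (finite) metric_space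
begin

definition dist_torus :: "'a torus \<Rightarrow> 'a torus \<Rightarrow> real" where
  "dist_torus X Y = Inf {norm (x - y) | x y. to_torus x = X \<and> to_torus y = Y}"

definition uniformity_torus :: "('a torus \<times> 'a torus) filter" where
  "uniformity_torus = (INF e\<in>{0 <..}. principal {(x, y). dist x y < e})"

definition open_torus :: "'a torus set \<Rightarrow> bool" where
  "open_torus U \<longleftrightarrow> (\<forall>x\<in>U. \<forall>\<^sub>F (x', y) in uniformity. x' = x \<longrightarrow> y \<in> U)"

lemma dist_torus_infdist:
  fixes X Y :: "'a torus"
  shows "dist X Y = infdist 0 {z. to_torus z = X - Y}"
proof -
  obtain y0 where y0: "to_torus y0 = Y" by (rule to_torus_obtain)
  note ne = to_torus_fibre_nonempty[of "X - Y"]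
  have "{norm (x - y) | x y. to_torus x = X \<and> to_torus y = Y} = norm ` {z. to_torus z = X - Y}"
  proof (intro equalityI subsetI)
    fix r assume "r \<in> {norm (x - y) | x y. to_torus x = X \<and> to_torus y = Y}"
    then obtain x y where "r = norm (x - y)" "to_torus x = X" "to_torus y = Y" by auto
    then show "r \<in> norm ` {z. to_torus z = X - Y}"
      by (intro image_eqI[of _ _ "x - y"]) (simp_all only: mem_Collect_eq to_torus_diff)
  next
    fix r assume "r \<in> norm ` {z. to_torus z = X - Y}"
    then obtain z where z: "to_torus z = X - Y" "r = norm z" by auto
    have "to_torus (z + y0) = X" unfolding to_torus_add z y0 by simp
    then show "r \<in> {norm (x - y) | x y. to_torus x = X \<and> to_torus y = Y}"
      unfolding mem_Collect_eq z(2) using y0 by (intro exI[of _ "z + y0"] exI[of _ y0] conjI) simp_all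
  qed
  moreover have "dist (0 :: real ^ 'a) = norm" by (rule ext) simp
  ultimately show ?thesis
    unfolding dist_torus_def infdist_notempty[OF ne] by (simp only:)
qed

lemma closed_torus_fibre: "closed {z. to_torus z = (X :: 'a torus)}"
proof -
  obtain x0 where x0: "to_torus x0 = X" by (rule to_torus_obtain)
  have "{z. to_torus z = X} = (\<Inter>i. (\<lambda>z. z $ i - x0 $ i) -` \<int>)"
    unfolding x0[symmetric] to_torus_eq_iff by auto
  also have "closed \<dots>"
  proof (intro closed_INT ballI)
    fix i
    have "continuous_on UNIV (\<lambda>z :: real ^ 'a. z $ i - x0 $ i)" by (intro continuous_intros)
    then show "closed ((\<lambda>z. z $ i - x0 $ i) -` \<int>)" by (rule closed_vimage[OF closed_Ints])
  qed
  finally show ?thesis .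
qed

lemma torus_norm_less:
  fixes X :: "'a torus"
  assumes "infdist 0 {z. to_torus z = X} < e"
  obtains z where "to_torus z = X" "norm z < e"
proof -
  have "(INF a\<in>{z. to_torus z = X}. dist 0 a) < e"
    using assms unfolding infdist_notempty[OF to_torus_fibre_nonempty] .
  moreover have "dist 0 ` {z. to_torus z = X} \<noteq> {}"
    unfolding image_is_empty by (rule to_torus_fibre_nonempty)
  ultimately obtain r where "r \<in> dist 0 ` {z. to_torus z = X}" "r < e"
    using cInf_lessD[of "dist 0 ` {z. to_torus z = X}" e] by metis
  then obtain z where "to_torus z = X" "norm z < e" by auto
  then show ?thesis by (rule that)
qed

instance
proof
  fix X Y Z :: "'a torus"
  show "uniformity = (INF e\<in>{0 <..}. principal {(x, y :: 'a torus). dist x y < e})"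
    by (rule uniformity_torus_def)
  show "open U \<longleftrightarrow> (\<forall>x\<in>U. \<forall>\<^sub>F (x', y) in uniformity. x' = x \<longrightarrow> y \<in> U)" for U :: "'a torus set"
    by (rule open_torus_def)
  have z0: "to_torus (0 :: real ^ 'a) = 0" by transfer simp
  show "dist X Y = 0 \<longleftrightarrow> X = Y"
  proof -
    have "dist X Y = 0 \<longleftrightarrow> 0 \<in> {z. to_torus z = X - Y}"
      unfolding dist_torus_infdist
      using in_closed_iff_infdist_zero[OF closed_torus_fibre to_torus_fibre_nonempty, of 0 "X - Y"] by (rule sym)
    also have "\<dots> \<longleftrightarrow> X = Y" using z0 by auto
    finally show ?thesis .
  qed
  show "dist X Y \<le> dist X Z + dist Y Z"
  proof (rule field_le_epsilon)
    fix e :: real assume e: "e > 0"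
    obtain u where u: "to_torus u = X - Z" "norm u < dist X Z + e / 2"
      using torus_norm_less[of "X - Z" "dist X Z + e / 2"] e by (auto simp: dist_torus_infdist)
    obtain v where v: "to_torus v = Y - Z" "norm v < dist Y Z + e / 2"
      using torus_norm_less[of "Y - Z" "dist Y Z + e / 2"] e by (auto simp: dist_torus_infdist)
    have "to_torus (u - v) = X - Y" using u v by (simp add: to_torus_diff)
    then have "dist X Y \<le> norm (u - v)"
      unfolding dist_torus_infdist by (intro infdist_le2[of "u - v"]) auto
    also have "\<dots> \<le> norm u + norm v" by (rule norm_triangle_ineq4)
    finally show "dist X Y \<le> dist X Z + dist Y Z + e" using u v by simp
  qed
qed

end

lemma dist_torus_le_card: "dist (X :: 'n::finite torus) Y \<le> CARD('n)"
proof -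
  obtain z where z: "to_torus z = X - Y" by (rule to_torus_obtain)
  define w :: "real ^ 'n" where "w = (\<chi> i. frac (z $ i))"
  have "to_torus w = to_torus z"
    unfolding to_torus_eq_iff w_def by (simp add: frac_def)
  then have "dist X Y \<le> norm w"
    unfolding dist_torus_infdist using z by (intro infdist_le2[of w]) auto
  also have "\<dots> \<le> (\<Sum>i\<in>UNIV. \<bar>w $ i\<bar>)" by (rule norm_le_l1_cart)
  also have "\<dots> \<le> (\<Sum>i\<in>(UNIV :: 'n set). 1)"
    by (rule sum_mono) (simp add: w_def frac_ge_0 less_imp_le[OF frac_lt_1])
  finally show ?thesis by simp
qed

section \<open>Probability measures on the torus with the 1-Wasserstein distance\<close>

typedef (overloaded) 'n torus_prob =
  "{\<mu> :: 'n::finite torus measure. sets \<mu> = sets borel \<and> prob_space \<mu>}"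
  by (rule exI[of _ "return borel 0"]) (simp add: prob_space_return)

lemma Rep_torus_prob_sets [simp]: "sets (Rep_torus_prob \<mu>) = sets borel"
  using Rep_torus_prob[of \<mu>] by simp

lemma Rep_torus_prob_prob_space: "prob_space (Rep_torus_prob \<mu>)"
  using Rep_torus_prob[of \<mu>] by simp

lemma lipschitz_torus_integrable:
  assumes "C-lipschitz_on UNIV (\<phi> :: 'n::finite torus \<Rightarrow> real)"
  shows "integrable (Rep_torus_prob \<mu>) \<phi>"
proof -
  interpret prob_space "Rep_torus_prob \<mu>" by (rule Rep_torus_prob_prob_space)
  have m: "\<phi> \<in> borel_measurable (Rep_torus_prob \<mu>)"
    using borel_measurable_continuous_onI[OF lipschitz_on_continuous_on[OF assms]]
    by (simp add: measurable_cong_sets[OF Rep_torus_prob_sets refl])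
  have "norm (\<phi> x) \<le> \<bar>\<phi> 0\<bar> + C * CARD('n)" for x
  proof -
    have "\<bar>\<phi> x - \<phi> 0\<bar> \<le> C * dist x 0"
      using lipschitz_onD[OF assms, of x 0] by (simp add: dist_real_def)
    also have "\<dots> \<le> C * CARD('n)"
      by (intro mult_left_mono dist_torus_le_card lipschitz_on_nonneg[OF assms])
    finally show ?thesis by simp
  qed
  then show ?thesis by (intro integrable_const_bound[OF _ m]) auto
qed

instantiation torus_prob :: (finite) metric_space
begin

definition dist_torus_prob :: "'a torus_prob \<Rightarrow> 'a torus_prob \<Rightarrow> real" where
  "dist_torus_prob \<mu> \<nu> = (SUP \<phi>\<in>{\<phi>. 1-lipschitz_on UNIV \<phi>}.
     (\<integral>x. \<phi> x \<partial>Rep_torus_prob \<mu>) - (\<integral>x. \<phi> x \<partial>Rep_torus_prob \<nu>))"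

definition uniformity_torus_prob :: "('a torus_prob \<times> 'a torus_prob) filter" where
  "uniformity_torus_prob = (INF e\<in>{0 <..}. principal {(x, y). dist x y < e})"

definition open_torus_prob :: "'a torus_prob set \<Rightarrow> bool" where
  "open_torus_prob U \<longleftrightarrow> (\<forall>x\<in>U. \<forall>\<^sub>F (x', y) in uniformity. x' = x \<longrightarrow> y \<in> U)"

lemma wasserstein_bdd:
  fixes \<mu> \<nu> :: "'a torus_prob"
  shows "bdd_above ((\<lambda>\<phi>. (\<integral>x. \<phi> x \<partial>Rep_torus_prob \<mu>) - (\<integral>x. \<phi> x \<partial>Rep_torus_prob \<nu>)) `
           {\<phi> :: 'a torus \<Rightarrow> real. 1-lipschitz_on UNIV \<phi>})"
proof (rule bdd_aboveI2)
  fix \<phi> :: "'a torus \<Rightarrow> real" assume "\<phi> \<in> {\<phi>. 1-lipschitz_on UNIV \<phi>}"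
  then have L: "1-lipschitz_on UNIV \<phi>" by simp
  interpret \<mu>: prob_space "Rep_torus_prob \<mu>" by (rule Rep_torus_prob_prob_space)
  interpret \<nu>: prob_space "Rep_torus_prob \<nu>" by (rule Rep_torus_prob_prob_space)
  have b: "\<bar>\<phi> x - \<phi> 0\<bar> \<le> CARD('a)" for x
    using lipschitz_onD[OF L, of x 0] dist_torus_le_card[of x 0] by (simp add: dist_real_def)
  have "(\<integral>x. \<phi> x \<partial>Rep_torus_prob \<mu>) \<le> (\<integral>x. \<phi> 0 + CARD('a) \<partial>Rep_torus_prob \<mu>)"
    using b by (intro integral_mono lipschitz_torus_integrable[OF L]) (auto simp: abs_le_iff algebra_simps)
  moreover have "(\<integral>x. \<phi> 0 - CARD('a) \<partial>Rep_torus_prob \<nu>) \<le> (\<integral>x. \<phi> x \<partial>Rep_torus_prob \<nu>)"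
    using b by (intro integral_mono lipschitz_torus_integrable[OF L]) (auto simp: abs_le_iff algebra_simps)
  ultimately show "(\<integral>x. \<phi> x \<partial>Rep_torus_prob \<mu>) - (\<integral>x. \<phi> x \<partial>Rep_torus_prob \<nu>) \<le> 2 * real CARD('a)"
    by (simp add: \<mu>.prob_space \<nu>.prob_space)
qed

lemma wasserstein_upper:
  fixes \<mu> \<nu> :: "'a torus_prob"
  assumes "1-lipschitz_on UNIV (\<phi> :: 'a torus \<Rightarrow> real)"
  shows "(\<integral>x. \<phi> x \<partial>Rep_torus_prob \<mu>) - (\<integral>x. \<phi> x \<partial>Rep_torus_prob \<nu>) \<le> dist \<mu> \<nu>"
  unfolding dist_torus_prob_def using assms by (intro cSUP_upper wasserstein_bdd) auto

lemma wasserstein_least: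
  fixes \<mu> \<nu> :: "'a torus_prob"
  assumes "\<And>\<phi> :: 'a torus \<Rightarrow> real. 1-lipschitz_on UNIV \<phi> \<Longrightarrow>
     (\<integral>x. \<phi> x \<partial>Rep_torus_prob \<mu>) - (\<integral>x. \<phi> x \<partial>Rep_torus_prob \<nu>) \<le> c"
  shows "dist \<mu> \<nu> \<le> c"
  unfolding dist_torus_prob_def
proof (rule cSUP_least)
  have "1-lipschitz_on UNIV (\<lambda>_ :: 'a torus. 0 :: real)" by (auto intro!: lipschitz_onI)
  then show "{\<phi> :: 'a torus \<Rightarrow> real. 1-lipschitz_on UNIV \<phi>} \<noteq> {}" by blast
qed (use assms in auto)

lemma wasserstein_commute: "dist \<mu> \<nu> = dist \<nu> (\<mu> :: 'a torus_prob)"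
proof -
  have "dist \<mu> \<nu> \<le> dist \<nu> \<mu>" for \<mu> \<nu> :: "'a torus_prob"
  proof (rule wasserstein_least)
    fix \<phi> :: "'a torus \<Rightarrow> real" assume "1-lipschitz_on UNIV \<phi>"
    then have "1-lipschitz_on UNIV (\<lambda>x. - \<phi> x)" by simp
    from wasserstein_upper[OF this, of \<nu> \<mu>]
    show "(\<integral>x. \<phi> x \<partial>Rep_torus_prob \<mu>) - (\<integral>x. \<phi> x \<partial>Rep_torus_prob \<nu>) \<le> dist \<nu> \<mu>" by simp
  qed
  then show ?thesis by (metis order_antisym)
qed

lemma wasserstein_zero:
  fixes \<mu> \<nu> :: "'a torus_prob"
  assumes "dist \<mu> \<nu> = 0"
  shows "\<mu> = \<nu>"
proof -
  have eq1: "(\<integral>x. \<phi> x \<partial>Rep_torus_prob \<mu>) = (\<integral>x. \<phi> x \<partial>Rep_torus_prob \<nu>)"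
    if "1-lipschitz_on UNIV \<phi>" for \<phi> :: "'a torus \<Rightarrow> real"
    using wasserstein_upper[OF that, of \<mu> \<nu>] wasserstein_upper[OF that, of \<nu> \<mu>] assms
      wasserstein_commute[of \<mu> \<nu>] by simp
  have eq: "(\<integral>x. \<phi> x \<partial>Rep_torus_prob \<mu>) = (\<integral>x. \<phi> x \<partial>Rep_torus_prob \<nu>)"
    if "C-lipschitz_on UNIV \<phi>" for C and \<phi> :: "'a torus \<Rightarrow> real"
  proof -
    have C: "C \<ge> 0" by (rule lipschitz_on_nonneg[OF that])
    have "1-lipschitz_on UNIV (\<lambda>x. (1 / (C + 1)) * \<phi> x)"
      using lipschitz_on_mono[OF lipschitz_on_cmult_real[OF that, of "1 / (C + 1)"], of UNIV 1] C
      by (simp add: field_simps)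
    from eq1[OF this] show ?thesis using C by simp
  qed
  have cl: "emeasure (Rep_torus_prob \<mu>) A = emeasure (Rep_torus_prob \<nu>) A"
    if A: "closed A" for A :: "'a torus set"
  proof (cases "A = {}")
    case False
    interpret \<mu>: prob_space "Rep_torus_prob \<mu>" by (rule Rep_torus_prob_prob_space)
    interpret \<nu>: prob_space "Rep_torus_prob \<nu>" by (rule Rep_torus_prob_prob_space)
    define f :: "nat \<Rightarrow> 'a torus \<Rightarrow> real" where "f n x = max 0 (1 - real n * infdist x A)" for n x
    have lip: "(real n)-lipschitz_on UNIV (f n)" for n
    proof (rule lipschitz_onI)
      fix x y :: "'a torus"
      have "dist (f n x) (f n y) \<le> \<bar>real n * infdist x A - real n * infdist y A\<bar>"
        unfolding f_def dist_real_def by linarith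
      also have "\<dots> = real n * \<bar>infdist x A - infdist y A\<bar>"
        by (simp add: abs_mult flip: right_diff_distrib)
      also have "\<dots> \<le> real n * dist x y"
        by (intro mult_left_mono infdist_triangle_abs) auto
      finally show "dist (f n x) (f n y) \<le> real n * dist x y" .
    qed simp
    have bm: "f n \<in> borel_measurable borel" for n
      by (rule borel_measurable_continuous_onI[OF lipschitz_on_continuous_on[OF lip]])
    have lim: "(\<lambda>n. f n x) \<longlonglongrightarrow> indicator A x" for x
    proof (cases "x \<in> A")
      case True then show ?thesis by (simp add: f_def)
    next
      case False
      then have p: "infdist x A > 0"
        using infdist_pos_not_in_closed A \<open>A \<noteq> {}\<close> by blast
      obtain N :: nat where N: "1 / infdist x A < N" using reals_Archimedean2 by blast
      have "f n x = 0" if "n \<ge> N" for n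
      proof -
        have "1 \<le> real N * infdist x A" using N p by (simp add: field_simps)
        also have "\<dots> \<le> real n * infdist x A" using that p by (intro mult_right_mono) auto
        finally show ?thesis by (simp add: f_def)
      qed
      then have "\<forall>\<^sub>F n in sequentially. f n x = 0" by (auto simp: eventually_sequentially)
      then show ?thesis using False by (simp add: tendsto_eventually)
    qed
    have conv: "(\<lambda>n. \<integral>x. f n x \<partial>Rep_torus_prob \<rho>) \<longlonglongrightarrow> measure (Rep_torus_prob \<rho>) A" for \<rho> :: "'a torus_prob"
    proof -
      interpret \<rho>: prob_space "Rep_torus_prob \<rho>" by (rule Rep_torus_prob_prob_space)
      have As: "A \<in> sets (Rep_torus_prob \<rho>)" using A by simp
      have "(\<lambda>n. \<integral>x. f n x \<partial>Rep_torus_prob \<rho>) \<longlonglongrightarrow> (\<integral>x. indicator A x \<partial>Rep_torus_prob \<rho>)"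
      proof (rule integral_dominated_convergence[where w="\<lambda>_. 1"])
        show "f n \<in> borel_measurable (Rep_torus_prob \<rho>)" for n
          using bm by (simp add: measurable_cong_sets[OF Rep_torus_prob_sets refl])
        show "AE x in Rep_torus_prob \<rho>. norm (f n x) \<le> 1" for n
          by (auto simp: f_def infdist_nonneg)
        show "indicator A \<in> borel_measurable (Rep_torus_prob \<rho>)"
          using As by (rule borel_measurable_indicator)
      qed (use lim in auto)
      then show ?thesis using As by simp
    qed
    have "measure (Rep_torus_prob \<mu>) A = measure (Rep_torus_prob \<nu>) A"
      by (rule LIMSEQ_unique[OF conv[of \<mu>]]) (use conv[of \<nu>] eq[OF lip] in simp)
    then show ?thesis by (simp add: \<mu>.emeasure_eq_measure \<nu>.emeasure_eq_measure)
  qed simp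
  have "Rep_torus_prob \<mu> = Rep_torus_prob \<nu>"
  proof (rule measure_eqI_generator_eq[where E="{A. closed A}" and \<Omega>=UNIV and A="\<lambda>_. UNIV"])
    show "emeasure (Rep_torus_prob \<mu>) UNIV \<noteq> \<infinity>"
      using finite_measure.emeasure_finite[OF prob_space.finite_measure[OF Rep_torus_prob_prob_space]]
      by (auto simp: top_unique)
    show "sets (Rep_torus_prob \<mu>) = sigma_sets UNIV {A. closed A}"
      by (simp add: borel_eq_closed)
    show "sets (Rep_torus_prob \<nu>) = sigma_sets UNIV {A. closed A}"
      by (simp add: borel_eq_closed)
  qed (use cl in \<open>auto simp: Int_stable_def\<close>)
  then show ?thesis by (simp add: Rep_torus_prob_inject)
qed

instance
proof
  fix \<mu> \<nu> \<rho> :: "'a torus_prob"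
  show "uniformity = (INF e\<in>{0 <..}. principal {(x, y :: 'a torus_prob). dist x y < e})"
    by (rule uniformity_torus_prob_def)
  show "open U \<longleftrightarrow> (\<forall>x\<in>U. \<forall>\<^sub>F (x', y) in uniformity. x' = x \<longrightarrow> y \<in> U)" for U :: "'a torus_prob set"
    by (rule open_torus_prob_def)
  have "dist \<mu> \<mu> = 0"
  proof (rule antisym)
    show "dist \<mu> \<mu> \<le> 0" by (rule wasserstein_least) simp
    show "0 \<le> dist \<mu> \<mu>"
      using wasserstein_upper[of "\<lambda>_. 0" \<mu> \<mu>] by (simp add: lipschitz_on_def)
  qed
  then show "dist \<mu> \<nu> = 0 \<longleftrightarrow> \<mu> = \<nu>" using wasserstein_zero by blast
  show "dist \<mu> \<nu> \<le> dist \<mu> \<rho> + dist \<nu> \<rho>"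
  proof (rule wasserstein_least)
    fix \<phi> :: "'a torus \<Rightarrow> real" assume L: "1-lipschitz_on UNIV \<phi>"
    show "(\<integral>x. \<phi> x \<partial>Rep_torus_prob \<mu>) - (\<integral>x. \<phi> x \<partial>Rep_torus_prob \<nu>) \<le> dist \<mu> \<rho> + dist \<nu> \<rho>"
      using wasserstein_upper[OF L, of \<mu> \<rho>] wasserstein_upper[OF L, of \<rho> \<nu>]
        wasserstein_commute[of \<nu> \<rho>] by simp
  qed
qed

end

definition law :: "'w measure \<Rightarrow> ('w \<Rightarrow> 'n::finite torus) \<Rightarrow> 'n torus_prob" where
  "law M X = Abs_torus_prob (distr M borel X)"

section \<open>The stochastic basis\<close>

text \<open>
  Only the times in \<open>[0, T]\<close> play a role, and only the \<open>\<sigma>\<close>-algebras of the measures \<open>F t\<close>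
  are used. The values \<open>W t\<close> with \<open>t \<in> [0, T]\<close> form a Brownian motion relative to \<open>F\<close>, so that
  \<open>W\<close> is independent of \<open>F 0\<close>.
\<close>

locale stochastic_basis = prob_space M
  for M :: "'w measure" +
  fixes T :: real
    and F :: "real \<Rightarrow> 'w measure"
    and W :: "real \<Rightarrow> 'w \<Rightarrow> real ^ 'n::finite"
  assumes F_subalgebra: "\<And>t. t \<in> {0..T} \<Longrightarrow> subalgebra M (F t)"
    and F_mono: "\<And>s t. 0 \<le> s \<Longrightarrow> s \<le> t \<Longrightarrow> t \<le> T \<Longrightarrow> sets (F s) \<subseteq> sets (F t)"
    and F_complete: "\<And>N A. N \<in> null_sets M \<Longrightarrow> A \<subseteq> N \<Longrightarrow> A \<in> sets (F 0)"
    and F_right_continuous: "\<And>t. 0 \<le> t \<Longrightarrow> t < T \<Longrightarrow> (\<Inter>s\<in>{t<..T}. sets (F s)) = sets (F t)"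
    and W_adapted: "\<And>t. t \<in> {0..T} \<Longrightarrow> W t \<in> F t \<rightarrow>\<^sub>M borel"
    and W_start: "AE \<omega> in M. W 0 \<omega> = 0"
    and W_continuous: "AE \<omega> in M. continuous_on {0..T} (\<lambda>t. W t \<omega>)"
    and W_increment_indep: "\<And>s t. 0 \<le> s \<Longrightarrow> s < t \<Longrightarrow> t \<le> T \<Longrightarrow>
      indep_set (sets (F s)) (sets (vimage_algebra (space M) (\<lambda>\<omega>. W t \<omega> - W s \<omega>) borel))"
    and W_increment_normal: "\<And>s t. 0 \<le> s \<Longrightarrow> s < t \<Longrightarrow> t \<le> T \<Longrightarrow>
      distributed M lborel (\<lambda>\<omega>. W t \<omega> - W s \<omega>)
        (\<lambda>x. ennreal (\<Prod>i\<in>UNIV. normal_density 0 (sqrt (t - s)) (x $ i)))"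
    and F0_atomless: "\<And>A. A \<in> sets (F 0) \<Longrightarrow> measure M A > 0 \<Longrightarrow>
      \<exists>B\<in>sets (F 0). B \<subseteq> A \<and> 0 < measure M B \<and> measure M B < measure M A"
    and F_generated: "\<And>t. t \<in> {0..T} \<Longrightarrow> sets (F t) = sigma_sets (space M)
      (sets (F 0) \<union> (\<Union>s\<in>{0..t}. sets (vimage_algebra (space M) (W s) borel)) \<union> null_sets M)"

section \<open>Controls and strategies\<close>

text \<open>
  Processes on \<open>[t\<^sub>0, T]\<close> are functions on all of \<open>real\<close> whose values outside \<open>[t\<^sub>0, T]\<close> are
  irrelevant: by the condition with \<open>t = T\<close>, a non-anticipative map does not depend on them.
\<close>

definition controls ::
  "(real \<Rightarrow> 'w measure) \<Rightarrow> real \<Rightarrow> 'a::metric_space set \<Rightarrow> real \<Rightarrow> (real \<Rightarrow> 'w \<Rightarrow> 'a) set" where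
  "controls F T A t0 = {\<alpha>. \<forall>t\<in>{t0..T}.
     (\<lambda>(s, \<omega>). \<alpha> s \<omega>) \<in> restrict_space borel {t0..t} \<Otimes>\<^sub>M F t \<rightarrow>\<^sub>M restrict_space borel A}"

definition agree_until ::
  "'w measure \<Rightarrow> real \<Rightarrow> real \<Rightarrow> (real \<Rightarrow> 'w \<Rightarrow> 'a) \<Rightarrow> (real \<Rightarrow> 'w \<Rightarrow> 'a) \<Rightarrow> bool" where
  "agree_until M t0 t \<alpha> \<alpha>' \<longleftrightarrow>
     (AE \<omega> in M. AE r in lborel. r \<in> {t0..t} \<longrightarrow> \<alpha> r \<omega> = \<alpha>' r \<omega>)"

text \<open>Strategies of a player with control set \<open>A\<close> against an opponent with control set \<open>B\<close>.\<close>

definition strategies ::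
  "'w measure \<Rightarrow> (real \<Rightarrow> 'w measure) \<Rightarrow> real \<Rightarrow> 'b::metric_space set \<Rightarrow> 'a::metric_space set \<Rightarrow> real
     \<Rightarrow> ((real \<Rightarrow> 'w \<Rightarrow> 'b) \<Rightarrow> (real \<Rightarrow> 'w \<Rightarrow> 'a)) set" where
  "strategies M F T B A t0 = {S.
     (\<forall>\<beta>\<in>controls F T B t0. S \<beta> \<in> controls F T A t0) \<and>
     (\<forall>t\<in>{t0..T}. \<forall>\<beta>\<in>controls F T B t0. \<forall>\<beta>'\<in>controls F T B t0.
        agree_until M t0 t \<beta> \<beta>' \<longrightarrow> agree_until M t0 t (S \<beta>) (S \<beta>'))}"

section \<open>The controlled McKean--Vlasov dynamics, payoff and value functions\<close>

text \<open>
  The noise is additive, so the equation involves no stochastic integral; \<open>+\<close> on the right-hand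
  side is the group operation of the torus.
\<close>

definition mkv_solution ::
  "'w measure \<Rightarrow> (real \<Rightarrow> 'w measure) \<Rightarrow> (real \<Rightarrow> 'w \<Rightarrow> real ^ 'n::finite) \<Rightarrow> real
     \<Rightarrow> ('n torus \<Rightarrow> 'a \<Rightarrow> 'b \<Rightarrow> 'n torus_prob \<Rightarrow> real ^ 'n)
     \<Rightarrow> real \<Rightarrow> ('w \<Rightarrow> 'n torus) \<Rightarrow> (real \<Rightarrow> 'w \<Rightarrow> 'a) \<Rightarrow> (real \<Rightarrow> 'w \<Rightarrow> 'b)
     \<Rightarrow> (real \<Rightarrow> 'w \<Rightarrow> 'n torus) \<Rightarrow> bool" where
  "mkv_solution M F W T b t0 \<xi> \<alpha>1 \<alpha>2 X \<longleftrightarrow>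
     (\<forall>t\<in>{t0..T}. X t \<in> F t \<rightarrow>\<^sub>M borel) \<and>
     (AE \<omega> in M. continuous_on {t0..T} (\<lambda>t. X t \<omega>)) \<and>
     (AE \<omega> in M. set_integrable lborel {t0..T}
        (\<lambda>s. b (X s \<omega>) (\<alpha>1 s \<omega>) (\<alpha>2 s \<omega>) (law M (X s)))) \<and>
     (AE \<omega> in M. \<forall>t\<in>{t0..T}. X t \<omega> = \<xi> \<omega> +
        to_torus ((LINT s:{t0..t}|lborel. b (X s \<omega>) (\<alpha>1 s \<omega>) (\<alpha>2 s \<omega>) (law M (X s)))
                  + sqrt 2 *\<^sub>R (W t \<omega> - W t0 \<omega>)))"

text \<open>
  For \<open>b\<close> bounded and Lipschitz in \<open>(x, m)\<close> the solution exists and is unique up to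
  indistinguishability, so the payoff does not depend on the choice made by \<open>SOME\<close>.
\<close>

definition payoff ::
  "'w measure \<Rightarrow> (real \<Rightarrow> 'w measure) \<Rightarrow> (real \<Rightarrow> 'w \<Rightarrow> real ^ 'n::finite) \<Rightarrow> real
     \<Rightarrow> ('n torus \<Rightarrow> 'a \<Rightarrow> 'b \<Rightarrow> 'n torus_prob \<Rightarrow> real ^ 'n)
     \<Rightarrow> ('n torus \<Rightarrow> 'a \<Rightarrow> 'b \<Rightarrow> 'n torus_prob \<Rightarrow> real)
     \<Rightarrow> ('n torus_prob \<Rightarrow> real)
     \<Rightarrow> real \<Rightarrow> ('w \<Rightarrow> 'n torus) \<Rightarrow> (real \<Rightarrow> 'w \<Rightarrow> 'a) \<Rightarrow> (real \<Rightarrow> 'w \<Rightarrow> 'b) \<Rightarrow> real" where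
  "payoff M F W T b L G t0 \<xi> \<alpha>1 \<alpha>2 =
     (let X = (SOME X. mkv_solution M F W T b t0 \<xi> \<alpha>1 \<alpha>2 X) in
      (\<integral>\<omega>. (LINT t:{t0..T}|lborel. L (X t \<omega>) (\<alpha>1 t \<omega>) (\<alpha>2 t \<omega>) (law M (X t)))
            + G (law M (X T)) \<partial>M))"

definition initial_states ::
  "'w measure \<Rightarrow> (real \<Rightarrow> 'w measure) \<Rightarrow> 'n::finite torus_prob \<Rightarrow> ('w \<Rightarrow> 'n torus) set" where
  "initial_states M F m0 = {\<xi>. \<xi> \<in> F 0 \<rightarrow>\<^sub>M borel \<and> law M \<xi> = m0}"

text \<open>
  The values at \<open>(t\<^sub>0, m\<^sub>0)\<close>, computed from a given \<open>\<xi>\<close> with law \<open>m\<^sub>0\<close>. In \<open>ereal\<close> every supremum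
  and infimum exists; under the boundedness of \<open>L\<close> and \<open>G\<close> all of them are finite.
\<close>

definition lower_value ::
  "'w measure \<Rightarrow> (real \<Rightarrow> 'w measure) \<Rightarrow> (real \<Rightarrow> 'w \<Rightarrow> real ^ 'n::finite) \<Rightarrow> real
     \<Rightarrow> 'a::metric_space set \<Rightarrow> 'b::metric_space set
     \<Rightarrow> ('n torus \<Rightarrow> 'a \<Rightarrow> 'b \<Rightarrow> 'n torus_prob \<Rightarrow> real ^ 'n)
     \<Rightarrow> ('n torus \<Rightarrow> 'a \<Rightarrow> 'b \<Rightarrow> 'n torus_prob \<Rightarrow> real)
     \<Rightarrow> ('n torus_prob \<Rightarrow> real)
     \<Rightarrow> real \<Rightarrow> ('w \<Rightarrow> 'n torus) \<Rightarrow> ereal" where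
  "lower_value M F W T A1 A2 b L G t0 \<xi> =
     (INF S2\<in>strategies M F T A1 A2 t0. SUP \<alpha>1\<in>controls F T A1 t0.
        ereal (payoff M F W T b L G t0 \<xi> \<alpha>1 (S2 \<alpha>1)))"

definition upper_value ::
  "'w measure \<Rightarrow> (real \<Rightarrow> 'w measure) \<Rightarrow> (real \<Rightarrow> 'w \<Rightarrow> real ^ 'n::finite) \<Rightarrow> real
     \<Rightarrow> 'a::metric_space set \<Rightarrow> 'b::metric_space set
     \<Rightarrow> ('n torus \<Rightarrow> 'a \<Rightarrow> 'b \<Rightarrow> 'n torus_prob \<Rightarrow> real ^ 'n)
     \<Rightarrow> ('n torus \<Rightarrow> 'a \<Rightarrow> 'b \<Rightarrow> 'n torus_prob \<Rightarrow> real)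
     \<Rightarrow> ('n torus_prob \<Rightarrow> real)
     \<Rightarrow> real \<Rightarrow> ('w \<Rightarrow> 'n torus) \<Rightarrow> ereal" where
  "upper_value M F W T A1 A2 b L G t0 \<xi> =
     (SUP S1\<in>strategies M F T A2 A1 t0. INF \<alpha>2\<in>controls F T A2 t0.
        ereal (payoff M F W T b L G t0 \<xi> (S1 \<alpha>2) \<alpha>2))"

section \<open>The Hamiltonians\<close>

text \<open>For compact nonempty control sets and continuous data the extrema are attained.\<close>

definition hamiltonian_minus ::
  "'a set \<Rightarrow> 'b set \<Rightarrow> ('x \<Rightarrow> 'a \<Rightarrow> 'b \<Rightarrow> 'm \<Rightarrow> 'v::real_inner)
     \<Rightarrow> ('x \<Rightarrow> 'a \<Rightarrow> 'b \<Rightarrow> 'm \<Rightarrow> real) \<Rightarrow> 'x \<Rightarrow> 'v \<Rightarrow> 'm \<Rightarrow> real" where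
  "hamiltonian_minus A1 A2 b L x p m =
     (INF a1\<in>A1. SUP a2\<in>A2. - L x a1 a2 m - b x a1 a2 m \<bullet> p)"

definition hamiltonian_plus ::
  "'a set \<Rightarrow> 'b set \<Rightarrow> ('x \<Rightarrow> 'a \<Rightarrow> 'b \<Rightarrow> 'm \<Rightarrow> 'v::real_inner)
     \<Rightarrow> ('x \<Rightarrow> 'a \<Rightarrow> 'b \<Rightarrow> 'm \<Rightarrow> real) \<Rightarrow> 'x \<Rightarrow> 'v \<Rightarrow> 'm \<Rightarrow> real" where
  "hamiltonian_plus A1 A2 b L x p m =
     (SUP a2\<in>A2. INF a1\<in>A1. - L x a1 a2 m - b x a1 a2 m \<bullet> p)"

end

theory Submission
  imports Defs
begin

text \<open>
  Both players act on a state with additive noise. If one noise and one initial state drive two plays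
  \<open>X\<close> and \<open>Y\<close> of the game, the noise cancels in \<open>X - Y\<close>, which is the projection of the time integral \<open>D\<close> of
  the difference of the drifts. The comparison of two plays is thus a matter of ordinary differential
  inequalities, and the equality of the values follows by the extremal aiming of Krasovskii and Subbotin,
  without a Hamilton-Jacobi equation on the space of measures.

  Take a partition of the time interval. In the play \<open>X\<close> player 1 answers the control \<open>\<alpha>2\<close> of player 2 by a response
  \<open>f\<close>, in the play \<open>Y\<close> player 2 answers the control \<open>\<beta>1\<close> of player 1 by a response \<open>g\<close>; responses are non-anticipative
  at the grid points only. The controls \<open>\<alpha>2\<close> and \<open>\<beta>1\<close> are kept constant in time on each cell, at values chosen from
  the data at its beginning \<open>r\<close>: they form an approximate saddle of \<open>\<kappa> * L + p \<bullet> b\<close> at \<open>X r\<close> and its law, where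
  \<open>p = D r\<close> and \<open>\<kappa>\<close> is the positive part of the difference of the expected running costs up to time \<open>r\<close>. The Isaacs
  condition provides the saddle (\<open>saddle_exists\<close>), and the choice can be made measurably (\<open>saddle_selection\<close>). The
  sum of the mean square of \<open>D\<close> and of \<open>\<kappa>\<^sup>2\<close> then satisfies a discrete Gronwall inequality (\<open>energy_step\<close>) with initial
  value \<open>0\<close> and a source that vanishes with the mesh and the saddle error. At the final time the laws are close
  and the cost of \<open>X\<close> hardly exceeds that of \<open>Y\<close>. This is \<open>coupled_play\<close>: the payoff of \<open>(f \<alpha>2, \<alpha>2)\<close> is at most that of
  \<open>(\<beta>1, g \<beta>1)\<close> plus \<open>\<epsilon>\<close>.

  Since strategies are responses, \<open>U\<^sup>+ \<le> U\<^sup>-\<close> is immediate. For the converse, consider the discretised game in which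
  in every cell one player moves first and the other one answers. It is a finite game of perfect information.
  For every threshold either the first mover can enforce it, and then does so with a delay, by a strategy in
  the sense of the values; or the second mover can prevent it by a response (\<open>determined\<close>). If \<open>U\<^sup>+ < U\<^sup>-\<close>, two
  thresholds in between lead to responses \<open>f\<close> and \<open>g\<close> that contradict \<open>coupled_play\<close>.

  All this rests on the well-posedness of the McKean--Vlasov equation (\<open>state_exists\<close>, \<open>mkv_solution_unique\<close>). Uniqueness
  up to time \<open>t\<close> for controls that agree up to time \<open>t\<close> makes the construction cell by cell consistent.
\<close>

section \<open>The torus, laws and measurability\<close>

lemma dist_to_torus_le: "dist (to_torus x) (to_torus y) \<le> norm (x - y)"
  unfolding dist_torus_infdist to_torus_diff[symmetric]
  by (rule infdist_le2[of "x - y"]) auto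

lemma dist_torus_add_right: "dist (X + Z) (Y + Z) = dist X (Y :: 'n::finite torus)"
  unfolding dist_torus_infdist by simp

lemma dist_torus_add_left: "dist (Z + X) (Z + Y) = dist X (Y :: 'n::finite torus)"
  unfolding dist_torus_infdist by simp

lemma dist_torus_add_le:
  "dist (X + Y) (X' + Y') \<le> dist X X' + dist Y (Y' :: 'n::finite torus)"
  using dist_triangle[of "X + Y" "X' + Y'" "X' + Y"]
  by (simp add: dist_torus_add_right dist_torus_add_left)

lemma continuous_on_to_torus: "continuous_on S to_torus"
proof (rule lipschitz_on_continuous_on)
  show "1-lipschitz_on S to_torus"
    by (rule lipschitz_onI) (auto simp: dist_norm intro: dist_to_torus_le)
qed

lemma continuous_on_torus_add [continuous_intros]:
  fixes f g :: "'x::metric_space \<Rightarrow> 'n::finite torus"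
  assumes "continuous_on S f" "continuous_on S g"
  shows "continuous_on S (\<lambda>x. f x + g x)"
  unfolding continuous_on_def
proof
  fix x assume x: "x \<in> S"
  have "((\<lambda>y. dist (f y) (f x)) \<longlongrightarrow> 0) (at x within S)" "((\<lambda>y. dist (g y) (g x)) \<longlongrightarrow> 0) (at x within S)"
    using assms x unfolding continuous_on_def by (blast intro: tendsto_dist_iff[THEN iffD1])+
  from tendsto_add[OF this]
  have "((\<lambda>y. dist (f y) (f x) + dist (g y) (g x)) \<longlongrightarrow> 0) (at x within S)"
    by simp
  moreover have "\<forall>\<^sub>F y in at x within S. norm (dist (f y + g y) (f x + g x)) \<le> dist (f y) (f x) + dist (g y) (g x)"
    by (rule always_eventually) (simp add: dist_torus_add_le)
  ultimately have "((\<lambda>y. dist (f y + g y) (f x + g x)) \<longlongrightarrow> 0) (at x within S)"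
    by (rule Lim_null_comparison[rotated])
  then show "((\<lambda>x. f x + g x) \<longlongrightarrow> f x + g x) (at x within S)"
    by (rule tendsto_dist_iff[THEN iffD2])
qed

text \<open>
  Openness of the projection carries a countable basis of \<open>real ^ 'n\<close> over to the torus.
\<close>

lemma open_to_torus_image:
  assumes "open U"
  shows "open (to_torus ` U)"
  unfolding open_dist
proof
  fix X assume "X \<in> to_torus ` U"
  then obtain x where x: "x \<in> U" "X = to_torus x" by auto
  obtain e where e: "e > 0" "ball x e \<subseteq> U" using assms x by (meson open_contains_ball)
  show "\<exists>e>0. \<forall>y. dist y X < e \<longrightarrow> y \<in> to_torus ` U"
  proof (intro exI[of _ e] conjI allI impI)
    fix Y assume "dist Y X < e"
    then obtain z where z: "to_torus z = Y - X" "norm z < e"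
      using torus_norm_less[of "Y - X" e] unfolding dist_torus_infdist by blast
    have "to_torus (z + x) = Y" by (simp add: to_torus_add z x)
    moreover have "z + x \<in> U" using e z by (auto simp: dist_norm subset_iff)
    ultimately show "Y \<in> to_torus ` U" by blast
  qed (rule e)
qed

instance torus :: (finite) second_countable_topology
proof
  obtain B :: "(real ^ 'a) set set" where B: "countable B" "topological_basis B"
    using ex_countable_basis by auto
  let ?B = "image to_torus ` B"
  have "topological_basis ?B"
  proof (rule topological_basisI)
    show "\<And>S. S \<in> ?B \<Longrightarrow> open S" using B by (auto intro: open_to_torus_image topological_basis_open)
    fix O' :: "'a torus set" and X assume O: "open O'" "X \<in> O'"
    obtain x where x: "to_torus x = X" by (rule to_torus_obtain)
    have "open (to_torus -` O')"
      using open_vimage[OF O(1) continuous_on_to_torus] .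
    moreover have "x \<in> to_torus -` O'" using O x by simp
    ultimately obtain S where S: "S \<in> B" "x \<in> S" "S \<subseteq> to_torus -` O'"
      by (rule topological_basisE[OF B(2)])
    show "\<exists>B'\<in>?B. X \<in> B' \<and> B' \<subseteq> O'"
    proof (rule bexI[of _ "to_torus ` S"])
      show "X \<in> to_torus ` S \<and> to_torus ` S \<subseteq> O'" using S x unfolding image_subset_iff_subset_vimage by blast
    qed (use S in simp)
  qed
  moreover have "countable ?B" using B(1) by simp
  ultimately show "\<exists>B :: 'a torus set set. countable B \<and> open = generate_topology B"
    by (intro exI[of _ ?B] conjI topological_basis_imp_subbasis)
qed

lemma measurable_to_torus [measurable]: "to_torus \<in> borel \<rightarrow>\<^sub>M borel"
  by (rule borel_measurable_continuous_onI[OF continuous_on_to_torus])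

lemma measurable_torus_add [measurable (raw)]:
  fixes f g :: "'x \<Rightarrow> 'n::finite torus"
  assumes "f \<in> N \<rightarrow>\<^sub>M borel" "g \<in> N \<rightarrow>\<^sub>M borel"
  shows "(\<lambda>x. f x + g x) \<in> N \<rightarrow>\<^sub>M borel"
  by (rule borel_measurable_continuous_Pair[OF assms]) (intro continuous_intros)

lemma Rep_law:
  assumes "prob_space M" "X \<in> M \<rightarrow>\<^sub>M borel"
  shows "Rep_torus_prob (law M X) = distr M borel X"
  unfolding law_def using assms
  by (intro Abs_torus_prob_inverse) (auto intro: prob_space.prob_space_distr)

lemma bounded_torus_dist_integrable:
  assumes "prob_space M" and [measurable]: "X \<in> M \<rightarrow>\<^sub>M borel" "Y \<in> M \<rightarrow>\<^sub>M borel"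
  shows "integrable M (\<lambda>w. dist (X w) (Y w :: 'n::finite torus))"
proof -
  interpret prob_space M by fact
  show ?thesis
    by (rule integrable_const_bound[where B="CARD('n)"]) (auto simp: dist_torus_le_card)
qed

text \<open>
  The pair \<open>(X, Y)\<close> is a coupling of the two laws, and every coupling bounds the dual supremum that
  defines the Wasserstein distance.
\<close>

lemma dist_law_le:
  assumes M: "prob_space M" and X[measurable]: "X \<in> M \<rightarrow>\<^sub>M borel" and Y[measurable]: "Y \<in> M \<rightarrow>\<^sub>M borel"
  shows "dist (law M X) (law M Y) \<le> (\<integral>w. dist (X w) (Y w :: 'n::finite torus) \<partial>M)"
proof (rule wasserstein_least)
  fix \<phi> :: "'n torus \<Rightarrow> real" assume L: "1-lipschitz_on UNIV \<phi>"
  have [measurable]: "\<phi> \<in> borel_measurable borel"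
    by (rule borel_measurable_continuous_onI[OF lipschitz_on_continuous_on[OF L]])
  have i: "integrable M (\<lambda>w. \<phi> (Z w))" if [measurable]: "Z \<in> M \<rightarrow>\<^sub>M borel" for Z
    using lipschitz_torus_integrable[OF L, of "law M Z"]
    unfolding Rep_law[OF M that] by (subst (asm) integrable_distr_eq) auto
  have "(\<integral>x. \<phi> x \<partial>Rep_torus_prob (law M X)) - (\<integral>x. \<phi> x \<partial>Rep_torus_prob (law M Y))
      = (\<integral>w. \<phi> (X w) - \<phi> (Y w) \<partial>M)"
    using i[OF X] i[OF Y] by (simp add: Rep_law[OF M X] Rep_law[OF M Y] integral_distr)
  also have "\<dots> \<le> (\<integral>w. dist (X w) (Y w) \<partial>M)"
  proof (rule integral_mono)
    show "\<phi> (X w) - \<phi> (Y w) \<le> dist (X w) (Y w)" for w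
      using lipschitz_onD[OF L, of "X w" "Y w"] by (simp add: dist_real_def)
  next
    show "integrable M (\<lambda>w. \<phi> (X w) - \<phi> (Y w))"
      by (intro Bochner_Integration.integrable_diff i X Y)
    show "integrable M (\<lambda>w. dist (X w) (Y w))"
      by (rule bounded_torus_dist_integrable[OF M X Y])
  qed
  finally show "(\<integral>x. \<phi> x \<partial>Rep_torus_prob (law M X)) - (\<integral>x. \<phi> x \<partial>Rep_torus_prob (law M Y))
    \<le> (\<integral>w. dist (X w) (Y w) \<partial>M)" .
qed

lemma dist_law_le_AE:
  assumes M: "prob_space M" and X[measurable]: "X \<in> M \<rightarrow>\<^sub>M borel" and Y[measurable]: "Y \<in> M \<rightarrow>\<^sub>M borel"
    and "AE w in M. dist (X w) (Y w :: 'n::finite torus) \<le> c"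
  shows "dist (law M X) (law M Y) \<le> c"
proof -
  interpret prob_space M by fact
  note dist_law_le[OF M X Y]
  also have "(\<integral>w. dist (X w) (Y w) \<partial>M) \<le> (\<integral>w. c \<partial>M)"
    by (intro integral_mono_AE bounded_torus_dist_integrable M assms) auto
  finally show ?thesis by (simp add: prob_space)
qed

lemma law_cong_AE:
  assumes M: "prob_space M" and "X \<in> M \<rightarrow>\<^sub>M borel" "Y \<in> M \<rightarrow>\<^sub>M borel"
    and "AE w in M. X w = (Y w :: 'n::finite torus)"
  shows "law M X = law M Y"
proof -
  have "AE w in M. dist (X w) (Y w) \<le> 0" using assms(4) by eventually_elim simp
  from dist_law_le_AE[OF assms(1-3) this] show ?thesis by simp
qed

lemma dist_torus_prob_le_card: "dist (\<mu> :: 'n::finite torus_prob) \<nu> \<le> 2 * real CARD('n)"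
proof (rule wasserstein_least)
  fix \<phi> :: "'n torus \<Rightarrow> real" assume L: "1-lipschitz_on UNIV \<phi>"
  interpret \<mu>: prob_space "Rep_torus_prob \<mu>" by (rule Rep_torus_prob_prob_space)
  interpret \<nu>: prob_space "Rep_torus_prob \<nu>" by (rule Rep_torus_prob_prob_space)
  have b: "\<bar>\<phi> x - \<phi> 0\<bar> \<le> CARD('n)" for x
    using lipschitz_onD[OF L, of x 0] dist_torus_le_card[of x 0] by (simp add: dist_real_def)
  have "(\<integral>x. \<phi> x \<partial>Rep_torus_prob \<mu>) \<le> (\<integral>x. \<phi> 0 + CARD('n) \<partial>Rep_torus_prob \<mu>)"
    using b by (intro integral_mono lipschitz_torus_integrable[OF L]) (auto simp: abs_le_iff algebra_simps)
  moreover have "(\<integral>x. \<phi> 0 - CARD('n) \<partial>Rep_torus_prob \<nu>) \<le> (\<integral>x. \<phi> x \<partial>Rep_torus_prob \<nu>)"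
    using b by (intro integral_mono lipschitz_torus_integrable[OF L]) (auto simp: abs_le_iff algebra_simps)
  ultimately show "(\<integral>x. \<phi> x \<partial>Rep_torus_prob \<mu>) - (\<integral>x. \<phi> x \<partial>Rep_torus_prob \<nu>) \<le> 2 * real CARD('n)"
    by (simp add: \<mu>.prob_space \<nu>.prob_space)
qed

text \<open>
  The control sets are compact subsets of arbitrary metric spaces. Separability is therefore a property
  of sets here, not a type class.
\<close>

definition separable_set :: "'a::metric_space set \<Rightarrow> bool" where
  "separable_set A \<longleftrightarrow> (\<exists>D. countable D \<and> D \<subseteq> A \<and> (\<forall>x\<in>A. \<forall>e>0. \<exists>d\<in>D. dist x d < e))"

lemma compact_separable_set:
  assumes "compact A"
  shows "separable_set A"
proof -
  have "\<exists>K. finite K \<and> K \<subseteq> A \<and> A \<subseteq> (\<Union>x\<in>K. ball x (1 / Suc n))" for n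
    using seq_compact_imp_totally_bounded[OF compact_imp_seq_compact[OF assms]] by simp
  then obtain K where K: "\<And>n. finite (K n)" "\<And>n. K n \<subseteq> A" "\<And>n. A \<subseteq> (\<Union>x\<in>K n. ball x (1 / Suc n))"
    by metis
  show ?thesis unfolding separable_set_def
  proof (intro exI[of _ "\<Union>n. K n"] conjI ballI allI impI)
    show "countable (\<Union>n. K n)" using K(1) by (auto intro: countable_finite)
    show "(\<Union>n. K n) \<subseteq> A" using K(2) by auto
    fix x e assume x: "x \<in> A" and e: "e > (0::real)"
    then obtain n where n: "1 / Suc n < e" using nat_approx_posE by blast
    obtain d where "d \<in> K n" "dist d x < 1 / Suc n" using K(3)[of n] x by auto
    then show "\<exists>d\<in>\<Union>n. K n. dist x d < e" using n by (auto simp: dist_commute intro!: bexI[of _ d])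
  qed
qed

lemma separable_set_UNIV: "separable_set (UNIV :: 'a::{metric_space, second_countable_topology} set)"
proof -
  obtain D :: "'a set" where D: "countable D" "\<And>X. open X \<Longrightarrow> X \<noteq> {} \<Longrightarrow> \<exists>d\<in>D. d \<in> X"
    using countable_dense_setE by blast
  show ?thesis unfolding separable_set_def
  proof (intro exI[of _ D] conjI ballI allI impI)
    fix x :: 'a and e :: real assume "e > 0"
    then show "\<exists>d\<in>D. dist x d < e" using D(2)[of "ball x e"] by auto
  qed (use D in auto)
qed

lemma separable_set_Times:
  assumes "separable_set A" "separable_set B"
  shows "separable_set (A \<times> B)"
proof -
  obtain D E where D: "countable D" "D \<subseteq> A" "\<And>x e. x \<in> A \<Longrightarrow> e > 0 \<Longrightarrow> \<exists>d\<in>D. dist x d < e"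
    and E: "countable E" "E \<subseteq> B" "\<And>x e. x \<in> B \<Longrightarrow> e > 0 \<Longrightarrow> \<exists>d\<in>E. dist x d < e"
    using assms unfolding separable_set_def by metis
  show ?thesis unfolding separable_set_def
  proof (intro exI[of _ "D \<times> E"] conjI ballI allI impI)
    fix z e assume z: "z \<in> A \<times> B" and e: "e > (0::real)"
    obtain d where d: "d \<in> D" "dist (fst z) d < e / 2" using D(3)[of "fst z" "e/2"] z e by auto
    obtain d' where d': "d' \<in> E" "dist (snd z) d' < e / 2" using E(3)[of "snd z" "e/2"] z e by auto
    have "dist z (d, d') \<le> dist (fst z) d + dist (snd z) d'"
      unfolding dist_prod_def by (simp add: sqrt_sum_squares_le_sum)
    then show "\<exists>d\<in>D \<times> E. dist z d < e" using d d' by (intro bexI[of _ "(d, d')"]) auto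
  qed (use D E in auto)
qed

lemma dist_prod_le: "dist (x, y) (x', y') \<le> dist x x' + dist y y'"
  unfolding dist_prod_def by (simp add: sqrt_sum_squares_le_sum)

text \<open>
  Every relatively open subset of a product of separable sets is a countable union of products of
  balls. For types that are not second countable this replaces the identification of the Borel
  \<open>\<sigma>\<close>-algebra of a product with the product \<open>\<sigma>\<close>-algebra.
\<close>

lemma measurable_Pair_separable:
  assumes A: "separable_set A" and B: "separable_set B"
    and X: "X \<in> N \<rightarrow>\<^sub>M restrict_space borel A" and Y: "Y \<in> N \<rightarrow>\<^sub>M restrict_space borel B"
  shows "(\<lambda>w. (X w, Y w)) \<in> N \<rightarrow>\<^sub>M restrict_space borel (A \<times> B)"
proof (rule measurable_restrict_space2)
  have XA: "X w \<in> A" "Y w \<in> B" if "w \<in> space N" for w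
    using measurable_space[OF X that] measurable_space[OF Y that] by (auto simp: space_restrict_space)
  then show "(\<lambda>w. (X w, Y w)) \<in> space N \<rightarrow> A \<times> B" by auto
  have [measurable]: "X \<in> N \<rightarrow>\<^sub>M borel" "Y \<in> N \<rightarrow>\<^sub>M borel"
    using X Y by (simp_all add: measurable_restrict_space2_iff)
  obtain D E where D: "countable D" "D \<subseteq> A" "\<And>x e. x \<in> A \<Longrightarrow> e > 0 \<Longrightarrow> \<exists>d\<in>D. dist x d < e"
    and E: "countable E" "E \<subseteq> B" "\<And>x e. x \<in> B \<Longrightarrow> e > 0 \<Longrightarrow> \<exists>d\<in>E. dist x d < e"
    using A B unfolding separable_set_def by metis
  show "(\<lambda>w. (X w, Y w)) \<in> N \<rightarrow>\<^sub>M borel"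
  proof (rule borel_measurableI)
    fix O' :: "('a \<times> 'b) set" assume O: "open O'"
    define I where "I = {(d, e, n :: nat). d \<in> D \<and> e \<in> E \<and> ball d (1 / Suc n) \<times> ball e (1 / Suc n) \<subseteq> O'}"
    have "I \<subseteq> D \<times> E \<times> UNIV" unfolding I_def by auto
    then have I: "countable I" using D(1) E(1) by (meson countable_SIGMA countable_subset countableI_type)
    have "(\<lambda>w. (X w, Y w)) -` O' \<inter> space N =
      (\<Union>(d, e, n)\<in>I. {w\<in>space N. dist (X w) d < 1 / Suc n \<and> dist (Y w) e < 1 / Suc n})" (is "?L = ?R")
    proof
      show "?R \<subseteq> ?L"
      proof
        fix w assume "w \<in> ?R"
        then obtain d e n where "(d, e, n) \<in> I" "w \<in> space N" "dist (X w) d < 1 / Suc n" "dist (Y w) e < 1 / Suc n"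
          by blast
        then have "(X w, Y w) \<in> ball d (1 / Suc n) \<times> ball e (1 / Suc n)" "ball d (1 / Suc n) \<times> ball e (1 / Suc n) \<subseteq> O'"
          by (auto simp: I_def dist_commute)
        then show "w \<in> ?L" using \<open>w \<in> space N\<close> by blast
      qed
      show "?L \<subseteq> ?R"
      proof
        fix w assume w: "w \<in> ?L"
        then obtain r where r: "r > 0" "ball (X w, Y w) r \<subseteq> O'" using O by (auto simp: open_contains_ball)
        obtain n where n: "1 / Suc n < r / 4" using nat_approx_posE[of "r/4"] r by auto
        obtain d where d: "d \<in> D" "dist (X w) d < 1 / Suc n" using D(3)[of "X w" "1 / Suc n"] XA w by auto
        obtain e where e: "e \<in> E" "dist (Y w) e < 1 / Suc n" using E(3)[of "Y w" "1 / Suc n"] XA w by auto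
        have "ball d (1 / Suc n) \<times> ball e (1 / Suc n) \<subseteq> ball (X w, Y w) r"
        proof clarify
          fix a b assume ab: "a \<in> ball d (1 / Suc n)" "b \<in> ball e (1 / Suc n)"
          have "dist (X w, Y w) (a, b) \<le> dist (X w) a + dist (Y w) b" by (rule dist_prod_le)
          also have "\<dots> \<le> (dist (X w) d + dist d a) + (dist (Y w) e + dist e b)"
            by (intro add_mono dist_triangle)
          also have "\<dots> < r" using ab d e n by auto
          finally show "(a, b) \<in> ball (X w, Y w) r" by simp
        qed
        then have "(d, e, n) \<in> I" unfolding I_def using d e r by blast
        then show "w \<in> ?R" using d e w by auto
      qed
    qed
    moreover have "{w\<in>space N. dist (X w) d < c \<and> dist (Y w) e < c} \<in> sets N" for d e c
    proof -
      have "{w\<in>space N. dist (X w) d < c \<and> dist (Y w) e < c} = (X -` ball d c \<inter> space N) \<inter> (Y -` ball e c \<inter> space N)"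
        by (auto simp: dist_commute)
      also have "\<dots> \<in> sets N" by (intro sets.Int measurable_sets[where A=borel]) auto
      finally show ?thesis .
    qed
    ultimately show "(\<lambda>w. (X w, Y w)) -` O' \<inter> space N \<in> sets N"
      using I by (auto intro!: sets.countable_UN')
  qed
qed

text \<open>
  By the Lindelof property countably many of the choices are enough, and the first good one in an
  enumeration is a measurable choice. The selection factors through its index \<open>j\<close>, which makes it
  measurable for every \<open>\<sigma>\<close>-algebra on the chosen objects.
\<close>

lemma countable_measurable_selection:
  fixes Q :: "'x::second_countable_topology \<Rightarrow> 'w \<Rightarrow> bool"
  assumes "\<And>x. \<exists>w U. open U \<and> x \<in> U \<and> (\<forall>y\<in>U. Q y w)"
  shows "\<exists>(j :: 'x \<Rightarrow> nat) w. j \<in> borel \<rightarrow>\<^sub>M count_space UNIV \<and> (\<forall>x. Q x (w (j x)))"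
proof -
  obtain w U where wU: "\<And>x. open (U x)" "\<And>x. x \<in> U x" "\<And>x y. y \<in> U x \<Longrightarrow> Q y (w x)"
    using assms by metis
  obtain \<F> where \<F>: "\<F> \<subseteq> range U" "countable \<F>" "\<Union>\<F> = \<Union>(range U)"
    using Lindelof[of "range U"] wU by blast
  have "UNIV = \<Union>\<F>" using \<F>(3) wU(2) by auto
  then have ne: "\<F> \<noteq> {}" by auto
  define V where "V = from_nat_into \<F>"
  have V: "range V = \<F>" unfolding V_def by (rule range_from_nat_into[OF ne \<F>(2)])
  then have "\<exists>x. V n = U x" for n using \<F>(1) by blast
  then obtain c where c: "\<And>n :: nat. V n = U (c n)" by metis
  have ex: "\<exists>n. x \<in> V n" for x using \<open>UNIV = \<Union>\<F>\<close> V by auto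
  have [measurable]: "Measurable.pred borel (\<lambda>x. x \<in> V n)" for n
    using wU(1)[of "c n"] by (auto simp: pred_def c)
  have "(\<lambda>x. LEAST n. x \<in> V n) \<in> borel \<rightarrow>\<^sub>M count_space UNIV" by measurable
  moreover have "Q x (w (c (LEAST n. x \<in> V n)))" for x
    using LeastI_ex[OF ex[of x]] wU(3) unfolding c by blast
  ultimately show ?thesis
    by (intro exI[of _ "\<lambda>x. LEAST n. x \<in> V n"] exI[of _ "\<lambda>n. w (c n)"]) auto
qed

lemma integral_shifted_power:
  assumes "t0 \<le> (t::real)"
  shows "set_integrable lborel {t0..t} (\<lambda>s. (s - t0) ^ n)"
    and "(LINT s:{t0..t}|lborel. (s - t0) ^ n) = (t - t0) ^ Suc n / Suc n"
proof -
  have D: "((\<lambda>s. (s - t0) ^ Suc n / Suc n) has_real_derivative (x - t0) ^ n) (at x)" for x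
    by (rule derivative_eq_intros refl | simp)+
  have "has_bochner_integral lborel (\<lambda>x. (x - t0) ^ n * indicator {t0..t} x)
     ((t - t0) ^ Suc n / Suc n - (t0 - t0) ^ Suc n / Suc n)"
    by (rule has_bochner_integral_FTC_Icc_real[OF assms D]) (intro continuous_intros)
  then have "has_bochner_integral lborel (\<lambda>x. (x - t0) ^ n * indicator {t0..t} x) ((t - t0) ^ Suc n / Suc n)"
    by simp
  then show "set_integrable lborel {t0..t} (\<lambda>s. (s - t0) ^ n)"
    "(LINT s:{t0..t}|lborel. (s - t0) ^ n) = (t - t0) ^ Suc n / Suc n"
    by (auto simp: set_integrable_def set_lebesgue_integral_def has_bochner_integral_iff mult.commute)
qed

section \<open>The controlled dynamics\<close>

definition lipschitz_data ::
  "'a::metric_space set \<Rightarrow> 'b::metric_space set \<Rightarrow> real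
    \<Rightarrow> ('n::finite torus \<Rightarrow> 'a \<Rightarrow> 'b \<Rightarrow> 'n torus_prob \<Rightarrow> 'v::metric_space) \<Rightarrow> bool" where
  "lipschitz_data A1 A2 C \<phi> \<longleftrightarrow>
     continuous_on (UNIV \<times> A1 \<times> A2 \<times> UNIV) (\<lambda>(x, a1, a2, m). \<phi> x a1 a2 m) \<and>
     (\<forall>a1\<in>A1. \<forall>a2\<in>A2. C-lipschitz_on UNIV (\<lambda>(x, m). \<phi> x a1 a2 m))"

lemma lipschitz_dataD:
  assumes "lipschitz_data A1 A2 C \<phi>" "a1 \<in> A1" "a2 \<in> A2"
  shows "dist (\<phi> x a1 a2 m) (\<phi> x' a1 a2 m') \<le> C * (dist x x' + dist m m')"
proof -
  have L: "C-lipschitz_on UNIV (\<lambda>(x, m). \<phi> x a1 a2 m)"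
    using assms unfolding lipschitz_data_def by blast
  have "dist (\<phi> x a1 a2 m) (\<phi> x' a1 a2 m') \<le> C * dist (x, m) (x', m')"
    using lipschitz_onD[OF L, of "(x, m)" "(x', m')"] by simp
  also have "\<dots> \<le> C * (dist x x' + dist m m')"
    by (intro mult_left_mono dist_prod_le lipschitz_on_nonneg[OF L])
  finally show ?thesis .
qed

text \<open>
  The torus and the space of measures have finite diameter, so the Lipschitz condition reduces the bound
  to one point \<open>(x, m)\<close>, where compactness of the control sets applies.
\<close>

lemma lipschitz_data_bounded:
  fixes \<phi> :: "'n::finite torus \<Rightarrow> 'a::metric_space \<Rightarrow> 'b::metric_space \<Rightarrow> 'n torus_prob \<Rightarrow> 'v::real_normed_vector"
  assumes \<phi>: "lipschitz_data A1 A2 C \<phi>" and "compact A1" "compact A2" "A1 \<noteq> {}" "A2 \<noteq> {}"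
  shows "\<exists>B>0. \<forall>x. \<forall>a1\<in>A1. \<forall>a2\<in>A2. \<forall>m. norm (\<phi> x a1 a2 m) \<le> B"
proof -
  fix m0 :: "'n torus_prob"
  have C: "C \<ge> 0" using assms unfolding lipschitz_data_def by (meson ex_in_conv lipschitz_on_nonneg)
  have "continuous_on (A1 \<times> A2) ((\<lambda>(x, a1, a2, m). \<phi> x a1 a2 m) \<circ> (\<lambda>(a1, a2). (0, a1, a2, m0)))"
  proof (rule continuous_on_compose)
    show "continuous_on (A1 \<times> A2) (\<lambda>(a1, a2). (0 :: 'n torus, a1, a2, m0))"
      unfolding case_prod_unfold by (intro continuous_intros)
    show "continuous_on ((\<lambda>(a1, a2). (0, a1, a2, m0)) ` (A1 \<times> A2)) (\<lambda>(x, a1, a2, m). \<phi> x a1 a2 m)"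
      by (rule continuous_on_subset[OF \<phi>[unfolded lipschitz_data_def, THEN conjunct1]]) auto
  qed
  then have "compact (((\<lambda>(x, a1, a2, m). \<phi> x a1 a2 m) \<circ> (\<lambda>(a1, a2). (0, a1, a2, m0))) ` (A1 \<times> A2))"
    by (intro compact_continuous_image compact_Times assms)
  then obtain B where B: "B > 0" "\<And>a1 a2. a1 \<in> A1 \<Longrightarrow> a2 \<in> A2 \<Longrightarrow> norm (\<phi> 0 a1 a2 m0) \<le> B"
    by (force dest!: compact_imp_bounded simp: bounded_pos)
  show ?thesis
  proof (intro exI[of _ "B + C * (CARD('n) + 2 * real CARD('n))"] conjI allI ballI)
    show "0 < B + C * (CARD('n) + 2 * real CARD('n))" using B C by (simp add: add_pos_nonneg)
    fix x a1 a2 m assume a: "a1 \<in> A1" "a2 \<in> A2"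
    have "norm (\<phi> x a1 a2 m) \<le> norm (\<phi> 0 a1 a2 m0) + dist (\<phi> x a1 a2 m) (\<phi> 0 a1 a2 m0)"
      unfolding dist_norm by (metis add.commute diff_add_cancel norm_triangle_ineq)
    also have "\<dots> \<le> B + C * (dist x 0 + dist m m0)"
      by (intro add_mono B a lipschitz_dataD[OF \<phi>])
    also have "\<dots> \<le> B + C * (CARD('n) + 2 * real CARD('n))"
      by (intro add_mono mult_left_mono dist_torus_le_card dist_torus_prob_le_card C order_refl)
    finally show "norm (\<phi> x a1 a2 m) \<le> B + C * (CARD('n) + 2 * real CARD('n))" .
  qed
qed

lemma set_integral_Icc_diff:
  fixes f :: "real \<Rightarrow> 'v::{banach, second_countable_topology}"
  assumes "a \<le> s" "s \<le> t" and f: "set_integrable lborel {a..t} f"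
  shows "(LINT r:{a..t}|lborel. f r) - (LINT r:{a..s}|lborel. f r) = (LINT r:{s..t}|lborel. f r)"
proof -
  have "{a..t} = {a..s} \<union> {s..t}" using assms by auto
  moreover have "(LINT r:{a..s} \<union> {s..t}|lborel. f r) = (LINT r:{a..s}|lborel. f r) + (LINT r:{s..t}|lborel. f r)"
  proof (rule set_integral_Un_AE)
    show "AE x in lborel. \<not> (x \<in> {a..s} \<and> x \<in> {s..t})"
      using AE_lborel_singleton[of s] by eventually_elim auto
  qed (use assms in \<open>auto intro: set_integrable_subset[OF f]\<close>)
  ultimately show ?thesis by simp
qed

lemma norm_set_integral_le:
  fixes f :: "real \<Rightarrow> 'v::{banach, second_countable_topology}"
  assumes f: "set_integrable lborel S f" and g: "set_integrable lborel S g"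
    and "AE r in lborel. r \<in> S \<longrightarrow> norm (f r) \<le> g r"
  shows "norm (LINT r:S|lborel. f r) \<le> (LINT r:S|lborel. g r)"
  unfolding set_lebesgue_integral_def
proof (rule order_trans[OF integral_norm_bound], rule integral_mono_AE)
  show "AE x in lborel. norm (indicator S x *\<^sub>R f x) \<le> indicator S x *\<^sub>R g x"
    using assms(3) by eventually_elim (auto simp: indicator_def)
  show "integrable lborel (\<lambda>x. norm (indicator S x *\<^sub>R f x))" "integrable lborel (\<lambda>x. indicator S x *\<^sub>R g x)"
    using f g unfolding set_integrable_def by (auto intro: integrable_norm simp del: norm_scaleR)
qed

lemma norm_set_integral_le_const:
  fixes f :: "real \<Rightarrow> 'v::{banach, second_countable_topology}"
  assumes "s \<le> t" "set_integrable lborel {s..t} f" "\<And>r. r \<in> {s..t} \<Longrightarrow> norm (f r) \<le> B"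
  shows "norm (LINT r:{s..t}|lborel. f r) \<le> B * (t - s)"
proof -
  have "norm (LINT r:{s..t}|lborel. f r) \<le> (LINT r:{s..t}|lborel. B)"
    using assms by (intro norm_set_integral_le) (auto simp: set_integrable_def)
  also have "\<dots> = B * (t - s)"
    using assms by (simp add: set_lebesgue_integral_def)
  finally show ?thesis .
qed

locale controlled_dynamics = stochastic_basis M T F W
  for M :: "'w measure" and T :: real and F :: "real \<Rightarrow> 'w measure"
    and W :: "real \<Rightarrow> 'w \<Rightarrow> real ^ 'n::finite" +
  fixes A1 :: "'a::metric_space set" and A2 :: "'b::metric_space set"
    and b :: "'n torus \<Rightarrow> 'a \<Rightarrow> 'b \<Rightarrow> 'n torus_prob \<Rightarrow> real ^ 'n"
    and Cb :: real and t0 :: real and \<xi> :: "'w \<Rightarrow> 'n torus"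
  assumes t0: "t0 \<in> {0..T}"
    and A1: "compact A1" "A1 \<noteq> {}" and A2: "compact A2" "A2 \<noteq> {}"
    and b: "lipschitz_data A1 A2 Cb b"
    and \<xi>: "\<xi> \<in> F 0 \<rightarrow>\<^sub>M borel"
begin

lemma space_F: "t \<in> {0..T} \<Longrightarrow> space (F t) = space M"
  using F_subalgebra by (auto simp: subalgebra_def)

lemma measurable_F_mono: "0 \<le> s \<Longrightarrow> s \<le> t \<Longrightarrow> t \<le> T \<Longrightarrow> f \<in> F s \<rightarrow>\<^sub>M N \<Longrightarrow> f \<in> F t \<rightarrow>\<^sub>M N"
  by (rule measurable_from_subalg[of "F t" "F s"]) (auto simp: subalgebra_def space_F F_mono)

lemma measurable_F_M: "t \<in> {0..T} \<Longrightarrow> f \<in> F t \<rightarrow>\<^sub>M N \<Longrightarrow> f \<in> M \<rightarrow>\<^sub>M N"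
  using F_subalgebra by (rule measurable_from_subalg)

text \<open>
  Continuity is asked for every \<open>w\<close> instead of almost every one; the state processes below are constructed
  with this property, which removes exceptional sets from the estimates.
\<close>

definition adapted_path :: "(real \<Rightarrow> 'w \<Rightarrow> 'x::metric_space) \<Rightarrow> bool" where
  "adapted_path X \<longleftrightarrow> (\<forall>t\<in>{t0..T}. X t \<in> F t \<rightarrow>\<^sub>M borel) \<and> (\<forall>w\<in>space M. continuous_on {t0..T} (\<lambda>t. X t w))"

lemma adapted_pathD: "adapted_path X \<Longrightarrow> t \<in> {t0..T} \<Longrightarrow> X t \<in> F t \<rightarrow>\<^sub>M borel"
  "adapted_path X \<Longrightarrow> w \<in> space M \<Longrightarrow> continuous_on {t0..T} (\<lambda>t. X t w)"
  by (auto simp: adapted_path_def)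

lemma adapted_path_M: "adapted_path X \<Longrightarrow> t \<in> {t0..T} \<Longrightarrow> X t \<in> M \<rightarrow>\<^sub>M borel"
  using t0 by (intro measurable_F_M[OF _ adapted_pathD(1)]) auto

text \<open>
  The path is read at the last multiple of \<open>1 / Suc n\<close> before the current time, which gives step processes
  that converge by continuity.
\<close>

lemma adapted_path_progressive:
  fixes X :: "real \<Rightarrow> 'w \<Rightarrow> 'x::metric_space"
  assumes X: "adapted_path X" and t: "t \<in> {t0..T}"
  shows "(\<lambda>(s, w). X s w) \<in> restrict_space borel {t0..t} \<Otimes>\<^sub>M F t \<rightarrow>\<^sub>M borel"
proof -
  \<comment> \<open>the clamp keeps the reading time in \<open>{t0..t}\<close>, where \<open>X\<close> is measurable with respect to \<open>F t\<close>\<close>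
  define g where "g n i = min t (max t0 (real_of_int i / real (Suc n)))" for n i
  let ?N = "restrict_space borel {t0..t} \<Otimes>\<^sub>M F t"
  have [measurable]: "(\<lambda>z. fst z) \<in> ?N \<rightarrow>\<^sub>M borel"
    by (rule measurable_compose[OF measurable_fst]) (simp add: measurable_restrict_space1)
  show ?thesis
  proof (rule borel_measurable_LIMSEQ_metric)
    fix n
    have m: "(\<lambda>z. X (g n i) (snd z)) \<in> ?N \<rightarrow>\<^sub>M borel" for i
    proof (rule measurable_compose[OF measurable_snd])
      have "g n i \<in> {t0..T}" "g n i \<le> t" using t by (auto simp: g_def)
      then show "X (g n i) \<in> F t \<rightarrow>\<^sub>M borel"
        using t t0 by (intro measurable_F_mono[OF _ _ _ adapted_pathD(1)[OF X]]) auto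
    qed
    show "(\<lambda>z. X (g n \<lfloor>fst z * real (Suc n)\<rfloor>) (snd z)) \<in> ?N \<rightarrow>\<^sub>M borel"
      by (rule measurable_compose_countable[OF m]) measurable
  next
    fix z assume z: "z \<in> space ?N"
    obtain s w where [simp]: "z = (s, w)" by (cases z)
    have s: "s \<in> {t0..t}" "w \<in> space M"
      using z t t0 by (auto simp: space_pair_measure space_restrict_space space_F)
    have lim: "(\<lambda>n. of_int \<lfloor>s * real (Suc n)\<rfloor> / real (Suc n)) \<longlonglongrightarrow> s"
    proof (rule real_tendsto_sandwich)
      show "\<forall>\<^sub>F n in sequentially. s - inverse (real (Suc n)) \<le> of_int \<lfloor>s * real (Suc n)\<rfloor> / real (Suc n)"
      proof (rule always_eventually, rule allI)
        fix n
        have "s * real (Suc n) - 1 \<le> of_int \<lfloor>s * real (Suc n)\<rfloor>" by linarith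
        then have "(s * real (Suc n) - 1) / real (Suc n) \<le> of_int \<lfloor>s * real (Suc n)\<rfloor> / real (Suc n)"
          by (intro divide_right_mono) auto
        then show "s - inverse (real (Suc n)) \<le> of_int \<lfloor>s * real (Suc n)\<rfloor> / real (Suc n)"
          by (simp add: diff_divide_distrib inverse_eq_divide del: of_nat_Suc)
      qed
      show "\<forall>\<^sub>F n in sequentially. of_int \<lfloor>s * real (Suc n)\<rfloor> / real (Suc n) \<le> s"
        by (rule always_eventually) (simp add: field_simps del: of_nat_Suc)
      show "(\<lambda>n. s - inverse (real (Suc n))) \<longlonglongrightarrow> s"
        using tendsto_diff[OF tendsto_const[of s] LIMSEQ_inverse_real_of_nat] by simp
    qed simp
    have "(\<lambda>n. g n \<lfloor>s * real (Suc n)\<rfloor>) \<longlonglongrightarrow> min t (max t0 s)"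
      unfolding g_def by (intro tendsto_intros lim)
    then have "(\<lambda>n. g n \<lfloor>s * real (Suc n)\<rfloor>) \<longlonglongrightarrow> s" using s by simp
    then have "(\<lambda>n. X (g n \<lfloor>s * real (Suc n)\<rfloor>) w) \<longlonglongrightarrow> X s w"
      using s t by (intro continuous_on_tendsto_compose[OF adapted_pathD(2)[OF X s(2)]])
        (auto simp: g_def intro!: always_eventually)
    then show "(\<lambda>n. X (g n \<lfloor>fst z * real (Suc n)\<rfloor>) (snd z)) \<longlonglongrightarrow> (\<lambda>(s, w). X s w) z"
      by simp
  qed
qed

lemma continuous_on_law:
  fixes X :: "real \<Rightarrow> 'w \<Rightarrow> 'n torus"
  assumes X: "adapted_path X"
  shows "continuous_on {t0..T} (\<lambda>s. law M (X s))"
proof (rule continuous_on_sequentiallyI)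
  fix u a assume u: "\<forall>n. u n \<in> {t0..T}" and a: "a \<in> {t0..T}" and lim: "u \<longlonglongrightarrow> a"
  note [measurable] = adapted_path_M[OF X]
  have "(\<lambda>n. \<integral>w. dist (X (u n) w) (X a w) \<partial>M) \<longlonglongrightarrow> (\<integral>w. 0 \<partial>M)"
  proof (rule integral_dominated_convergence[where w="\<lambda>_. CARD('n)"])
    show "AE w in M. (\<lambda>n. dist (X (u n) w) (X a w)) \<longlonglongrightarrow> 0"
    proof (rule AE_I2)
      fix w assume "w \<in> space M"
      then have "(\<lambda>n. X (u n) w) \<longlonglongrightarrow> X a w"
        using u a lim by (intro continuous_on_tendsto_compose[OF adapted_pathD(2)[OF X]]) auto
      then show "(\<lambda>n. dist (X (u n) w) (X a w)) \<longlonglongrightarrow> 0" by (rule tendsto_dist_iff[THEN iffD1])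
    qed
    show "(\<lambda>w. dist (X (u n) w) (X a w)) \<in> borel_measurable M" for n
      using u a by (intro borel_measurable_dist) auto
    show "AE w in M. norm (dist (X (u n) w) (X a w)) \<le> CARD('n)" for n
      by (rule AE_I2) (simp add: dist_torus_le_card)
  qed auto
  then have "(\<lambda>n. \<integral>w. dist (X (u n) w) (X a w) \<partial>M) \<longlonglongrightarrow> 0" by simp
  moreover have "\<forall>\<^sub>F n in sequentially. norm (dist (law M (X (u n))) (law M (X a))) \<le> (\<integral>w. dist (X (u n) w) (X a w) \<partial>M)"
    using u a by (intro always_eventually) (auto intro!: dist_law_le prob_space_axioms)
  ultimately have "(\<lambda>n. dist (law M (X (u n))) (law M (X a))) \<longlonglongrightarrow> 0"
    by (rule Lim_null_comparison[rotated])
  then show "(\<lambda>n. law M (X (u n))) \<longlonglongrightarrow> law M (X a)" by (rule tendsto_dist_iff[THEN iffD2])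
qed

abbreviation ctrl :: "'x::metric_space set \<Rightarrow> (real \<Rightarrow> 'w \<Rightarrow> 'x) set" where
  "ctrl A \<equiv> controls F T A t0"

lemma controlsD:
  assumes "\<alpha> \<in> ctrl A"
  shows "t \<in> {t0..T} \<Longrightarrow> (\<lambda>(s, w). \<alpha> s w) \<in> restrict_space borel {t0..t} \<Otimes>\<^sub>M F t \<rightarrow>\<^sub>M restrict_space borel A"
    and "s \<in> {t0..T} \<Longrightarrow> w \<in> space M \<Longrightarrow> \<alpha> s w \<in> A"
proof -
  show *: "(\<lambda>(s, w). \<alpha> s w) \<in> restrict_space borel {t0..t} \<Otimes>\<^sub>M F t \<rightarrow>\<^sub>M restrict_space borel A" if "t \<in> {t0..T}" for t
    using assms that by (auto simp: controls_def)
  assume s: "s \<in> {t0..T}" "w \<in> space M"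
  then have "T \<in> {t0..T}" "(s, w) \<in> space (restrict_space borel {t0..T} \<Otimes>\<^sub>M F T)"
    using t0 by (auto simp: space_pair_measure space_restrict_space space_F)
  from measurable_space[OF *[OF this(1)] this(2)] show "\<alpha> s w \<in> A"
    by (simp add: space_restrict_space)
qed

text \<open>
  The law enters only as a continuous function of time. This makes the integrand a continuous function of
  \<open>(s, X s w, \<alpha>1 s w, \<alpha>2 s w)\<close> on a product of separable sets.
\<close>

lemma integrand_progressive:
  fixes \<phi> :: "'n torus \<Rightarrow> 'a \<Rightarrow> 'b \<Rightarrow> 'n torus_prob \<Rightarrow> 'v::metric_space"
  assumes \<phi>: "lipschitz_data A1 A2 C \<phi>" and X: "adapted_path X" and t: "t \<in> {t0..T}"
    and \<alpha>: "\<alpha>1 \<in> ctrl A1" "\<alpha>2 \<in> ctrl A2"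
  shows "(\<lambda>(s, w). \<phi> (X s w) (\<alpha>1 s w) (\<alpha>2 s w) (law M (X s)))
    \<in> restrict_space borel {t0..t} \<Otimes>\<^sub>M F t \<rightarrow>\<^sub>M borel"
proof -
  let ?N = "restrict_space borel {t0..t} \<Otimes>\<^sub>M F t"
  let ?S = "({t0..t} \<times> UNIV) \<times> (A1 \<times> A2)"
  let ?\<psi> = "(\<lambda>(x, a1, a2, m). \<phi> x a1 a2 m) \<circ> (\<lambda>z :: (real \<times> 'n torus) \<times> ('a \<times> 'b). (snd (fst z), fst (snd z), snd (snd z), law M (X (fst (fst z)))))"
  have sep: "separable_set {t0..t}" "separable_set A1" "separable_set A2" "separable_set (UNIV :: 'n torus set)"
    using A1 A2 by (auto intro: compact_separable_set separable_set_UNIV)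
  have "(\<lambda>z. fst z) \<in> ?N \<rightarrow>\<^sub>M restrict_space borel {t0..t}" by measurable
  moreover have "(\<lambda>z. X (fst z) (snd z)) \<in> ?N \<rightarrow>\<^sub>M restrict_space borel UNIV"
    using adapted_path_progressive[OF X t] by (intro measurable_restrict_space2) (simp_all add: case_prod_unfold)
  ultimately have 1: "(\<lambda>z. (fst z, X (fst z) (snd z))) \<in> ?N \<rightarrow>\<^sub>M restrict_space borel ({t0..t} \<times> UNIV)"
    by (rule measurable_Pair_separable[OF sep(1,4)])
  have 2: "(\<lambda>z. (\<alpha>1 (fst z) (snd z), \<alpha>2 (fst z) (snd z))) \<in> ?N \<rightarrow>\<^sub>M restrict_space borel (A1 \<times> A2)"
    using controlsD(1)[OF \<alpha>(1) t] controlsD(1)[OF \<alpha>(2) t]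
    by (intro measurable_Pair_separable sep) (simp_all add: case_prod_unfold)
  have "(\<lambda>z. ((fst z, X (fst z) (snd z)), (\<alpha>1 (fst z) (snd z), \<alpha>2 (fst z) (snd z)))) \<in> ?N \<rightarrow>\<^sub>M restrict_space borel ?S"
    by (intro measurable_Pair_separable 1 2 separable_set_Times sep)
  moreover have "?\<psi> \<in> restrict_space borel ?S \<rightarrow>\<^sub>M borel"
  proof (rule borel_measurable_continuous_on_restrict, rule continuous_on_compose)
    have "continuous_on ?S ((\<lambda>s. law M (X s)) \<circ> (\<lambda>z. fst (fst z)))"
      using t by (intro continuous_on_compose continuous_on_subset[OF continuous_on_law[OF X]] continuous_intros) auto
    then show "continuous_on ?S (\<lambda>z. (snd (fst z), fst (snd z), snd (snd z), law M (X (fst (fst z)))))"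
      by (intro continuous_intros) (simp add: o_def)
    show "continuous_on ((\<lambda>z. (snd (fst z), fst (snd z), snd (snd z), law M (X (fst (fst z))))) ` ?S) (\<lambda>(x, a1, a2, m). \<phi> x a1 a2 m)"
      by (rule continuous_on_subset[OF \<phi>[unfolded lipschitz_data_def, THEN conjunct1]]) auto
  qed
  ultimately have "(\<lambda>z. ?\<psi> ((fst z, X (fst z) (snd z)), (\<alpha>1 (fst z) (snd z), \<alpha>2 (fst z) (snd z)))) \<in> ?N \<rightarrow>\<^sub>M borel"
    by (rule measurable_compose)
  then show ?thesis by (simp add: case_prod_unfold)
qed

definition running ::
  "('n torus \<Rightarrow> 'a \<Rightarrow> 'b \<Rightarrow> 'n torus_prob \<Rightarrow> 'v::{banach, second_countable_topology})
    \<Rightarrow> (real \<Rightarrow> 'w \<Rightarrow> 'n torus) \<Rightarrow> (real \<Rightarrow> 'w \<Rightarrow> 'a) \<Rightarrow> (real \<Rightarrow> 'w \<Rightarrow> 'b) \<Rightarrow> real \<Rightarrow> 'w \<Rightarrow> 'v" where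
  "running \<phi> X \<alpha>1 \<alpha>2 t w = (LINT s:{t0..t}|lborel. \<phi> (X s w) (\<alpha>1 s w) (\<alpha>2 s w) (law M (X s)))"

lemma running_set_integrable:
  fixes \<phi> :: "'n torus \<Rightarrow> 'a \<Rightarrow> 'b \<Rightarrow> 'n torus_prob \<Rightarrow> 'v::{banach, second_countable_topology}"
  assumes \<phi>: "lipschitz_data A1 A2 C \<phi>" and X: "adapted_path X"
    and \<alpha>: "\<alpha>1 \<in> ctrl A1" "\<alpha>2 \<in> ctrl A2"
    and w: "w \<in> space M" and S: "S \<in> sets borel" "S \<subseteq> {t0..T}"
  shows "set_integrable lborel S (\<lambda>s. \<phi> (X s w) (\<alpha>1 s w) (\<alpha>2 s w) (law M (X s)))"
proof -
  obtain B where B: "\<forall>x. \<forall>a1\<in>A1. \<forall>a2\<in>A2. \<forall>m. norm (\<phi> x a1 a2 m) \<le> B"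
    using lipschitz_data_bounded[OF \<phi> A1(1) A2(1) A1(2) A2(2)] by blast
  have T: "T \<in> {t0..T}" using t0 by auto
  have "(\<lambda>s. \<phi> (X s w) (\<alpha>1 s w) (\<alpha>2 s w) (law M (X s))) \<in> borel_measurable (restrict_space lborel {t0..T})"
    using measurable_Pair2[OF integrand_progressive[OF \<phi> X T \<alpha>], of _] 
      measurable_compose[OF measurable_Pair2'[of w "F T" "restrict_space borel {t0..T}"] integrand_progressive[OF \<phi> X T \<alpha>]] w t0
    by (simp add: space_F cong: measurable_cong_sets)
  then have "integrable (restrict_space lborel {t0..T}) (\<lambda>s. \<phi> (X s w) (\<alpha>1 s w) (\<alpha>2 s w) (law M (X s)))"
    using B t0 controlsD(2)[OF \<alpha>(1) _ w] controlsD(2)[OF \<alpha>(2) _ w]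
    by (intro integrableI_bounded_set[where A="{t0..T}" and B=B] AE_I2)
      (auto simp: space_restrict_space emeasure_restrict_space sets_restrict_space_iff)
  then have "set_integrable lborel {t0..T} (\<lambda>s. \<phi> (X s w) (\<alpha>1 s w) (\<alpha>2 s w) (law M (X s)))"
    by (subst (asm) integrable_restrict_space) (auto simp: set_integrable_def)
  then show ?thesis using S by (auto intro: set_integrable_subset[of lborel "{t0..T}"])
qed

lemma running_measurable:
  fixes \<phi> :: "'n torus \<Rightarrow> 'a \<Rightarrow> 'b \<Rightarrow> 'n torus_prob \<Rightarrow> 'v::{banach, second_countable_topology}"
  assumes \<phi>: "lipschitz_data A1 A2 C \<phi>" and X: "adapted_path X"
    and \<alpha>: "\<alpha>1 \<in> ctrl A1" "\<alpha>2 \<in> ctrl A2" and t: "t \<in> {t0..T}"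
  shows "running \<phi> X \<alpha>1 \<alpha>2 t \<in> F t \<rightarrow>\<^sub>M borel"
proof -
  let ?N = "restrict_space lborel {t0..t}"
  interpret sigma_finite_measure ?N
    by (rule sigma_finite_measure_restrict_space[OF sigma_finite_lborel]) auto
  have "(\<lambda>(s, w). \<phi> (X s w) (\<alpha>1 s w) (\<alpha>2 s w) (law M (X s))) \<in> borel_measurable (?N \<Otimes>\<^sub>M F t)"
    using integrand_progressive[OF \<phi> X t \<alpha>]
    by (simp cong: measurable_cong_sets sets_pair_measure_cong sets_restrict_space_cong)
  from measurable_pair_swap[OF this]
  have "(\<lambda>w. \<integral>s. \<phi> (X s w) (\<alpha>1 s w) (\<alpha>2 s w) (law M (X s)) \<partial>?N) \<in> borel_measurable (F t)"
    by (intro borel_measurable_lebesgue_integral) (simp add: case_prod_unfold)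
  then show ?thesis
    unfolding running_def[abs_def] set_lebesgue_integral_def by (simp add: integral_restrict_space)
qed

lemma running_diff:
  fixes \<phi> :: "'n torus \<Rightarrow> 'a \<Rightarrow> 'b \<Rightarrow> 'n torus_prob \<Rightarrow> 'v::{banach, second_countable_topology}"
  assumes \<phi>: "lipschitz_data A1 A2 C \<phi>" and X: "adapted_path X"
    and \<alpha>: "\<alpha>1 \<in> ctrl A1" "\<alpha>2 \<in> ctrl A2"
    and w: "w \<in> space M" and st: "t0 \<le> s" "s \<le> t" "t \<le> T"
  shows "running \<phi> X \<alpha>1 \<alpha>2 t w - running \<phi> X \<alpha>1 \<alpha>2 s w
    = (LINT r:{s..t}|lborel. \<phi> (X r w) (\<alpha>1 r w) (\<alpha>2 r w) (law M (X r)))"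
  unfolding running_def
  by (rule set_integral_Icc_diff[OF st(1,2) running_set_integrable[OF \<phi> X \<alpha> w]]) (use st in auto)

lemma running_diff_bound:
  fixes \<phi> :: "'n torus \<Rightarrow> 'a \<Rightarrow> 'b \<Rightarrow> 'n torus_prob \<Rightarrow> 'v::{banach, second_countable_topology}"
  assumes \<phi>: "lipschitz_data A1 A2 C \<phi>" and X: "adapted_path X"
    and \<alpha>: "\<alpha>1 \<in> ctrl A1" "\<alpha>2 \<in> ctrl A2"
    and w: "w \<in> space M" and st: "t0 \<le> s" "s \<le> t" "t \<le> T"
    and B: "\<forall>x. \<forall>a1\<in>A1. \<forall>a2\<in>A2. \<forall>m. norm (\<phi> x a1 a2 m) \<le> B"
  shows "norm (running \<phi> X \<alpha>1 \<alpha>2 t w - running \<phi> X \<alpha>1 \<alpha>2 s w) \<le> B * (t - s)"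
  unfolding running_diff[OF \<phi> X \<alpha> w st]
  using st B controlsD(2)[OF \<alpha>(1) _ w] controlsD(2)[OF \<alpha>(2) _ w]
  by (intro norm_set_integral_le_const running_set_integrable[OF \<phi> X \<alpha> w]) auto

lemma running_t0: "running \<phi> X \<alpha>1 \<alpha>2 t0 w = 0"
  unfolding running_def set_lebesgue_integral_def
  by (rule integral_eq_zero_AE) (use AE_lborel_singleton[of t0] in eventually_elim, auto)

lemma running_continuous:
  fixes \<phi> :: "'n torus \<Rightarrow> 'a \<Rightarrow> 'b \<Rightarrow> 'n torus_prob \<Rightarrow> 'v::{banach, second_countable_topology}"
  assumes \<phi>: "lipschitz_data A1 A2 C \<phi>" and X: "adapted_path X"
    and \<alpha>: "\<alpha>1 \<in> ctrl A1" "\<alpha>2 \<in> ctrl A2" and w: "w \<in> space M"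
  shows "continuous_on {t0..T} (\<lambda>t. running \<phi> X \<alpha>1 \<alpha>2 t w)"
proof -
  obtain B where B: "B > 0" "\<forall>x. \<forall>a1\<in>A1. \<forall>a2\<in>A2. \<forall>m. norm (\<phi> x a1 a2 m) \<le> B"
    using lipschitz_data_bounded[OF \<phi> A1(1) A2(1) A1(2) A2(2)] by blast
  have "B-lipschitz_on {t0..T} (\<lambda>t. running \<phi> X \<alpha>1 \<alpha>2 t w)"
  proof (rule lipschitz_onI)
    fix s t assume "s \<in> {t0..T}" "t \<in> {t0..T}"
    then show "dist (running \<phi> X \<alpha>1 \<alpha>2 s w) (running \<phi> X \<alpha>1 \<alpha>2 t w) \<le> B * dist s t"
      using running_diff_bound[OF \<phi> X \<alpha> w _ _ _ B(2), of s t] running_diff_bound[OF \<phi> X \<alpha> w _ _ _ B(2), of t s]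
      by (cases "s \<le> t") (auto simp: dist_norm norm_minus_commute)
  qed (use B in simp)
  then show ?thesis by (rule lipschitz_on_continuous_on)
qed

text \<open>
  A null set off which the Brownian paths are continuous. The noise is set to \<open>0\<close> on it; since the
  filtration contains all null sets, the modified noise stays adapted.
\<close>

definition exceptional :: "'w set" where
  "exceptional = (SOME N. N \<in> null_sets M \<and> {w\<in>space M. \<not> continuous_on {0..T} (\<lambda>t. W t w)} \<subseteq> N)"

lemma exceptional:
  "exceptional \<in> null_sets M" "w \<in> space M \<Longrightarrow> w \<notin> exceptional \<Longrightarrow> continuous_on {0..T} (\<lambda>t. W t w)"
proof -
  have "\<exists>N. N \<in> null_sets M \<and> {w\<in>space M. \<not> continuous_on {0..T} (\<lambda>t. W t w)} \<subseteq> N"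
    using W_continuous by (auto simp: eventually_ae_filter)
  from someI_ex[OF this] show "exceptional \<in> null_sets M"
    "w \<in> space M \<Longrightarrow> w \<notin> exceptional \<Longrightarrow> continuous_on {0..T} (\<lambda>t. W t w)"
    unfolding exceptional_def[symmetric] by auto
qed

text \<open>
  The state for zero drift, on the torus.
\<close>

definition uncontrolled :: "real \<Rightarrow> 'w \<Rightarrow> 'n torus" where
  "uncontrolled t w = \<xi> w + to_torus (if w \<in> exceptional then 0 else sqrt 2 *\<^sub>R (W t w - W t0 w))"

abbreviation fluctuation :: "real \<Rightarrow> real \<Rightarrow> real" where
  "fluctuation s r \<equiv> \<integral>w. dist (uncontrolled s w) (uncontrolled r w) \<partial>M"

lemma adapted_path_uncontrolled: "adapted_path uncontrolled"
  unfolding adapted_path_def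
proof (intro conjI ballI)
  fix t assume t: "t \<in> {t0..T}"
  have [measurable]: "exceptional \<in> sets (F t)"
    using F_complete[OF exceptional(1), of exceptional] F_mono[of 0 t] t t0 by auto
  have [measurable]: "\<xi> \<in> F t \<rightarrow>\<^sub>M borel" "W t \<in> F t \<rightarrow>\<^sub>M borel" "W t0 \<in> F t \<rightarrow>\<^sub>M borel"
    using t t0 by (auto intro: measurable_F_mono[OF _ _ _ \<xi>] measurable_F_mono[OF _ _ _ W_adapted] W_adapted)
  show "uncontrolled t \<in> F t \<rightarrow>\<^sub>M borel" unfolding uncontrolled_def[abs_def] by measurable
next
  fix w assume w: "w \<in> space M"
  have "continuous_on {t0..T} (\<lambda>t. if w \<in> exceptional then 0 else sqrt 2 *\<^sub>R (W t w - W t0 w))"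
    using continuous_on_subset[OF exceptional(2)[OF w], of "{t0..T}"] t0
    by (cases "w \<in> exceptional") (auto intro!: continuous_intros)
  then show "continuous_on {t0..T} (\<lambda>t. uncontrolled t w)"
    unfolding uncontrolled_def
    by (intro continuous_intros continuous_on_compose2[OF continuous_on_to_torus[of UNIV]]) auto
qed

lemma adapted_path_add_running:
  assumes X: "adapted_path X" and \<alpha>: "\<alpha>1 \<in> ctrl A1" "\<alpha>2 \<in> ctrl A2"
  shows "adapted_path (\<lambda>t w. uncontrolled t w + to_torus (running b X \<alpha>1 \<alpha>2 t w))"
  unfolding adapted_path_def
proof (intro conjI ballI)
  fix t assume t: "t \<in> {t0..T}"
  note [measurable] = adapted_pathD(1)[OF adapted_path_uncontrolled t] running_measurable[OF b X \<alpha> t]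
  show "(\<lambda>w. uncontrolled t w + to_torus (running b X \<alpha>1 \<alpha>2 t w)) \<in> F t \<rightarrow>\<^sub>M borel" by measurable
next
  fix w assume w: "w \<in> space M"
  show "continuous_on {t0..T} (\<lambda>t. uncontrolled t w + to_torus (running b X \<alpha>1 \<alpha>2 t w))"
    by (intro continuous_intros adapted_pathD(2)[OF adapted_path_uncontrolled w]
        continuous_on_compose2[OF continuous_on_to_torus[of UNIV] running_continuous[OF b X \<alpha> w]]) auto
qed

lemma Cb_nonneg: "Cb \<ge> 0"
  using b A1 A2 unfolding lipschitz_data_def by (meson ex_in_conv lipschitz_on_nonneg)

text \<open>
  The iteration step behind existence and uniqueness: a gap \<open>c * (s - t0) ^ n\<close> between states and laws
  becomes a gap of the next order between the drifts. The factor \<open>2\<close> counts the state and the law.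
\<close>

lemma drift_gap:
  assumes "t0 \<le> t"
    and f: "set_integrable lborel {t0..t} (\<lambda>s. b (x s) (a1 s) (a2 s) (m s))"
    and f': "set_integrable lborel {t0..t} (\<lambda>s. b (x' s) (a1' s) (a2' s) (m' s))"
    and a: "AE s in lborel. s \<in> {t0..t} \<longrightarrow> a1 s = a1' s \<and> a2 s = a2' s"
    and A: "\<And>s. s \<in> {t0..t} \<Longrightarrow> a1 s \<in> A1 \<and> a2 s \<in> A2"
    and x: "\<And>s. s \<in> {t0..t} \<Longrightarrow> dist (x s) (x' s) \<le> c * (s - t0) ^ n"
    and m: "\<And>s. s \<in> {t0..t} \<Longrightarrow> dist (m s) (m' s) \<le> c * (s - t0) ^ n"
  shows "norm ((LINT s:{t0..t}|lborel. b (x s) (a1 s) (a2 s) (m s))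
     - (LINT s:{t0..t}|lborel. b (x' s) (a1' s) (a2' s) (m' s))) \<le> 2 * Cb * c / Suc n * (t - t0) ^ Suc n"
proof -
  have "norm (LINT s:{t0..t}|lborel. b (x s) (a1 s) (a2 s) (m s) - b (x' s) (a1' s) (a2' s) (m' s))
    \<le> (LINT s:{t0..t}|lborel. (2 * Cb * c) * (s - t0) ^ n)"
  proof (rule norm_set_integral_le)
    show "set_integrable lborel {t0..t} (\<lambda>s. b (x s) (a1 s) (a2 s) (m s) - b (x' s) (a1' s) (a2' s) (m' s))"
      by (rule set_integral_diff(1)[OF f f'])
    show "set_integrable lborel {t0..t} (\<lambda>s. 2 * Cb * c * (s - t0) ^ n)"
      by (intro set_integrable_mult_right integral_shifted_power assms)
    show "AE s in lborel. s \<in> {t0..t} \<longrightarrow> norm (b (x s) (a1 s) (a2 s) (m s) - b (x' s) (a1' s) (a2' s) (m' s)) \<le> 2 * Cb * c * (s - t0) ^ n"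
      using a
    proof eventually_elim
      case (elim s)
      show ?case
      proof
        assume s: "s \<in> {t0..t}"
        have "norm (b (x s) (a1 s) (a2 s) (m s) - b (x' s) (a1' s) (a2' s) (m' s)) \<le> Cb * (dist (x s) (x' s) + dist (m s) (m' s))"
          using lipschitz_dataD[OF b, of "a1 s" "a2 s" "x s" "m s" "x' s" "m' s"] A[OF s] elim s by (simp add: dist_norm)
        also have "\<dots> \<le> Cb * (c * (s - t0) ^ n + c * (s - t0) ^ n)"
          by (intro mult_left_mono add_mono x m s Cb_nonneg)
        finally show "norm (b (x s) (a1 s) (a2 s) (m s) - b (x' s) (a1' s) (a2' s) (m' s)) \<le> 2 * Cb * c * (s - t0) ^ n"
          by simp
      qed
    qed
  qed
  then show ?thesis
    unfolding set_integral_diff(2)[OF f f'] set_integral_mult_right integral_shifted_power(2)[OF assms(1)] by simp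
qed

end

section \<open>Existence and uniqueness of the state process\<close>

text \<open>
  The terms of the exponential series of \<open>2 * C * r\<close>, scaled by \<open>K\<close>.
\<close>

abbreviation picard_bound :: "real \<Rightarrow> real \<Rightarrow> nat \<Rightarrow> real \<Rightarrow> real" where
  "picard_bound K C n r \<equiv> K * (2 * C) ^ n / fact n * r ^ n"

lemma picard_bound_Suc:
  "2 * C * (K * (2 * C) ^ n / fact n) / real (Suc n) * r ^ Suc n = picard_bound K C (Suc n) r"
  by (simp add: field_simps)

lemma picard_bound_sums: "summable (\<lambda>n. picard_bound K C n r)"
proof -
  have "summable (\<lambda>n. K * (inverse (fact n) * (2 * C * r) ^ n))"
    by (intro summable_mult summable_exp)
  then show ?thesis by (simp add: field_simps power_mult_distrib)
qed

context controlled_dynamics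
begin

text \<open>
  The filtration contains all subsets of null sets. A solution in the sense of \<open>mkv_solution\<close> is controlled
  almost surely only, and its running cost becomes measurable in this way.
\<close>

lemma borel_measurable_AE_eq:
  assumes h: "h \<in> M \<rightarrow>\<^sub>M N" and gh: "AE w in M. g w = h w" and g: "g \<in> space M \<rightarrow> space N"
  shows "g \<in> M \<rightarrow>\<^sub>M N"
proof (rule measurableI)
  obtain E where E: "E \<in> null_sets M" "{w\<in>space M. g w \<noteq> h w} \<subseteq> E"
    using gh by (auto simp: eventually_ae_filter)
  fix A assume A: "A \<in> sets N"
  have "g -` A \<inter> space M = (h -` A \<inter> space M - E) \<union> (g -` A \<inter> space M \<inter> E)"
    using E(2) by auto
  moreover have "g -` A \<inter> space M \<inter> E \<in> sets M"
    using F_complete[OF E(1), of "g -` A \<inter> space M \<inter> E"] F_subalgebra[of 0] t0 by (auto simp: subalgebra_def)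
  ultimately show "g -` A \<inter> space M \<in> sets M"
    using measurable_sets[OF h A] null_setsD2[OF E(1)] by (metis sets.Diff sets.Un)
qed (use g in auto)

definition is_state ::
  "(real \<Rightarrow> 'w \<Rightarrow> 'a) \<Rightarrow> (real \<Rightarrow> 'w \<Rightarrow> 'b) \<Rightarrow> (real \<Rightarrow> 'w \<Rightarrow> 'n torus) \<Rightarrow> bool" where
  "is_state \<alpha>1 \<alpha>2 X \<longleftrightarrow> adapted_path X \<and>
     (\<forall>w\<in>space M. \<forall>t\<in>{t0..T}. X t w = uncontrolled t w + to_torus (running b X \<alpha>1 \<alpha>2 t w))"

primrec picard :: "(real \<Rightarrow> 'w \<Rightarrow> 'a) \<Rightarrow> (real \<Rightarrow> 'w \<Rightarrow> 'b) \<Rightarrow> nat \<Rightarrow> real \<Rightarrow> 'w \<Rightarrow> 'n torus" where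
  "picard \<alpha>1 \<alpha>2 0 = uncontrolled"
| "picard \<alpha>1 \<alpha>2 (Suc n) = (\<lambda>t w. uncontrolled t w + to_torus (running b (picard \<alpha>1 \<alpha>2 n) \<alpha>1 \<alpha>2 t w))"

context
  fixes \<alpha>1 \<alpha>2
  assumes \<alpha>: "\<alpha>1 \<in> ctrl A1" "\<alpha>2 \<in> ctrl A2"
begin

lemma adapted_path_picard: "adapted_path (picard \<alpha>1 \<alpha>2 n)"
  by (induction n) (auto intro: adapted_path_uncontrolled adapted_path_add_running \<alpha>)

lemma running_gap:
  assumes X: "adapted_path X" "adapted_path X'"
    and gap: "\<And>s w. s \<in> {t0..t} \<Longrightarrow> w \<in> space M \<Longrightarrow> dist (X s w) (X' s w) \<le> picard_bound (real CARD('n)) Cb n (s - t0)"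
    and t: "t \<in> {t0..T}" and w: "w \<in> space M"
  shows "norm (running b X \<alpha>1 \<alpha>2 t w - running b X' \<alpha>1 \<alpha>2 t w) \<le> picard_bound (real CARD('n)) Cb (Suc n) (t - t0)"
  unfolding running_def picard_bound_Suc[symmetric]
proof (rule drift_gap)
  fix s assume s: "s \<in> {t0..t}"
  then have sT: "s \<in> {t0..T}" using t by auto
  show "dist (X s w) (X' s w) \<le> real CARD('n) * (2 * Cb) ^ n / fact n * (s - t0) ^ n"
    using gap[OF s w] .
  show "dist (law M (X s)) (law M (X' s)) \<le> real CARD('n) * (2 * Cb) ^ n / fact n * (s - t0) ^ n"
    using s t gap by (intro dist_law_le_AE prob_space_axioms adapted_path_M X sT AE_I2) auto
  show "\<alpha>1 s w \<in> A1 \<and> \<alpha>2 s w \<in> A2"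
    using controlsD(2)[OF \<alpha>(1) sT w] controlsD(2)[OF \<alpha>(2) sT w] by simp
next
  show "set_integrable lborel {t0..t} (\<lambda>s. b (X s w) (\<alpha>1 s w) (\<alpha>2 s w) (law M (X s)))"
    "set_integrable lborel {t0..t} (\<lambda>s. b (X' s w) (\<alpha>1 s w) (\<alpha>2 s w) (law M (X' s)))"
    using t by (auto intro!: running_set_integrable[OF b _ \<alpha> w] X)
qed (use t in auto)

lemma picard_gap:
  assumes "t \<in> {t0..T}" "w \<in> space M"
  shows "dist (picard \<alpha>1 \<alpha>2 (Suc n) t w) (picard \<alpha>1 \<alpha>2 n t w) \<le> picard_bound (real CARD('n)) Cb n (t - t0)"
  using assms
proof (induction n arbitrary: t w)
  case 0
  then show ?case using dist_torus_le_card by simp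
next
  case (Suc n)
  have "norm (running b (picard \<alpha>1 \<alpha>2 (Suc n)) \<alpha>1 \<alpha>2 t w - running b (picard \<alpha>1 \<alpha>2 n) \<alpha>1 \<alpha>2 t w)
    \<le> picard_bound (real CARD('n)) Cb (Suc n) (t - t0)"
    using Suc.prems by (intro running_gap adapted_path_picard Suc.IH) auto
  from order_trans[OF dist_to_torus_le this] show ?case
    by (subst picard.simps(2), subst (2) picard.simps(2)) (simp only: dist_torus_add_left)
qed

lemma picard_running_convergent:
  assumes t: "t \<in> {t0..T}" and w: "w \<in> space M"
  shows "convergent (\<lambda>n. running b (picard \<alpha>1 \<alpha>2 n) \<alpha>1 \<alpha>2 t w)"
proof -
  let ?R = "\<lambda>n. running b (picard \<alpha>1 \<alpha>2 n) \<alpha>1 \<alpha>2 t w"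
  have "summable (\<lambda>n. ?R (Suc n) - ?R n)"
  proof (rule summable_comparison_test'[where N=0])
    show "summable (\<lambda>n. picard_bound (real CARD('n)) Cb (Suc n) (t - t0))"
      using picard_bound_sums by (subst summable_Suc_iff)
    show "norm (?R (Suc n) - ?R n) \<le> picard_bound (real CARD('n)) Cb (Suc n) (t - t0)" for n
      using t w by (intro running_gap adapted_path_picard picard_gap) auto
  qed
  then have "convergent (\<lambda>n. ?R n - ?R 0)"
    using sum_lessThan_telescope[of ?R] by (simp only: summable_iff_convergent)
  then show ?thesis by (simp add: convergent_diff_const_right_iff)
qed

text \<open>
  The Picard iterates converge pointwise, and their drifts are Lipschitz in time with a common constant,
  so that the limit is continuous. Dominated convergence is applied twice: to the distance of the laws, and
  then to the integral in the equation.
\<close>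

lemma state_exists: "\<exists>X. is_state \<alpha>1 \<alpha>2 X"
proof -
  define P where "P = picard \<alpha>1 \<alpha>2"
  define R where "R n t w = running b (P n) \<alpha>1 \<alpha>2 t w" for n t w
  define Q where "Q t w = lim (\<lambda>n. R n t w)" for t w
  define X where "X t w = uncontrolled t w + to_torus (Q t w)" for t w
  note P = adapted_path_picard[folded P_def]
  have Q: "(\<lambda>n. R n t w) \<longlonglongrightarrow> Q t w" if "t \<in> {t0..T}" "w \<in> space M" for t w
    using picard_running_convergent[OF that] by (simp add: Q_def R_def P_def convergent_LIMSEQ_iff)
  obtain B where B: "B > 0" "\<forall>x. \<forall>a1\<in>A1. \<forall>a2\<in>A2. \<forall>m. norm (b x a1 a2 m) \<le> B"
    using lipschitz_data_bounded[OF b A1(1) A2(1) A1(2) A2(2)] by blast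
  have X: "adapted_path X"
    unfolding adapted_path_def
  proof (intro conjI ballI)
    fix t assume t: "t \<in> {t0..T}"
    have [measurable]: "Q t \<in> F t \<rightarrow>\<^sub>M borel"
    proof (rule borel_measurable_LIMSEQ_metric)
      show "R n t \<in> F t \<rightarrow>\<^sub>M borel" for n
        unfolding R_def[abs_def] by (rule running_measurable[OF b P \<alpha> t])
      show "(\<lambda>n. R n t w) \<longlonglongrightarrow> Q t w" if "w \<in> space (F t)" for w
        using Q[OF t] that t t0 by (simp add: space_F)
    qed
    note [measurable] = adapted_pathD(1)[OF adapted_path_uncontrolled t]
    show "X t \<in> F t \<rightarrow>\<^sub>M borel" unfolding X_def[abs_def] by measurable
  next
    fix w assume w: "w \<in> space M"
    have *: "dist (Q s w) (Q t w) \<le> B * (t - s)" if "s \<in> {t0..T}" "t \<in> {t0..T}" "s \<le> t" for s t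
    proof (rule tendsto_upperbound)
      show "(\<lambda>n. dist (R n s w) (R n t w)) \<longlonglongrightarrow> dist (Q s w) (Q t w)"
        by (intro tendsto_dist Q that w)
      show "\<forall>\<^sub>F n in sequentially. dist (R n s w) (R n t w) \<le> B * (t - s)"
        using running_diff_bound[OF b P \<alpha> w _ \<open>s \<le> t\<close> _ B(2)] that
        by (auto simp: R_def dist_norm norm_minus_commute)
    qed simp
    have "B-lipschitz_on {t0..T} (\<lambda>t. Q t w)"
    proof (rule lipschitz_onI)
      fix s t assume "s \<in> {t0..T}" "t \<in> {t0..T}"
      then show "dist (Q s w) (Q t w) \<le> B * dist s t"
        using *[of s t] *[of t s] by (cases "s \<le> t") (auto simp: dist_commute dist_real_def)
    qed (use B in simp)
    then have "continuous_on {t0..T} (\<lambda>t. Q t w)" by (rule lipschitz_on_continuous_on)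
    then show "continuous_on {t0..T} (\<lambda>t. X t w)"
      unfolding X_def
      by (intro continuous_intros adapted_pathD(2)[OF adapted_path_uncontrolled w]
        continuous_on_compose2[OF continuous_on_to_torus[of UNIV]]) auto
  qed
  have PX: "(\<lambda>n. dist (P n t w) (X t w)) \<longlonglongrightarrow> 0" if "t \<in> {t0..T}" "w \<in> space M" for t w
  proof -
    have le: "dist (P (Suc n) t w) (X t w) \<le> dist (R n t w) (Q t w)" for n
      unfolding P_def picard.simps X_def dist_torus_add_left R_def dist_norm by (rule dist_to_torus_le)
    have "(\<lambda>n. dist (R n t w) (Q t w)) \<longlonglongrightarrow> 0"
      by (rule tendsto_dist_iff[THEN iffD1, OF Q[OF that]])
    moreover have "\<forall>\<^sub>F n in sequentially. norm (dist (P (Suc n) t w) (X t w)) \<le> dist (R n t w) (Q t w)"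
      by (rule always_eventually) (simp add: le)
    ultimately have "(\<lambda>n. dist (P (Suc n) t w) (X t w)) \<longlonglongrightarrow> 0"
      by (rule Lim_null_comparison[rotated])
    then show ?thesis by (rule LIMSEQ_imp_Suc)
  qed
  have PX_law: "(\<lambda>n. dist (law M (P n t)) (law M (X t))) \<longlonglongrightarrow> 0" if t: "t \<in> {t0..T}" for t
  proof -
    note [measurable] = adapted_path_M[OF X t] adapted_path_M[OF P t]
    have "(\<lambda>n. \<integral>w. dist (P n t w) (X t w) \<partial>M) \<longlonglongrightarrow> (\<integral>w. 0 \<partial>M)"
    proof (rule integral_dominated_convergence[where w="\<lambda>_. CARD('n)"])
      show "AE w in M. (\<lambda>n. dist (P n t w) (X t w)) \<longlonglongrightarrow> 0"
        by (rule AE_I2) (rule PX[OF t])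
      show "(\<lambda>w. dist (P n t w) (X t w)) \<in> borel_measurable M" for n by measurable
      show "AE w in M. norm (dist (P n t w) (X t w)) \<le> CARD('n)" for n
        by (rule AE_I2) (simp add: dist_torus_le_card)
    qed auto
    then have "(\<lambda>n. \<integral>w. dist (P n t w) (X t w) \<partial>M) \<longlonglongrightarrow> 0" by simp
    then show ?thesis
      by (rule Lim_null_comparison[rotated])
        (auto intro!: always_eventually dist_law_le prob_space_axioms)
  qed
  have "Q t w = running b X \<alpha>1 \<alpha>2 t w" if t: "t \<in> {t0..T}" and w: "w \<in> space M" for t w
  proof -
    have "(\<lambda>n. R n t w) \<longlonglongrightarrow> running b X \<alpha>1 \<alpha>2 t w"
      unfolding R_def running_def set_lebesgue_integral_def
    proof (rule integral_dominated_convergence[where w="\<lambda>s. indicator {t0..t} s * B"])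
      show "(\<lambda>s. indicator {t0..t} s *\<^sub>R b (X s w) (\<alpha>1 s w) (\<alpha>2 s w) (law M (X s))) \<in> borel_measurable lborel"
        using running_set_integrable[OF b X \<alpha> w, of "{t0..t}"] t by (auto simp: set_integrable_def)
      show "(\<lambda>s. indicator {t0..t} s *\<^sub>R b (P n s w) (\<alpha>1 s w) (\<alpha>2 s w) (law M (P n s))) \<in> borel_measurable lborel" for n
        using running_set_integrable[OF b P \<alpha> w, of "{t0..t}"] t by (auto simp: set_integrable_def)
      show "integrable lborel (\<lambda>s. indicator {t0..t} s * B)" using t by (intro integrable_mult_left) simp
      show "AE s in lborel. norm (indicator {t0..t} s *\<^sub>R b (P n s w) (\<alpha>1 s w) (\<alpha>2 s w) (law M (P n s))) \<le> indicator {t0..t} s * B" for n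
      proof (rule AE_I2)
        fix s
        show "norm (indicator {t0..t} s *\<^sub>R b (P n s w) (\<alpha>1 s w) (\<alpha>2 s w) (law M (P n s))) \<le> indicator {t0..t} s * B"
          using B controlsD(2)[OF \<alpha>(1) _ w, of s] controlsD(2)[OF \<alpha>(2) _ w, of s] t
          by (auto simp: indicator_def)
      qed
      show "AE s in lborel. (\<lambda>n. indicator {t0..t} s *\<^sub>R b (P n s w) (\<alpha>1 s w) (\<alpha>2 s w) (law M (P n s)))
        \<longlonglongrightarrow> indicator {t0..t} s *\<^sub>R b (X s w) (\<alpha>1 s w) (\<alpha>2 s w) (law M (X s))"
      proof (rule AE_I2)
        fix s
        have "(\<lambda>n. b (P n s w) (\<alpha>1 s w) (\<alpha>2 s w) (law M (P n s))) \<longlonglongrightarrow> b (X s w) (\<alpha>1 s w) (\<alpha>2 s w) (law M (X s))"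
          if "s \<in> {t0..t}"
        proof (rule tendsto_dist_iff[THEN iffD2])
          have s: "s \<in> {t0..T}" using that t by auto
          have "(\<lambda>n. Cb * (dist (P n s w) (X s w) + dist (law M (P n s)) (law M (X s)))) \<longlonglongrightarrow> Cb * (0 + 0)"
            by (intro tendsto_intros PX PX_law s w)
          then have "(\<lambda>n. Cb * (dist (P n s w) (X s w) + dist (law M (P n s)) (law M (X s)))) \<longlonglongrightarrow> 0" by simp
          moreover have "\<forall>\<^sub>F n in sequentially. norm (dist (b (P n s w) (\<alpha>1 s w) (\<alpha>2 s w) (law M (P n s))) (b (X s w) (\<alpha>1 s w) (\<alpha>2 s w) (law M (X s))))
            \<le> Cb * (dist (P n s w) (X s w) + dist (law M (P n s)) (law M (X s)))"
            using lipschitz_dataD[OF b controlsD(2)[OF \<alpha>(1) s w] controlsD(2)[OF \<alpha>(2) s w]]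
            by (intro always_eventually allI) simp
          ultimately show "(\<lambda>n. dist (b (P n s w) (\<alpha>1 s w) (\<alpha>2 s w) (law M (P n s))) (b (X s w) (\<alpha>1 s w) (\<alpha>2 s w) (law M (X s)))) \<longlonglongrightarrow> 0"
            by (rule Lim_null_comparison[rotated])
        qed
        then show "(\<lambda>n. indicator {t0..t} s *\<^sub>R b (P n s w) (\<alpha>1 s w) (\<alpha>2 s w) (law M (P n s)))
          \<longlonglongrightarrow> indicator {t0..t} s *\<^sub>R b (X s w) (\<alpha>1 s w) (\<alpha>2 s w) (law M (X s))"
          by (cases "s \<in> {t0..t}") auto
      qed
    qed
    with Q[OF that] show ?thesis by (rule LIMSEQ_unique)
  qed
  then have "is_state \<alpha>1 \<alpha>2 X"
    unfolding is_state_def using X by (simp add: X_def)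
  then show ?thesis by blast
qed

end

definition state :: "(real \<Rightarrow> 'w \<Rightarrow> 'a) \<Rightarrow> (real \<Rightarrow> 'w \<Rightarrow> 'b) \<Rightarrow> real \<Rightarrow> 'w \<Rightarrow> 'n torus" where
  "state \<alpha>1 \<alpha>2 = (SOME X. is_state \<alpha>1 \<alpha>2 X)"

lemma
  assumes \<alpha>: "\<alpha>1 \<in> ctrl A1" "\<alpha>2 \<in> ctrl A2"
  shows adapted_path_state: "adapted_path (state \<alpha>1 \<alpha>2)"
    and state_eq: "w \<in> space M \<Longrightarrow> t \<in> {t0..T} \<Longrightarrow>
      state \<alpha>1 \<alpha>2 t w = uncontrolled t w + to_torus (running b (state \<alpha>1 \<alpha>2) \<alpha>1 \<alpha>2 t w)"
proof -
  have "is_state \<alpha>1 \<alpha>2 (state \<alpha>1 \<alpha>2)"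
    unfolding state_def by (rule someI_ex[OF state_exists[OF \<alpha>]])
  then show "adapted_path (state \<alpha>1 \<alpha>2)" "w \<in> space M \<Longrightarrow> t \<in> {t0..T} \<Longrightarrow>
      state \<alpha>1 \<alpha>2 t w = uncontrolled t w + to_torus (running b (state \<alpha>1 \<alpha>2) \<alpha>1 \<alpha>2 t w)"
    by (auto simp: is_state_def)
qed

lemma state_mkv_solution:
  assumes \<alpha>: "\<alpha>1 \<in> ctrl A1" "\<alpha>2 \<in> ctrl A2"
  shows "mkv_solution M F W T b t0 \<xi> \<alpha>1 \<alpha>2 (state \<alpha>1 \<alpha>2)"
  unfolding mkv_solution_def
proof (intro conjI ballI)
  let ?X = "state \<alpha>1 \<alpha>2"
  note X = adapted_path_state[OF \<alpha>]
  show "?X t \<in> F t \<rightarrow>\<^sub>M borel" if "t \<in> {t0..T}" for t by (rule adapted_pathD(1)[OF X that])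
  show "AE w in M. continuous_on {t0..T} (\<lambda>t. ?X t w)"
    by (rule AE_I2) (rule adapted_pathD(2)[OF X])
  show "AE w in M. set_integrable lborel {t0..T} (\<lambda>s. b (?X s w) (\<alpha>1 s w) (\<alpha>2 s w) (law M (?X s)))"
    by (rule AE_I2) (rule running_set_integrable[OF b X \<alpha>], auto)
  show "AE w in M. \<forall>t\<in>{t0..T}. ?X t w = \<xi> w +
        to_torus ((LINT s:{t0..t}|lborel. b (?X s w) (\<alpha>1 s w) (\<alpha>2 s w) (law M (?X s)))
                  + sqrt 2 *\<^sub>R (W t w - W t0 w))"
    using AE_not_in[OF exceptional(1)] AE_space
  proof eventually_elim
    case (elim w)
    show ?case
    proof
      fix t assume "t \<in> {t0..T}"
      from state_eq[OF \<alpha> elim(2) this] elim(1)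
      show "?X t w = \<xi> w + to_torus ((LINT s:{t0..t}|lborel. b (?X s w) (\<alpha>1 s w) (\<alpha>2 s w) (law M (?X s)))
                  + sqrt 2 *\<^sub>R (W t w - W t0 w))"
        by (simp add: uncontrolled_def running_def to_torus_add ac_simps)
    qed
  qed
qed

text \<open>
  The gap is at most the diameter of the torus, and every application of \<open>drift_gap\<close> improves the bound to
  the next term of a convergent series. Controls that differ after time \<open>t\<close> are admitted because plays are
  later built up cell by cell.
\<close>

lemma mkv_solution_unique:
  assumes \<alpha>: "\<alpha>1 \<in> ctrl A1" "\<alpha>2 \<in> ctrl A2"
    and agree: "agree_until M t0 t \<alpha>1 \<alpha>1'" "agree_until M t0 t \<alpha>2 \<alpha>2'"
    and X: "mkv_solution M F W T b t0 \<xi> \<alpha>1 \<alpha>2 X" and X': "mkv_solution M F W T b t0 \<xi> \<alpha>1' \<alpha>2' X'"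
    and t: "t \<in> {t0..T}"
  shows "AE w in M. \<forall>s\<in>{t0..t}. X s w = X' s w"
proof -
  have gap: "AE w in M. \<forall>s\<in>{t0..t}. dist (X s w) (X' s w) \<le> picard_bound (real CARD('n)) Cb n (s - t0)" for n
  proof (induction n)
    case 0
    show ?case by (rule AE_I2) (simp add: dist_torus_le_card)
  next
    case (Suc n)
    have m: "X s \<in> M \<rightarrow>\<^sub>M borel" "X' s \<in> M \<rightarrow>\<^sub>M borel" if "s \<in> {t0..t}" for s
      using X X' that t t0 by (auto simp: mkv_solution_def intro!: measurable_F_M[of s])
    have law: "dist (law M (X s)) (law M (X' s)) \<le> picard_bound (real CARD('n)) Cb n (s - t0)" if s: "s \<in> {t0..t}" for s
    proof (rule dist_law_le_AE[OF prob_space_axioms m[OF s]])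
      show "AE w in M. dist (X s w) (X' s w) \<le> picard_bound (real CARD('n)) Cb n (s - t0)"
        using Suc.IH by eventually_elim (use s in auto)
    qed
    have "AE w in M. set_integrable lborel {t0..T} (\<lambda>s. b (X s w) (\<alpha>1 s w) (\<alpha>2 s w) (law M (X s)))"
      "AE w in M. set_integrable lborel {t0..T} (\<lambda>s. b (X' s w) (\<alpha>1' s w) (\<alpha>2' s w) (law M (X' s)))"
      "AE w in M. \<forall>t\<in>{t0..T}. X t w = \<xi> w +
        to_torus ((LINT s:{t0..t}|lborel. b (X s w) (\<alpha>1 s w) (\<alpha>2 s w) (law M (X s)))
                  + sqrt 2 *\<^sub>R (W t w - W t0 w))"
      "AE w in M. \<forall>t\<in>{t0..T}. X' t w = \<xi> w +
        to_torus ((LINT s:{t0..t}|lborel. b (X' s w) (\<alpha>1' s w) (\<alpha>2' s w) (law M (X' s)))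
                  + sqrt 2 *\<^sub>R (W t w - W t0 w))"
      using X X' by (auto simp: mkv_solution_def)
    from this agree[unfolded agree_until_def] Suc.IH AE_space show ?case
    proof eventually_elim
      case (elim w)
      show ?case
      proof
        fix s assume s: "s \<in> {t0..t}"
        let ?I = "LINT s:{t0..s}|lborel. b (X s w) (\<alpha>1 s w) (\<alpha>2 s w) (law M (X s))"
        let ?I' = "LINT s:{t0..s}|lborel. b (X' s w) (\<alpha>1' s w) (\<alpha>2' s w) (law M (X' s))"
        have sT: "s \<in> {t0..T}" using s t by auto
        have "norm (?I - ?I') \<le> picard_bound (real CARD('n)) Cb (Suc n) (s - t0)"
          unfolding picard_bound_Suc[symmetric]
        proof (rule drift_gap)
          show "AE r in lborel. r \<in> {t0..s} \<longrightarrow> \<alpha>1 r w = \<alpha>1' r w \<and> \<alpha>2 r w = \<alpha>2' r w"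
            using elim(5,6) by eventually_elim (use s in auto)
          show "set_integrable lborel {t0..s} (\<lambda>s. b (X s w) (\<alpha>1 s w) (\<alpha>2 s w) (law M (X s)))"
            by (rule set_integrable_subset[OF elim(1)]) (use sT in auto)
          show "set_integrable lborel {t0..s} (\<lambda>s. b (X' s w) (\<alpha>1' s w) (\<alpha>2' s w) (law M (X' s)))"
            by (rule set_integrable_subset[OF elim(2)]) (use sT in auto)
          fix r assume r: "r \<in> {t0..s}"
          show "\<alpha>1 r w \<in> A1 \<and> \<alpha>2 r w \<in> A2"
            using controlsD(2)[OF \<alpha>(1) _ elim(8), of r] controlsD(2)[OF \<alpha>(2) _ elim(8), of r] r sT by auto
          show "dist (X r w) (X' r w) \<le> real CARD('n) * (2 * Cb) ^ n / fact n * (r - t0) ^ n"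
            using elim(7) r s by auto
          show "dist (law M (X r)) (law M (X' r)) \<le> real CARD('n) * (2 * Cb) ^ n / fact n * (r - t0) ^ n"
            using r s by (intro law) auto
        qed (use s in auto)
        then have "norm ((?I + sqrt 2 *\<^sub>R (W s w - W t0 w)) - (?I' + sqrt 2 *\<^sub>R (W s w - W t0 w))) \<le> picard_bound (real CARD('n)) Cb (Suc n) (s - t0)"
          by simp
        from order_trans[OF dist_to_torus_le this]
        show "dist (X s w) (X' s w) \<le> picard_bound (real CARD('n)) Cb (Suc n) (s - t0)"
          using elim(3,4) sT by (simp only: dist_torus_add_left)
      qed
    qed
  qed
  then have "AE w in M. \<forall>n. \<forall>s\<in>{t0..t}. dist (X s w) (X' s w) \<le> picard_bound (real CARD('n)) Cb n (s - t0)"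
    unfolding AE_all_countable by blast
  then show ?thesis
  proof eventually_elim
    case (elim w)
    show ?case
    proof
      fix s assume s: "s \<in> {t0..t}"
      have "dist (X s w) (X' s w) \<le> 0"
      proof (rule tendsto_lowerbound)
        show "(\<lambda>n. picard_bound (real CARD('n)) Cb n (s - t0)) \<longlonglongrightarrow> 0"
          by (rule summable_LIMSEQ_zero[OF picard_bound_sums])
        show "\<forall>\<^sub>F n in sequentially. dist (X s w) (X' s w) \<le> picard_bound (real CARD('n)) Cb n (s - t0)"
          using elim s by (intro always_eventually) blast
      qed simp
      then show "X s w = X' s w" by simp
    qed
  qed
qed

lemma state_unique:
  assumes "\<alpha>1 \<in> ctrl A1" "\<alpha>2 \<in> ctrl A2"
    and "\<alpha>1' \<in> ctrl A1" "\<alpha>2' \<in> ctrl A2"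
    and "agree_until M t0 t \<alpha>1 \<alpha>1'" "agree_until M t0 t \<alpha>2 \<alpha>2'" and "t \<in> {t0..T}"
  shows "AE w in M. \<forall>s\<in>{t0..t}. state \<alpha>1 \<alpha>2 s w = state \<alpha>1' \<alpha>2' s w"
  by (rule mkv_solution_unique[OF assms(1,2,5,6) state_mkv_solution[OF assms(1,2)] state_mkv_solution[OF assms(3,4)] assms(7)])

lemma running_cong:
  fixes \<phi> :: "'n torus \<Rightarrow> 'a \<Rightarrow> 'b \<Rightarrow> 'n torus_prob \<Rightarrow> 'v::{banach, second_countable_topology}"
  assumes \<phi>: "lipschitz_data A1 A2 C \<phi>"
    and \<alpha>: "\<alpha>1 \<in> ctrl A1" "\<alpha>2 \<in> ctrl A2"
    and \<alpha>': "\<alpha>1' \<in> ctrl A1" "\<alpha>2' \<in> ctrl A2"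
    and agree: "agree_until M t0 t \<alpha>1 \<alpha>1'" "agree_until M t0 t \<alpha>2 \<alpha>2'" and t: "t \<in> {t0..T}"
  shows "AE w in M. \<forall>s\<in>{t0..t}. running \<phi> (state \<alpha>1 \<alpha>2) \<alpha>1 \<alpha>2 s w = running \<phi> (state \<alpha>1' \<alpha>2') \<alpha>1' \<alpha>2' s w"
proof -
  note u = state_unique[OF \<alpha> \<alpha>' agree t]
  have law: "law M (state \<alpha>1 \<alpha>2 s) = law M (state \<alpha>1' \<alpha>2' s)" if s: "s \<in> {t0..t}" for s
  proof (rule law_cong_AE[OF prob_space_axioms])
    show "AE w in M. state \<alpha>1 \<alpha>2 s w = state \<alpha>1' \<alpha>2' s w" using u by eventually_elim (use s in auto)
  qed (use s t in \<open>auto intro!: adapted_path_M adapted_path_state \<alpha> \<alpha>'\<close>)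
  from u agree[unfolded agree_until_def] AE_space show ?thesis
  proof eventually_elim
    case (elim w)
    show ?case
    proof
      fix s assume s: "s \<in> {t0..t}"
      have sT: "{t0..s} \<subseteq> {t0..T}" using s t by auto
      show "running \<phi> (state \<alpha>1 \<alpha>2) \<alpha>1 \<alpha>2 s w = running \<phi> (state \<alpha>1' \<alpha>2') \<alpha>1' \<alpha>2' s w"
        unfolding running_def set_lebesgue_integral_def
      proof (rule integral_cong_AE)
        show "AE r in lborel. indicator {t0..s} r *\<^sub>R \<phi> (state \<alpha>1 \<alpha>2 r w) (\<alpha>1 r w) (\<alpha>2 r w) (law M (state \<alpha>1 \<alpha>2 r)) =
          indicator {t0..s} r *\<^sub>R \<phi> (state \<alpha>1' \<alpha>2' r w) (\<alpha>1' r w) (\<alpha>2' r w) (law M (state \<alpha>1' \<alpha>2' r))"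
          using elim(2,3) by eventually_elim (use s elim(1) law in \<open>auto simp: indicator_def\<close>)
      qed (use running_set_integrable[OF \<phi> adapted_path_state[OF \<alpha>] \<alpha> elim(4) _ sT]
          running_set_integrable[OF \<phi> adapted_path_state[OF \<alpha>'] \<alpha>' elim(4) _ sT] in \<open>auto simp: set_integrable_def\<close>)
    qed
  qed
qed

text \<open>
  The solution chosen in \<open>payoff\<close> is indistinguishable from \<open>state\<close>.
\<close>

lemma payoff_eq:
  fixes G :: "'n torus_prob \<Rightarrow> real"
  assumes L: "lipschitz_data A1 A2 C L"
    and \<alpha>: "\<alpha>1 \<in> ctrl A1" "\<alpha>2 \<in> ctrl A2"
  shows "payoff M F W T b L G t0 \<xi> \<alpha>1 \<alpha>2 =
     (\<integral>w. running L (state \<alpha>1 \<alpha>2) \<alpha>1 \<alpha>2 T w \<partial>M) + G (law M (state \<alpha>1 \<alpha>2 T))"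
proof -
  define X where "X = (SOME X. mkv_solution M F W T b t0 \<xi> \<alpha>1 \<alpha>2 X)"
  have X: "mkv_solution M F W T b t0 \<xi> \<alpha>1 \<alpha>2 X"
    unfolding X_def by (rule someI[where P="mkv_solution M F W T b t0 \<xi> \<alpha>1 \<alpha>2", OF state_mkv_solution[OF \<alpha>]])
  have T: "T \<in> {t0..T}" using t0 by auto
  have refl: "agree_until M t0 T \<alpha> \<alpha>" for \<alpha> :: "real \<Rightarrow> 'w \<Rightarrow> 'x" by (simp add: agree_until_def)
  note u = mkv_solution_unique[OF \<alpha> refl refl X state_mkv_solution[OF \<alpha>] T]
  have m: "X s \<in> M \<rightarrow>\<^sub>M borel" if "s \<in> {t0..T}" for s
    using X that t0 by (auto simp: mkv_solution_def intro!: measurable_F_M[of s])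
  have law: "law M (X s) = law M (state \<alpha>1 \<alpha>2 s)" if s: "s \<in> {t0..T}" for s
  proof (rule law_cong_AE[OF prob_space_axioms m[OF s]])
    show "AE w in M. X s w = state \<alpha>1 \<alpha>2 s w" using u by eventually_elim (use s in auto)
  qed (use s in \<open>auto intro!: adapted_path_M adapted_path_state \<alpha>\<close>)
  obtain B where B: "B > 0" "\<forall>x. \<forall>a1\<in>A1. \<forall>a2\<in>A2. \<forall>m. norm (L x a1 a2 m) \<le> B"
    using lipschitz_data_bounded[OF L A1(1) A2(1) A1(2) A2(2)] by blast
  have rm: "running L (state \<alpha>1 \<alpha>2) \<alpha>1 \<alpha>2 T \<in> borel_measurable M"
    by (rule measurable_F_M[OF _ running_measurable[OF L adapted_path_state[OF \<alpha>] \<alpha> T]]) (use t0 in simp)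
  have "payoff M F W T b L G t0 \<xi> \<alpha>1 \<alpha>2 =
    (\<integral>w. (LINT t:{t0..T}|lborel. L (X t w) (\<alpha>1 t w) (\<alpha>2 t w) (law M (X t))) + G (law M (X T)) \<partial>M)"
    unfolding payoff_def X_def[symmetric] Let_def ..
  also have "\<dots> = (\<integral>w. running L (state \<alpha>1 \<alpha>2) \<alpha>1 \<alpha>2 T w + G (law M (state \<alpha>1 \<alpha>2 T)) \<partial>M)"
  proof -
    have *: "AE w in M. (LINT t:{t0..T}|lborel. L (X t w) (\<alpha>1 t w) (\<alpha>2 t w) (law M (X t))) + G (law M (X T))
      = running L (state \<alpha>1 \<alpha>2) \<alpha>1 \<alpha>2 T w + G (law M (state \<alpha>1 \<alpha>2 T))"
      using u
    proof eventually_elim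
      case (elim w)
      then show ?case
        unfolding running_def using law T by (intro arg_cong2[where f="(+)"] set_lebesgue_integral_cong) auto
    qed
    have meas: "(\<lambda>w. running L (state \<alpha>1 \<alpha>2) \<alpha>1 \<alpha>2 T w + G (law M (state \<alpha>1 \<alpha>2 T))) \<in> borel_measurable M"
      by (intro borel_measurable_add rm) simp
    show ?thesis
      by (rule integral_cong_AE[OF borel_measurable_AE_eq[OF meas *] meas *]) simp
  qed
  also have "\<dots> = (\<integral>w. running L (state \<alpha>1 \<alpha>2) \<alpha>1 \<alpha>2 T w \<partial>M) + G (law M (state \<alpha>1 \<alpha>2 T))"
  proof (subst Bochner_Integration.integral_add)
    show "integrable M (running L (state \<alpha>1 \<alpha>2) \<alpha>1 \<alpha>2 T)"
    proof (rule integrable_const_bound[where B="B * (T - t0)"])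
      show "AE w in M. norm (running L (state \<alpha>1 \<alpha>2) \<alpha>1 \<alpha>2 T w) \<le> B * (T - t0)"
        using running_diff_bound[OF L adapted_path_state[OF \<alpha>] \<alpha> _ _ _ _ B(2), of _ t0 T] t0
        by (intro AE_I2) (auto simp: running_t0)
      show "running L (state \<alpha>1 \<alpha>2) \<alpha>1 \<alpha>2 T \<in> borel_measurable M" by (rule rm)
    qed
  qed (auto simp: prob_space)
  finally show ?thesis .
qed

end

section \<open>Determinacy of the discretised game\<close>

definition switch :: "real \<Rightarrow> (real \<Rightarrow> 'w \<Rightarrow> 'x) \<Rightarrow> (real \<Rightarrow> 'w \<Rightarrow> 'x) \<Rightarrow> real \<Rightarrow> 'w \<Rightarrow> 'x" where
  "switch r \<alpha> \<beta> s w = (if s < r then \<alpha> s w else \<beta> s w)"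

lemma switch_self [simp]: "switch r \<alpha> \<alpha> = \<alpha>"
  by (simp add: switch_def fun_eq_iff)

lemma agree_until_refl [simp]: "agree_until M a t \<alpha> \<alpha>"
  by (simp add: agree_until_def)

lemma agree_until_sym: "agree_until M a t \<alpha> \<beta> \<Longrightarrow> agree_until M a t \<beta> \<alpha>"
  by (simp add: agree_until_def eq_commute)

lemma agree_until_trans:
  assumes "agree_until M a t \<alpha> \<beta>" "agree_until M a t \<beta> \<gamma>"
  shows "agree_until M a t \<alpha> \<gamma>"
  using assms unfolding agree_until_def
proof eventually_elim
  case (elim w)
  then show ?case by eventually_elim auto
qed

lemma agree_until_mono:
  assumes "agree_until M a t \<alpha> \<beta>" "s \<le> t"
  shows "agree_until M a s \<alpha> \<beta>"
  using assms(1) unfolding agree_until_def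
proof eventually_elim
  case (elim w)
  then show ?case by eventually_elim (use assms(2) in auto)
qed

lemma agree_until_start: "agree_until M a a \<alpha> \<beta>"
proof -
  have "AE r in lborel. r \<in> {a..a} \<longrightarrow> \<alpha> r w = \<beta> r w" for w
    using AE_lborel_singleton[of a] by eventually_elim auto
  then show ?thesis by (simp add: agree_until_def)
qed

lemma agree_until_switch: "agree_until M a r (switch r \<alpha> \<beta>) \<alpha>"
proof -
  have "AE s in lborel. s \<in> {a..r} \<longrightarrow> switch r \<alpha> \<beta> s w = \<alpha> s w" for w
    using AE_lborel_singleton[of r] by eventually_elim (auto simp: switch_def)
  then show ?thesis by (simp add: agree_until_def)
qed

lemma agree_until_switch_cong:
  assumes "agree_until M a r \<alpha> \<alpha>'"
  shows "agree_until M a t (switch r \<alpha> \<beta>) (switch r \<alpha>' \<beta>)"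
  using assms unfolding agree_until_def
proof eventually_elim
  case (elim w)
  then show ?case by eventually_elim (auto simp: switch_def)
qed

context controlled_dynamics
begin

lemma switch_controls:
  fixes A :: "'x::metric_space set"
  assumes "\<alpha> \<in> ctrl A" "\<beta> \<in> ctrl A"
  shows "switch r \<alpha> \<beta> \<in> ctrl A"
  unfolding controls_def
proof (intro CollectI ballI)
  fix t assume t: "t \<in> {t0..T}"
  let ?N = "restrict_space borel {t0..t} \<Otimes>\<^sub>M F t"
  have [measurable]: "(\<lambda>z. fst z) \<in> ?N \<rightarrow>\<^sub>M borel"
    by (rule measurable_compose[OF measurable_fst]) (simp add: measurable_restrict_space1)
  have "Measurable.pred ?N (\<lambda>z. fst z < r)" by measurable
  then have "(\<lambda>z. if fst z < r then (case z of (s, w) \<Rightarrow> \<alpha> s w) else (case z of (s, w) \<Rightarrow> \<beta> s w))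
     \<in> ?N \<rightarrow>\<^sub>M restrict_space borel A"
    by (intro measurable_If controlsD(1)[OF assms(1) t] controlsD(1)[OF assms(2) t]) (simp add: pred_def)
  then show "(\<lambda>(s, w). switch r \<alpha> \<beta> s w) \<in> ?N \<rightarrow>\<^sub>M restrict_space borel A"
    unfolding switch_def case_prod_unfold .
qed

lemma switch_controls_const:
  fixes A :: "'x::metric_space set"
  assumes \<alpha>: "\<alpha> \<in> ctrl A" and r: "r \<in> {t0..T}" and u: "u \<in> F r \<rightarrow>\<^sub>M restrict_space borel A"
  shows "switch r \<alpha> (\<lambda>_. u) \<in> ctrl A"
  unfolding controls_def
proof (intro CollectI ballI)
  fix t assume t: "t \<in> {t0..T}"
  let ?N = "restrict_space borel {t0..t} \<Otimes>\<^sub>M F t"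
  have [measurable]: "(\<lambda>z. fst z) \<in> ?N \<rightarrow>\<^sub>M borel"
    by (rule measurable_compose[OF measurable_fst]) (simp add: measurable_restrict_space1)
  show "(\<lambda>(s, w). switch r \<alpha> (\<lambda>_. u) s w) \<in> ?N \<rightarrow>\<^sub>M restrict_space borel A"
  proof (cases "t < r")
    case True
    have "(\<lambda>(s, w). switch r \<alpha> (\<lambda>_. u) s w) \<in> ?N \<rightarrow>\<^sub>M restrict_space borel A
      \<longleftrightarrow> (\<lambda>(s, w). \<alpha> s w) \<in> ?N \<rightarrow>\<^sub>M restrict_space borel A"
      using True by (intro measurable_cong) (auto simp: switch_def space_pair_measure space_restrict_space)
    then show ?thesis using controlsD(1)[OF \<alpha> t] by simp
  next
    case False
    have "Measurable.pred ?N (\<lambda>z. fst z < r)" by measurable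
    moreover have "(\<lambda>z. u (snd z)) \<in> ?N \<rightarrow>\<^sub>M restrict_space borel A"
      using False r t t0 by (intro measurable_compose[OF measurable_snd] measurable_F_mono[OF _ _ _ u]) auto
    ultimately have "(\<lambda>z. if fst z < r then (case z of (s, w) \<Rightarrow> \<alpha> s w) else u (snd z))
       \<in> ?N \<rightarrow>\<^sub>M restrict_space borel A"
      by (intro measurable_If controlsD(1)[OF \<alpha> t]) (simp_all add: pred_def)
    then show ?thesis
      unfolding switch_def case_prod_unfold .
  qed
qed

lemma const_controls: "a \<in> A \<Longrightarrow> (\<lambda>_ _. a) \<in> ctrl A"
  by (auto simp: controls_def space_restrict_space case_prod_unfold)

definition grid :: "nat \<Rightarrow> nat \<Rightarrow> real" where
  "grid N k = t0 + real k * ((T - t0) / real N)"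

lemma grid_0 [simp]: "grid N 0 = t0"
  by (simp add: grid_def)

lemma grid_last [simp]: "N > 0 \<Longrightarrow> grid N N = T"
  by (simp add: grid_def)

lemma grid_mono: "j \<le> k \<Longrightarrow> grid N j \<le> grid N k"
  using t0 by (auto simp: grid_def intro!: mult_right_mono divide_right_mono)

lemma grid_mem: "N > 0 \<Longrightarrow> k \<le> N \<Longrightarrow> grid N k \<in> {t0..T}"
  using grid_mono[of 0 k N] grid_mono[of k N N] by simp

lemma grid_cover:
  assumes "N > 0" "t \<in> {t0..T}"
  obtains k where "k < N" "grid N k \<le> t" "t \<le> grid N (Suc k)"
proof -
  let ?K = "{k. k < N \<and> grid N k \<le> t}"
  have K: "finite ?K" "0 \<in> ?K" using assms by auto
  then have m: "Max ?K \<in> ?K" by (intro Max_in) auto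
  show ?thesis
  proof (rule that)
    show "t \<le> grid N (Suc (Max ?K))"
    proof (rule ccontr)
      assume *: "\<not> t \<le> grid N (Suc (Max ?K))"
      then have "Suc (Max ?K) \<noteq> N" using assms by auto
      then have "Suc (Max ?K) \<in> ?K" using * m by auto
      from Max_ge[OF K(1) this] show False by simp
    qed
  qed (use m in auto)
qed

lemma switch_sequence_agree:
  assumes "\<And>k. h (Suc k) = switch (grid N k) (h k) (\<gamma> k)" and "k \<le> j"
  shows "agree_until M t0 (grid N k) (h j) (h k)"
  using assms(2)
proof (induction j rule: dec_induct)
  case (step j)
  have "agree_until M t0 (grid N j) (h (Suc j)) (h j)" unfolding assms(1) by (rule agree_until_switch)
  then have "agree_until M t0 (grid N k) (h (Suc j)) (h j)"
    using grid_mono[OF step(1)] by (rule agree_until_mono)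
  then show ?case using step.IH by (rule agree_until_trans)
qed simp

text \<open>
  Non-anticipativity is tested at the grid points only, so that a response may look ahead to the end of the
  current cell. Every strategy is such a response, and so is the answer of a player who moves second in
  each cell.
\<close>

definition grid_responses ::
  "nat \<Rightarrow> 'y::metric_space set \<Rightarrow> 'x::metric_space set \<Rightarrow> ((real \<Rightarrow> 'w \<Rightarrow> 'y) \<Rightarrow> (real \<Rightarrow> 'w \<Rightarrow> 'x)) set" where
  "grid_responses N B A = {f.
     (\<forall>\<beta>\<in>ctrl B. f \<beta> \<in> ctrl A) \<and>
     (\<forall>k\<le>N. \<forall>\<beta>\<in>ctrl B. \<forall>\<beta>'\<in>ctrl B.
        agree_until M t0 (grid N k) \<beta> \<beta>' \<longrightarrow> agree_until M t0 (grid N k) (f \<beta>) (f \<beta>'))}"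

lemma strategies_grid_responses: "N > 0 \<Longrightarrow> strategies M F T B A t0 \<subseteq> grid_responses N B A"
  using grid_mem by (auto simp: strategies_def grid_responses_def)

context
  fixes N :: nat and A :: "'x::metric_space set" and B :: "'y::metric_space set"
    and P :: "(real \<Rightarrow> 'w \<Rightarrow> 'x) \<Rightarrow> (real \<Rightarrow> 'w \<Rightarrow> 'y) \<Rightarrow> bool"
  assumes N: "N > 0" and ne: "A \<noteq> {}" "B \<noteq> {}"
    and P_cong: "\<And>\<alpha> \<alpha>' \<beta> \<beta>'. \<alpha> \<in> ctrl A \<Longrightarrow> \<alpha>' \<in> ctrl A \<Longrightarrow>
      \<beta> \<in> ctrl B \<Longrightarrow> \<beta>' \<in> ctrl B \<Longrightarrow>
      agree_until M t0 T \<alpha> \<alpha>' \<Longrightarrow> agree_until M t0 T \<beta> \<beta>' \<Longrightarrow> P \<alpha> \<beta> \<longleftrightarrow> P \<alpha>' \<beta>'"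
begin

text \<open>
  The truth of \<open>win n \<alpha> \<beta>\<close> means: when \<open>n\<close> cells remain and \<open>\<alpha>\<close>, \<open>\<beta>\<close> have been played before, the player with
  control set \<open>B\<close> can force \<open>P\<close>, although he has to move first in every cell. A move is a control on the whole
  interval that takes over at the beginning of the cell; its continuation beyond the cell is overwritten by
  the next move.
\<close>

primrec win :: "nat \<Rightarrow> (real \<Rightarrow> 'w \<Rightarrow> 'x) \<Rightarrow> (real \<Rightarrow> 'w \<Rightarrow> 'y) \<Rightarrow> bool" where
  "win 0 = P"
| "win (Suc n) = (\<lambda>\<alpha> \<beta>. \<exists>u\<in>ctrl B. \<forall>v\<in>ctrl A.
     win n (switch (grid N (N - Suc n)) \<alpha> v) (switch (grid N (N - Suc n)) \<beta> u))"

lemma win_step: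
  assumes "k < N"
  shows "win (N - k) \<alpha> \<beta> \<longleftrightarrow> (\<exists>u\<in>ctrl B. \<forall>v\<in>ctrl A.
     win (N - Suc k) (switch (grid N k) \<alpha> v) (switch (grid N k) \<beta> u))"
proof -
  have "N - k = Suc (N - Suc k)" "N - Suc (N - Suc k) = k" using assms by auto
  then show ?thesis by simp
qed

lemma win_cong:
  assumes "n \<le> N" "\<alpha> \<in> ctrl A" "\<alpha>' \<in> ctrl A"
    "\<beta> \<in> ctrl B" "\<beta>' \<in> ctrl B"
    "agree_until M t0 (grid N (N - n)) \<alpha> \<alpha>'" "agree_until M t0 (grid N (N - n)) \<beta> \<beta>'"
  shows "win n \<alpha> \<beta> \<longleftrightarrow> win n \<alpha>' \<beta>'"
  using assms
proof (induction n arbitrary: \<alpha> \<alpha>' \<beta> \<beta>')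
  case 0
  then show ?case using P_cong[of \<alpha> \<alpha>' \<beta> \<beta>'] N by simp
next
  case (Suc n)
  have "win n (switch (grid N (N - Suc n)) \<alpha> v) (switch (grid N (N - Suc n)) \<beta> u) \<longleftrightarrow>
    win n (switch (grid N (N - Suc n)) \<alpha>' v) (switch (grid N (N - Suc n)) \<beta>' u)"
    if "u \<in> ctrl B" "v \<in> ctrl A" for u v
  proof -
    have "n \<le> N" using Suc.prems(1) by simp
    then show ?thesis
      by (rule Suc.IH[OF _ switch_controls[OF Suc.prems(2) that(2)] switch_controls[OF Suc.prems(3) that(2)]
          switch_controls[OF Suc.prems(4) that(1)] switch_controls[OF Suc.prems(5) that(1)]
          agree_until_switch_cong[OF Suc.prems(6)] agree_until_switch_cong[OF Suc.prems(7)]])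
  qed
  then show ?case unfolding win.simps by (intro bex_cong ball_cong refl)
qed

text \<open>
  A winning first mover chooses his control on a cell from what the opponent did before that cell. The
  resulting map reacts with a delay and is therefore non-anticipative at all times, not only at the grid
  points. It is compatible with \<open>agree_until\<close> because the predicates from which \<open>SOME\<close> chooses are equal for
  pasts that agree almost everywhere.
\<close>

lemma determined_win:
  assumes win: "\<alpha>0 \<in> ctrl A" "\<beta>0 \<in> ctrl B" "win N \<alpha>0 \<beta>0"
  shows "\<exists>S\<in>strategies M F T A B t0. \<forall>\<alpha>\<in>ctrl A. P \<alpha> (S \<alpha>)"
proof -
  define good where "good k \<alpha> \<beta> u \<longleftrightarrow> u \<in> ctrl B \<and> (\<forall>v\<in>ctrl A.
     win (N - Suc k) (switch (grid N k) \<alpha> v) (switch (grid N k) \<beta> u))" for k \<alpha> \<beta> u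
  define U where "U k \<alpha> \<beta> = (SOME u. good k \<alpha> \<beta> u)" for k \<alpha> \<beta>
  define h where "h \<alpha> = rec_nat \<beta>0 (\<lambda>k \<beta>. switch (grid N k) \<beta> (U k \<alpha> \<beta>))" for \<alpha>
  have h0: "h \<alpha> 0 = \<beta>0" and hS: "h \<alpha> (Suc k) = switch (grid N k) (h \<alpha> k) (U k \<alpha> (h \<alpha> k))" for \<alpha> k
    by (simp_all add: h_def)
  have h: "h \<alpha> k \<in> ctrl B \<and> win (N - k) \<alpha> (h \<alpha> k)"
    if "k \<le> N" and \<alpha>: "\<alpha> \<in> ctrl A" for k \<alpha>
    using that(1)
  proof (induction k)
    case 0
    have "win N \<alpha> \<beta>0 \<longleftrightarrow> win N \<alpha>0 \<beta>0"
      using win \<alpha> by (intro win_cong) (auto intro: agree_until_start)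
    then show ?case using win by (simp add: h0)
  next
    case (Suc k)
    then have IH: "h \<alpha> k \<in> ctrl B" "win (N - k) \<alpha> (h \<alpha> k)" and k: "k < N" by auto
    have "\<exists>u. good k \<alpha> (h \<alpha> k) u" using IH(2) unfolding win_step[OF k] good_def by blast
    then have "good k \<alpha> (h \<alpha> k) (U k \<alpha> (h \<alpha> k))" unfolding U_def by (rule someI_ex)
    then have "U k \<alpha> (h \<alpha> k) \<in> ctrl B"
      "win (N - Suc k) (switch (grid N k) \<alpha> \<alpha>) (switch (grid N k) (h \<alpha> k) (U k \<alpha> (h \<alpha> k)))"
      using \<alpha> unfolding good_def by blast+
    then show ?case using IH(1) by (simp add: hS switch_controls)
  qed
  have h_later: "agree_until M t0 (grid N k) (h \<alpha> j) (h \<alpha> k)" if "k \<le> j" for \<alpha> j k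
    using hS that by (rule switch_sequence_agree)
  have good_eq: "good k \<alpha> \<beta> = good k \<alpha>' \<beta>"
    if "k < N" "\<beta> \<in> ctrl B" "\<alpha> \<in> ctrl A" "\<alpha>' \<in> ctrl A"
      and agree: "agree_until M t0 (grid N k) \<alpha> \<alpha>'" for k \<alpha> \<alpha>' \<beta>
  proof -
    have "win (N - Suc k) (switch (grid N k) \<alpha> v) (switch (grid N k) \<beta> u) \<longleftrightarrow>
        win (N - Suc k) (switch (grid N k) \<alpha>' v) (switch (grid N k) \<beta> u)"
      if "u \<in> ctrl B" "v \<in> ctrl A" for u v
      by (rule win_cong[OF _ switch_controls switch_controls switch_controls switch_controls agree_until_switch_cong[OF agree] agree_until_refl])
        (use that \<open>\<beta> \<in> _\<close> \<open>\<alpha> \<in> _\<close> \<open>\<alpha>' \<in> _\<close> in simp_all)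
    then show ?thesis unfolding good_def fun_eq_iff by blast
  qed
  have h_eq: "h \<alpha> (Suc j) = h \<alpha>' (Suc j)"
    if \<alpha>: "\<alpha> \<in> ctrl A" "\<alpha>' \<in> ctrl A" and k: "k < N" "j \<le> k"
      and agree: "agree_until M t0 (grid N k) \<alpha> \<alpha>'" for \<alpha> \<alpha>' j k
    using k(2)
  proof (induction j)
    case (0)
    have "good 0 \<alpha> \<beta>0 = good 0 \<alpha>' \<beta>0"
      by (rule good_eq[OF N win(2) \<alpha>]) (simp add: agree_until_start)
    then show ?case by (simp add: hS h0 U_def)
  next
    case (Suc j)
    then have IH: "h \<alpha> (Suc j) = h \<alpha>' (Suc j)" by simp
    have j: "Suc j < N" using Suc k by auto
    have a: "agree_until M t0 (grid N (Suc j)) \<alpha> \<alpha>'"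
      using agree grid_mono[OF Suc.prems] by (rule agree_until_mono)
    have "good (Suc j) \<alpha> (h \<alpha> (Suc j)) = good (Suc j) \<alpha>' (h \<alpha> (Suc j))"
      using j h[of "Suc j" \<alpha>] \<alpha>(1) by (intro good_eq[OF j _ \<alpha> a]) simp
    then show ?case by (simp only: hS[of _ "Suc j"] IH U_def)
  qed
  show ?thesis
  proof (intro bexI ballI)
    show "P \<alpha> (h \<alpha> N)" if "\<alpha> \<in> ctrl A" for \<alpha>
      using h[of N \<alpha>] that by simp
    show "(\<lambda>\<alpha>. h \<alpha> N) \<in> strategies M F T A B t0"
      unfolding strategies_def
    proof (intro CollectI conjI ballI impI)
      show "h \<alpha> N \<in> ctrl B" if "\<alpha> \<in> ctrl A" for \<alpha>
        using h[of N \<alpha>] that by simp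
      fix t \<alpha> \<alpha>' assume t: "t \<in> {t0..T}" and \<alpha>: "\<alpha> \<in> ctrl A" "\<alpha>' \<in> ctrl A"
        and agree: "agree_until M t0 t \<alpha> \<alpha>'"
      obtain k where k: "k < N" "grid N k \<le> t" "t \<le> grid N (Suc k)" using grid_cover[OF N t] .
      have eq: "h \<alpha> (Suc k) = h \<alpha>' (Suc k)"
        by (rule h_eq[OF \<alpha> k(1) order_refl agree_until_mono[OF agree k(2)]])
      have "Suc k \<le> N" using k(1) by simp
      note later = h_later[OF this, of \<alpha>] agree_until_sym[OF h_later[OF this, of \<alpha>'], folded eq]
      from agree_until_mono[OF agree_until_trans[OF later] k(3)]
      show "agree_until M t0 t (h \<alpha> N) (h \<alpha>' N)" .
    qed
  qed
qed

text \<open>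
  The second mover has seen the opponent's control on the whole cell before he answers. His answers thus
  depend on the opponent's control up to the end of the cell.
\<close>

lemma determined_lose:
  assumes lose: "\<alpha>0 \<in> ctrl A" "\<beta>0 \<in> ctrl B" "\<not> win N \<alpha>0 \<beta>0"
  shows "\<exists>f\<in>grid_responses N B A. \<forall>\<beta>\<in>ctrl B. \<not> P (f \<beta>) \<beta>"
proof -
  define good where "good k \<alpha> \<beta> v \<longleftrightarrow> v \<in> ctrl A \<and>
     \<not> win (N - Suc k) (switch (grid N k) \<alpha> v) \<beta>" for k \<alpha> \<beta> v
  define V where "V k \<alpha> \<beta> = (SOME v. good k \<alpha> \<beta> v)" for k \<alpha> \<beta>
  define h where "h \<beta> = rec_nat \<alpha>0 (\<lambda>k \<alpha>. switch (grid N k) \<alpha> (V k \<alpha> \<beta>))" for \<beta>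
  have h0: "h \<beta> 0 = \<alpha>0" and hS: "h \<beta> (Suc k) = switch (grid N k) (h \<beta> k) (V k (h \<beta> k) \<beta>)" for \<beta> k
    by (simp_all add: h_def)
  have h: "h \<beta> k \<in> ctrl A \<and> \<not> win (N - k) (h \<beta> k) \<beta>"
    if "k \<le> N" and \<beta>: "\<beta> \<in> ctrl B" for k \<beta>
    using that(1)
  proof (induction k)
    case 0
    have "win N \<alpha>0 \<beta> \<longleftrightarrow> win N \<alpha>0 \<beta>0"
      using lose \<beta> by (intro win_cong) (auto intro: agree_until_start)
    then show ?case using lose by (simp add: h0)
  next
    case (Suc k)
    then have IH: "h \<beta> k \<in> ctrl A" "\<not> win (N - k) (h \<beta> k) \<beta>" and k: "k < N" by auto
    have "\<exists>v\<in>ctrl A. \<not> win (N - Suc k) (switch (grid N k) (h \<beta> k) v) (switch (grid N k) \<beta> \<beta>)"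
      using IH(2) \<beta> unfolding win_step[OF k] by blast
    then have "\<exists>v. good k (h \<beta> k) \<beta> v" unfolding good_def by auto
    then have "good k (h \<beta> k) \<beta> (V k (h \<beta> k) \<beta>)" unfolding V_def by (rule someI_ex)
    then show ?case using IH(1) by (simp add: hS switch_controls good_def)
  qed
  have h_later: "agree_until M t0 (grid N k) (h \<beta> j) (h \<beta> k)" if "k \<le> j" for \<beta> j k
    using hS that by (rule switch_sequence_agree)
  have h_eq: "h \<beta> j = h \<beta>' j"
    if \<beta>: "\<beta> \<in> ctrl B" "\<beta>' \<in> ctrl B" and k: "k \<le> N" "j \<le> k"
      and agree: "agree_until M t0 (grid N k) \<beta> \<beta>'" for \<beta> \<beta>' j k
    using k(2)
  proof (induction j)
    case (Suc j)
    then have IH: "h \<beta> j = h \<beta>' j" by simp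
    have j: "j < N" using Suc k by auto
    have a: "agree_until M t0 (grid N (Suc j)) \<beta> \<beta>'"
      using agree grid_mono[OF Suc.prems] by (rule agree_until_mono)
    have "win (N - Suc j) (switch (grid N j) (h \<beta> j) v) \<beta> \<longleftrightarrow> win (N - Suc j) (switch (grid N j) (h \<beta> j) v) \<beta>'"
      if "v \<in> ctrl A" for v
      by (rule win_cong[OF _ switch_controls switch_controls \<beta> agree_until_refl])
        (use that j a h[of j \<beta>] \<beta> in \<open>simp_all add: Suc_diff_Suc\<close>)
    then have "good j (h \<beta> j) \<beta> = good j (h \<beta> j) \<beta>'"
      unfolding good_def fun_eq_iff by blast
    then show ?case by (simp only: hS IH V_def)
  qed (simp add: h0)
  show ?thesis
  proof (intro bexI ballI)
    show "\<not> P (h \<beta> N) \<beta>" if "\<beta> \<in> ctrl B" for \<beta>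
      using h[of N \<beta>] that by simp
    show "(\<lambda>\<beta>. h \<beta> N) \<in> grid_responses N B A"
      unfolding grid_responses_def
    proof (intro CollectI conjI ballI impI allI)
      show "h \<beta> N \<in> ctrl A" if "\<beta> \<in> ctrl B" for \<beta>
        using h[of N \<beta>] that by simp
      fix k \<beta> \<beta>' assume k: "k \<le> N" and \<beta>: "\<beta> \<in> ctrl B" "\<beta>' \<in> ctrl B"
        and agree: "agree_until M t0 (grid N k) \<beta> \<beta>'"
      have eq: "h \<beta> k = h \<beta>' k" by (rule h_eq[OF \<beta> k order_refl agree])
      show "agree_until M t0 (grid N k) (h \<beta> N) (h \<beta>' N)"
        using agree_until_trans[OF h_later[OF k] agree_until_sym[OF h_later[OF k, of \<beta>'], folded eq]] .
    qed
  qed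
qed

text \<open>
  A finite game of perfect information is determined: negating the alternating quantifiers in \<open>win\<close> turns
  the failure of the first mover into a success of the second.
\<close>

lemma determined:
  "(\<exists>S\<in>strategies M F T A B t0. \<forall>\<alpha>\<in>ctrl A. P \<alpha> (S \<alpha>)) \<or>
   (\<exists>f\<in>grid_responses N B A. \<forall>\<beta>\<in>ctrl B. \<not> P (f \<beta>) \<beta>)"
proof -
  obtain a c where "a \<in> A" "c \<in> B" using ne by blast
  then show ?thesis
    using determined_win[OF const_controls const_controls] determined_lose[OF const_controls const_controls] by blast
qed

end

end

section \<open>Extremal aiming\<close>

locale isaacs_game = controlled_dynamics M T F W A1 A2 b C t0 \<xi>
  for M :: "'w measure" and T :: real and F :: "real \<Rightarrow> 'w measure"
    and W :: "real \<Rightarrow> 'w \<Rightarrow> real ^ 'n::finite"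
    and A1 :: "'a::metric_space set" and A2 :: "'b::metric_space set"
    and b :: "'n torus \<Rightarrow> 'a \<Rightarrow> 'b \<Rightarrow> 'n torus_prob \<Rightarrow> real ^ 'n"
    and C :: real and t0 :: real and \<xi> :: "'w \<Rightarrow> 'n torus" +
  fixes L :: "'n torus \<Rightarrow> 'a \<Rightarrow> 'b \<Rightarrow> 'n torus_prob \<Rightarrow> real" and B :: real
  assumes L: "lipschitz_data A1 A2 C L"
    and B_pos: "B > 0"
    and b_bound: "\<forall>x. \<forall>a1\<in>A1. \<forall>a2\<in>A2. \<forall>m. norm (b x a1 a2 m) \<le> B"
    and L_bound: "\<forall>x. \<forall>a1\<in>A1. \<forall>a2\<in>A2. \<forall>m. norm (L x a1 a2 m) \<le> B"
    and isaacs: "\<forall>x p m. hamiltonian_plus A1 A2 b L x p m = hamiltonian_minus A1 A2 b L x p m"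
begin

text \<open>
  With \<open>\<kappa> = 1\<close> the negative of this is the expression under the extrema in the Hamiltonians. The weight \<open>\<kappa>\<close>
  of the running cost is allowed to vary because costs and states are aimed at simultaneously.
\<close>

definition rate :: "real \<Rightarrow> real ^ 'n \<Rightarrow> 'n torus \<Rightarrow> 'a \<Rightarrow> 'b \<Rightarrow> 'n torus_prob \<Rightarrow> real" where
  "rate \<kappa> p x a1 a2 m = \<kappa> * L x a1 a2 m + p \<bullet> b x a1 a2 m"

lemma rate_lipschitz:
  assumes "\<kappa> \<ge> 0" "a1 \<in> A1" "a2 \<in> A2"
  shows "\<bar>rate \<kappa> p x a1 a2 m - rate \<kappa> p x' a1 a2 m'\<bar> \<le> C * (\<kappa> + norm p) * (dist x x' + dist m m')"
proof -
  let ?d = "dist x x' + dist m m'"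
  have "rate \<kappa> p x a1 a2 m - rate \<kappa> p x' a1 a2 m' =
    \<kappa> * (L x a1 a2 m - L x' a1 a2 m') + p \<bullet> (b x a1 a2 m - b x' a1 a2 m')"
    by (simp add: rate_def algebra_simps inner_diff_right)
  also have "\<bar>\<dots>\<bar> \<le> \<kappa> * \<bar>L x a1 a2 m - L x' a1 a2 m'\<bar> + norm p * norm (b x a1 a2 m - b x' a1 a2 m')"
    using assms(1) Cauchy_Schwarz_ineq2[of p "b x a1 a2 m - b x' a1 a2 m'"]
    by (intro order_trans[OF abs_triangle_ineq]) (auto simp: abs_mult)
  also have "\<dots> \<le> \<kappa> * (C * ?d) + norm p * (C * ?d)"
    using lipschitz_dataD[OF L assms(2,3), of x m x' m'] lipschitz_dataD[OF b assms(2,3), of x m x' m'] assms(1)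
    by (intro add_mono mult_left_mono) (auto simp: dist_norm)
  finally show ?thesis by (simp add: algebra_simps)
qed

lemma rate_diff_momentum:
  assumes "a1 \<in> A1" "a2 \<in> A2"
  shows "\<bar>rate \<kappa> p x a1 a2 m - rate \<kappa> q x a1 a2 m\<bar> \<le> B * norm (p - q)"
proof -
  have "rate \<kappa> p x a1 a2 m - rate \<kappa> q x a1 a2 m = (p - q) \<bullet> b x a1 a2 m"
    by (simp add: rate_def inner_diff_left)
  also have "\<bar>\<dots>\<bar> \<le> norm (p - q) * norm (b x a1 a2 m)" by (rule Cauchy_Schwarz_ineq2)
  also have "\<dots> \<le> norm (p - q) * B" using b_bound assms by (intro mult_left_mono) auto
  finally show ?thesis by (simp add: mult.commute)
qed

text \<open>
  The choice \<open>v\<close> of player 1 and the choice \<open>u\<close> of player 2 are used in two different plays: against \<open>u\<close> player 1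
  cannot get more than \<open>\<epsilon>\<close> above what \<open>v\<close> guarantees to player 1.
\<close>

definition saddle ::
  "real \<Rightarrow> real \<Rightarrow> real ^ 'n \<Rightarrow> 'n torus \<Rightarrow> 'n torus_prob \<Rightarrow> 'a \<Rightarrow> 'b \<Rightarrow> bool" where
  "saddle \<epsilon> \<kappa> p x m v u \<longleftrightarrow> v \<in> A1 \<and> u \<in> A2 \<and>
     (\<forall>a1\<in>A1. \<forall>a2\<in>A2. rate \<kappa> p x a1 u m \<le> rate \<kappa> p x v a2 m + \<epsilon>)"

text \<open>
  The rate is homogeneous of degree one in \<open>(\<kappa>, p)\<close>, so the Isaacs condition at the momentum \<open>p / \<kappa>\<close> applies.
  The inequality between the two sides needs \<open>v\<close> nearly optimal in \<open>H\<^sup>-\<close> and \<open>u\<close> nearly optimal in \<open>H\<^sup>+\<close>.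
\<close>

lemma saddle_exists_pos:
  assumes "\<kappa> > 0" "\<epsilon> > 0"
  shows "\<exists>v u. saddle \<epsilon> \<kappa> p x m v u"
proof -
  define q where "q = (1 / \<kappa>) *\<^sub>R p"
  define \<phi> where "\<phi> a1 a2 = - L x a1 a2 m - b x a1 a2 m \<bullet> q" for a1 a2
  define \<delta> where "\<delta> = \<epsilon> / (2 * \<kappa>)"
  have \<delta>: "\<delta> > 0" using assms by (simp add: \<delta>_def)
  have rate: "rate \<kappa> p x a1 a2 m = - \<kappa> * \<phi> a1 a2" for a1 a2
    using assms by (simp add: rate_def \<phi>_def q_def algebra_simps inner_commute)
  have bd: "\<bar>\<phi> a1 a2\<bar> \<le> B + B * norm q" if "a1 \<in> A1" "a2 \<in> A2" for a1 a2
  proof -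
    have "\<bar>\<phi> a1 a2\<bar> \<le> \<bar>L x a1 a2 m\<bar> + \<bar>b x a1 a2 m \<bullet> q\<bar>" unfolding \<phi>_def by linarith
    also have "\<dots> \<le> B + norm (b x a1 a2 m) * norm q"
      using L_bound that by (intro add_mono Cauchy_Schwarz_ineq2) auto
    also have "\<dots> \<le> B + B * norm q" using b_bound that by (intro add_mono mult_right_mono) auto
    finally show ?thesis .
  qed
  define h where "h = hamiltonian_minus A1 A2 b L x q m"
  have h1: "h = (INF a1\<in>A1. SUP a2\<in>A2. \<phi> a1 a2)" by (simp add: h_def hamiltonian_minus_def \<phi>_def)
  have h2: "h = (SUP a2\<in>A2. INF a1\<in>A1. \<phi> a1 a2)"
    unfolding h_def using isaacs by (metis hamiltonian_plus_def[of A1 A2 b L x q m, folded \<phi>_def])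
  have "(INF a1\<in>A1. SUP a2\<in>A2. \<phi> a1 a2) < h + \<delta>" using h1 \<delta> by simp
  from cInf_lessD[OF _ this] A1 obtain v where v: "v \<in> A1" "(SUP a2\<in>A2. \<phi> v a2) < h + \<delta>" by auto
  have "h - \<delta> < (SUP a2\<in>A2. INF a1\<in>A1. \<phi> a1 a2)" using h2 \<delta> by simp
  from less_cSupD[OF _ this] A2 obtain u where u: "u \<in> A2" "h - \<delta> < (INF a1\<in>A1. \<phi> a1 u)" by auto
  have "rate \<kappa> p x a1 u m \<le> rate \<kappa> p x v a2 m + \<epsilon>" if a: "a1 \<in> A1" "a2 \<in> A2" for a1 a2
  proof -
    have "\<phi> v a2 \<le> (SUP a2\<in>A2. \<phi> v a2)"
      using bd[OF v(1)] a by (intro cSUP_upper bdd_aboveI2[of _ _ "B + B * norm q"]) (auto simp: abs_le_iff)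
    moreover have "(INF a1\<in>A1. \<phi> a1 u) \<le> \<phi> a1 u"
      using bd[OF _ u(1)] a by (intro cINF_lower bdd_belowI2[of _ "- (B + B * norm q)"]) (force simp: abs_le_iff)+
    ultimately have "\<phi> v a2 - \<phi> a1 u \<le> 2 * \<delta>" using u v by simp
    then have "\<kappa> * (\<phi> v a2 - \<phi> a1 u) \<le> \<kappa> * (2 * \<delta>)" using assms by (intro mult_left_mono) auto
    also have "\<kappa> * (2 * \<delta>) = \<epsilon>" using assms by (simp add: \<delta>_def)
    finally show ?thesis by (simp add: rate algebra_simps)
  qed
  then show ?thesis using u v by (auto simp: saddle_def)
qed

text \<open>
  The weight \<open>0\<close> is reached by a small perturbation \<open>\<eta>\<close> of \<open>\<kappa>\<close>, which changes every rate by at most \<open>\<eta> * B\<close>.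
\<close>

lemma saddle_exists:
  assumes "\<kappa> \<ge> 0" "\<epsilon> > 0"
  shows "\<exists>v u. saddle \<epsilon> \<kappa> p x m v u"
proof -
  define \<eta> where "\<eta> = \<epsilon> / (4 * B)"
  have \<eta>: "\<eta> > 0" using assms B_pos by (simp add: \<eta>_def)
  then obtain v u where vu: "saddle (\<epsilon> / 2) (\<kappa> + \<eta>) p x m v u"
    using saddle_exists_pos[of "\<kappa> + \<eta>" "\<epsilon> / 2" p x m] assms by auto
  have *: "rate (\<kappa> + \<eta>) p x a1 a2 m = rate \<kappa> p x a1 a2 m + \<eta> * L x a1 a2 m" for a1 a2
    by (simp add: rate_def algebra_simps)
  have **: "\<bar>\<eta> * L x a1 a2 m\<bar> \<le> \<epsilon> / 4" if "a1 \<in> A1" "a2 \<in> A2" for a1 a2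
  proof -
    have "\<bar>\<eta> * L x a1 a2 m\<bar> = \<eta> * \<bar>L x a1 a2 m\<bar>" using \<eta> by (simp add: abs_mult)
    also have "\<dots> \<le> \<eta> * B" using L_bound that \<eta> by (intro mult_left_mono) auto
    finally show ?thesis using B_pos by (simp add: \<eta>_def)
  qed
  have "saddle \<epsilon> \<kappa> p x m v u"
    unfolding saddle_def
  proof (intro conjI ballI)
    show v: "v \<in> A1" and u: "u \<in> A2" using vu by (auto simp: saddle_def)
    fix a1 a2 assume a: "a1 \<in> A1" "a2 \<in> A2"
    have "rate (\<kappa> + \<eta>) p x a1 u m \<le> rate (\<kappa> + \<eta>) p x v a2 m + \<epsilon> / 2"
      using vu a by (auto simp: saddle_def)
    then show "rate \<kappa> p x a1 u m \<le> rate \<kappa> p x v a2 m + \<epsilon>"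
      using **[OF a(1) u] **[OF v a(2)] unfolding * by linarith
  qed
  then show ?thesis by blast
qed

text \<open>
  The rate is Lipschitz in \<open>(x, p)\<close> uniformly in the controls, so a saddle with half the tolerance at one
  point is a saddle at all nearby points.
\<close>

lemma saddle_selection:
  assumes \<kappa>: "\<kappa> \<ge> 0" and \<epsilon>: "\<epsilon> > 0"
  shows "\<exists>(j :: 'n torus \<times> (real ^ 'n) \<Rightarrow> nat) v u. j \<in> borel \<rightarrow>\<^sub>M count_space UNIV \<and>
    (\<forall>x p. saddle \<epsilon> \<kappa> p x m (v (j (x, p))) (u (j (x, p))))"
proof -
  define Q where "Q z w = saddle \<epsilon> \<kappa> (snd z) (fst z) m (fst w) (snd w)" for z w
  have "\<exists>w U. open U \<and> z \<in> U \<and> (\<forall>y\<in>U. Q y w)" for z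
  proof -
    obtain x p where z: "z = (x, p)" by (cases z)
    obtain v u where vu: "saddle (\<epsilon> / 2) \<kappa> p x m v u" using saddle_exists[of \<kappa> "\<epsilon> / 2" p x m] assms by auto
    define K where "K = B + C * (\<kappa> + norm p)"
    have K: "K > 0" using B_pos Cb_nonneg \<kappa> by (simp add: K_def add_pos_nonneg)
    define r where "r = \<epsilon> / (4 * K)"
    have r: "r > 0" "K * r = \<epsilon> / 4" using K \<epsilon> by (auto simp: r_def)
    have near: "\<bar>rate \<kappa> q y a1 a2 m - rate \<kappa> p x a1 a2 m\<bar> \<le> \<epsilon> / 4"
      if "(y, q) \<in> ball z r" and a: "a1 \<in> A1" "a2 \<in> A2" for y q a1 a2
    proof -
      have "dist (y, q) (x, p) < r" using that by (simp add: z dist_commute)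
      then have d: "dist y x \<le> r" "norm (q - p) \<le> r"
        using dist_fst_le[of "(y, q)" "(x, p)"] dist_snd_le[of "(y, q)" "(x, p)"] by (auto simp: dist_norm)
      have "\<bar>rate \<kappa> q y a1 a2 m - rate \<kappa> p x a1 a2 m\<bar> \<le> B * norm (q - p) + C * (\<kappa> + norm p) * (dist y x + dist m m)"
        using rate_diff_momentum[OF a, of \<kappa> q y m p] rate_lipschitz[OF \<kappa> a, of p y m x m] by linarith
      also have "\<dots> \<le> B * r + C * (\<kappa> + norm p) * r"
        using d B_pos \<kappa> Cb_nonneg by (intro add_mono mult_left_mono) auto
      also have "\<dots> = \<epsilon> / 4" using r(2) by (simp add: K_def algebra_simps)
      finally show ?thesis .
    qed
    have "Q y (v, u)" if "y \<in> ball z r" for y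
    proof -
      obtain x' p' where y: "y = (x', p')" by (cases y)
      have vA: "v \<in> A1" "u \<in> A2" using vu by (auto simp: saddle_def)
      have "rate \<kappa> p' x' a1 u m \<le> rate \<kappa> p' x' v a2 m + \<epsilon>" if a: "a1 \<in> A1" "a2 \<in> A2" for a1 a2
      proof -
        have "rate \<kappa> p x a1 u m \<le> rate \<kappa> p x v a2 m + \<epsilon> / 2" using vu a by (auto simp: saddle_def)
        then show ?thesis
          using near[OF \<open>y \<in> ball z r\<close>[unfolded y] a(1) vA(2)] near[OF \<open>y \<in> ball z r\<close>[unfolded y] vA(1) a(2)]
          by linarith
      qed
      then show ?thesis using vA by (auto simp: Q_def saddle_def y)
    qed
    then show ?thesis using r by (intro exI[of _ "(v, u)"] exI[of _ "ball z r"]) auto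
  qed
  from countable_measurable_selection[of Q, OF this]
  obtain j :: "'n torus \<times> (real ^ 'n) \<Rightarrow> nat" and w where j: "j \<in> borel \<rightarrow>\<^sub>M count_space UNIV" "\<And>z. Q z (w (j z))" by auto
  then show ?thesis
    by (intro exI[of _ j] exI[of _ "\<lambda>n. fst (w n)"] exI[of _ "\<lambda>n. snd (w n)"]) (auto simp: Q_def)
qed

end

context controlled_dynamics
begin

text \<open>
  The mean distance is a continuous function on the compact square of times and vanishes on the diagonal.
  The noise enters the later estimates through this modulus only.
\<close>

lemma uncontrolled_modulus:
  assumes "\<rho> > 0"
  shows "\<exists>\<delta>>0. \<forall>r\<in>{t0..T}. \<forall>s\<in>{t0..T}. \<bar>s - r\<bar> < \<delta> \<longrightarrow>
    fluctuation s r \<le> \<rho>"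
proof -
  let ?q = "\<lambda>z. \<integral>w. dist (uncontrolled (fst z) w) (uncontrolled (snd z) w) \<partial>M"
  let ?S = "{t0..T} \<times> {t0..T}"
  note m = adapted_path_M[OF adapted_path_uncontrolled]
  have "continuous_on ?S ?q"
  proof (rule continuous_on_sequentiallyI)
    fix u a assume u: "\<forall>n. u n \<in> ?S" and a: "a \<in> ?S" and lim: "u \<longlonglongrightarrow> a"
    show "(\<lambda>n. ?q (u n)) \<longlonglongrightarrow> ?q a"
    proof (rule integral_dominated_convergence[where w="\<lambda>_. CARD('n)"])
      show "AE w in M. (\<lambda>n. dist (uncontrolled (fst (u n)) w) (uncontrolled (snd (u n)) w))
        \<longlonglongrightarrow> dist (uncontrolled (fst a) w) (uncontrolled (snd a) w)"
      proof (rule AE_I2)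
        fix w assume w: "w \<in> space M"
        have "fst (u n) \<in> {t0..T}" "snd (u n) \<in> {t0..T}" for n using u[rule_format, of n] by (auto simp: mem_Times_iff)
        then show "(\<lambda>n. dist (uncontrolled (fst (u n)) w) (uncontrolled (snd (u n)) w))
          \<longlonglongrightarrow> dist (uncontrolled (fst a) w) (uncontrolled (snd a) w)"
          using a by (intro tendsto_dist continuous_on_tendsto_compose[OF adapted_pathD(2)[OF adapted_path_uncontrolled w]]
              tendsto_fst[OF lim] tendsto_snd[OF lim] always_eventually allI) (auto simp: mem_Times_iff)
      qed
      show "(\<lambda>w. dist (uncontrolled (fst (u n)) w) (uncontrolled (snd (u n)) w)) \<in> borel_measurable M" for n
        using u[rule_format, of n] by (intro borel_measurable_dist m) (auto simp: mem_Times_iff)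
      show "(\<lambda>w. dist (uncontrolled (fst a) w) (uncontrolled (snd a) w)) \<in> borel_measurable M"
        using a by (intro borel_measurable_dist m) (auto simp: mem_Times_iff)
      show "AE w in M. norm (dist (uncontrolled (fst (u n)) w) (uncontrolled (snd (u n)) w)) \<le> CARD('n)" for n
        by (rule AE_I2) (simp add: dist_torus_le_card)
    qed auto
  qed
  then have "uniformly_continuous_on ?S ?q"
    by (intro compact_uniformly_continuous compact_Times compact_Icc)
  then obtain \<delta> where \<delta>: "\<delta> > 0" "\<And>z z'. z \<in> ?S \<Longrightarrow> z' \<in> ?S \<Longrightarrow> dist z' z < \<delta> \<Longrightarrow> dist (?q z') (?q z) < \<rho>"
    using assms unfolding uniformly_continuous_on_def by blast
  show ?thesis
  proof (intro exI[of _ \<delta>] conjI ballI impI \<delta>(1))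
    fix r s assume "r \<in> {t0..T}" "s \<in> {t0..T}" "\<bar>s - r\<bar> < \<delta>"
    then have "dist (?q (s, r)) (?q (r, r)) < \<rho>"
      by (intro \<delta>(2)) (auto simp: dist_Pair_Pair dist_real_def)
    then show "fluctuation s r \<le> \<rho>"
      by (simp add: dist_real_def)
  qed
qed

lemma uncontrolled_fluctuation:
  assumes r: "t0 \<le> r" "r \<le> r'" "r' \<le> T"
    and \<rho>: "\<And>s. s \<in> {r..r'} \<Longrightarrow> fluctuation s r \<le> \<rho>"
  shows "w \<in> space M \<Longrightarrow> set_integrable lborel {r..r'} (\<lambda>s. dist (uncontrolled s w) (uncontrolled r w))" (is "_ \<Longrightarrow> ?int")
    and "integrable M (\<lambda>w. LINT s:{r..r'}|lborel. dist (uncontrolled s w) (uncontrolled r w))"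
    and "(\<integral>w. (LINT s:{r..r'}|lborel. dist (uncontrolled s w) (uncontrolled r w)) \<partial>M) \<le> \<rho> * (r' - r)"
proof -
  let ?d = "\<lambda>s w. dist (uncontrolled s w) (uncontrolled r w)"
  let ?R = "restrict_space lborel {r..r'}"
  show "?int" if w: "w \<in> space M"
  proof -
    have "continuous_on {r..r'} (\<lambda>s. ?d s w)"
      using r by (intro continuous_on_dist continuous_on_const continuous_on_subset[OF adapted_pathD(2)[OF adapted_path_uncontrolled w]]) auto
    then show ?thesis by (rule borel_integrable_atLeastAtMost'[of r r'])
  qed
  interpret R: finite_measure ?R
    by (rule finite_measureI) (use r in \<open>simp add: emeasure_restrict_space space_restrict_space\<close>)
  interpret RM: pair_sigma_finite ?R M ..
  interpret P: finite_measure "?R \<Otimes>\<^sub>M M" by (rule finite_measure_pair_measure) unfold_locales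
  have T: "T \<in> {t0..T}" using t0 by auto
  have "(\<lambda>z. (fst z, snd z)) \<in> ?R \<Otimes>\<^sub>M M \<rightarrow>\<^sub>M restrict_space borel {t0..T} \<Otimes>\<^sub>M F T"
  proof (rule measurable_Pair)
    have "(\<lambda>s. s) \<in> ?R \<rightarrow>\<^sub>M restrict_space borel {t0..T}"
      using r by (intro measurable_restrict_space2) (auto simp: space_restrict_space measurable_restrict_space1)
    then show "(\<lambda>z. fst z) \<in> ?R \<Otimes>\<^sub>M M \<rightarrow>\<^sub>M restrict_space borel {t0..T}"
      by (rule measurable_compose[OF measurable_fst])
    show "(\<lambda>z. snd z) \<in> ?R \<Otimes>\<^sub>M M \<rightarrow>\<^sub>M F T"
      using t0 by (intro measurable_compose[OF measurable_snd] measurable_F_M[of T]) auto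
  qed
  from measurable_compose[OF this adapted_path_progressive[OF adapted_path_uncontrolled T]]
  have 1: "(\<lambda>z. uncontrolled (fst z) (snd z)) \<in> ?R \<Otimes>\<^sub>M M \<rightarrow>\<^sub>M borel" by simp
  have 2: "(\<lambda>z. uncontrolled r (snd z)) \<in> ?R \<Otimes>\<^sub>M M \<rightarrow>\<^sub>M borel"
    using r by (intro measurable_compose[OF measurable_snd] adapted_path_M[OF adapted_path_uncontrolled]) auto
  have int: "integrable (?R \<Otimes>\<^sub>M M) (\<lambda>(s, w). ?d s w)"
    unfolding case_prod_unfold
    by (rule P.integrable_const_bound[where B="CARD('n)"])
      (auto intro!: AE_I2 borel_measurable_dist 1 2 simp: dist_torus_le_card)
  have eq: "(LINT s:{r..r'}|lborel. ?d s w) = (\<integral>s. ?d s w \<partial>?R)" for w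
    by (simp add: set_lebesgue_integral_def integral_restrict_space)
  show "integrable M (\<lambda>w. LINT s:{r..r'}|lborel. ?d s w)"
    unfolding eq by (rule RM.integrable_snd[OF int])
  have "(\<integral>w. (\<integral>s. ?d s w \<partial>?R) \<partial>M) = (\<integral>s. (\<integral>w. ?d s w \<partial>M) \<partial>?R)"
    by (rule RM.Fubini_integral[OF int])
  also have "\<dots> \<le> (\<integral>s. \<rho> \<partial>?R)"
    by (rule integral_mono[OF RM.integrable_fst[OF int]]) (auto simp: space_restrict_space intro: \<rho>)
  also have "\<dots> = \<rho> * (r' - r)"
    using r by (simp add: measure_restrict_space space_restrict_space)
  finally show "(\<integral>w. (LINT s:{r..r'}|lborel. ?d s w) \<partial>M) \<le> \<rho> * (r' - r)"
    unfolding eq .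
qed

end

context isaacs_game
begin

text \<open>
  The common noise and the common initial state cancel: \<open>shift\<close> is a lift of the difference of the two states
  from the torus to \<open>real ^ 'n\<close>, and it is Lipschitz in time.
\<close>

definition shift ::
  "(real \<Rightarrow> 'w \<Rightarrow> 'a) \<Rightarrow> (real \<Rightarrow> 'w \<Rightarrow> 'b) \<Rightarrow> (real \<Rightarrow> 'w \<Rightarrow> 'a) \<Rightarrow> (real \<Rightarrow> 'w \<Rightarrow> 'b) \<Rightarrow> real \<Rightarrow> 'w \<Rightarrow> real ^ 'n" where
  "shift \<alpha>1 \<alpha>2 \<beta>1 \<beta>2 t w = running b (state \<alpha>1 \<alpha>2) \<alpha>1 \<alpha>2 t w - running b (state \<beta>1 \<beta>2) \<beta>1 \<beta>2 t w"

definition cost_gap ::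
  "(real \<Rightarrow> 'w \<Rightarrow> 'a) \<Rightarrow> (real \<Rightarrow> 'w \<Rightarrow> 'b) \<Rightarrow> (real \<Rightarrow> 'w \<Rightarrow> 'a) \<Rightarrow> (real \<Rightarrow> 'w \<Rightarrow> 'b) \<Rightarrow> real \<Rightarrow> real" where
  "cost_gap \<alpha>1 \<alpha>2 \<beta>1 \<beta>2 t = (\<integral>w. running L (state \<alpha>1 \<alpha>2) \<alpha>1 \<alpha>2 t w \<partial>M) - (\<integral>w. running L (state \<beta>1 \<beta>2) \<beta>1 \<beta>2 t w \<partial>M)"

text \<open>
  On the time interval from \<open>r\<close> to \<open>r'\<close> player 2 in the first play and player 1 in the second play use the two
  parts of a saddle. Its momentum pulls the states together; its weight pulls the cost of the first play down
  to that of the second, and is \<open>0\<close> as long as the first play is the cheaper one.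
\<close>

definition aimed ::
  "real \<Rightarrow> real \<Rightarrow> real \<Rightarrow> (real \<Rightarrow> 'w \<Rightarrow> 'a) \<Rightarrow> (real \<Rightarrow> 'w \<Rightarrow> 'b) \<Rightarrow> (real \<Rightarrow> 'w \<Rightarrow> 'a) \<Rightarrow> (real \<Rightarrow> 'w \<Rightarrow> 'b) \<Rightarrow> bool" where
  "aimed \<epsilon> r r' \<alpha>1 \<alpha>2 \<beta>1 \<beta>2 \<longleftrightarrow> (AE w in M. AE s in lborel. s \<in> {r..r'} \<longrightarrow>
     saddle \<epsilon> (max 0 (cost_gap \<alpha>1 \<alpha>2 \<beta>1 \<beta>2 r)) (shift \<alpha>1 \<alpha>2 \<beta>1 \<beta>2 r w) (state \<alpha>1 \<alpha>2 r w)
       (law M (state \<alpha>1 \<alpha>2 r)) (\<beta>1 s w) (\<alpha>2 s w))"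

lemma running_M:
  fixes \<phi> :: "'n torus \<Rightarrow> 'a \<Rightarrow> 'b \<Rightarrow> 'n torus_prob \<Rightarrow> 'v::{banach, second_countable_topology}"
  assumes "lipschitz_data A1 A2 C' \<phi>" "\<alpha>1 \<in> ctrl A1" "\<alpha>2 \<in> ctrl A2" "t \<in> {t0..T}"
  shows "running \<phi> (state \<alpha>1 \<alpha>2) \<alpha>1 \<alpha>2 t \<in> M \<rightarrow>\<^sub>M borel"
  using t0 assms by (intro measurable_F_M[OF _ running_measurable[OF _ adapted_path_state]]) auto

lemma law_state_cong:
  assumes "\<alpha>1 \<in> ctrl A1" "\<alpha>2 \<in> ctrl A2"
    and "\<alpha>1' \<in> ctrl A1" "\<alpha>2' \<in> ctrl A2"
    and "agree_until M t0 t \<alpha>1 \<alpha>1'" "agree_until M t0 t \<alpha>2 \<alpha>2'" and t: "t \<in> {t0..T}" and r: "r \<in> {t0..t}"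
  shows "law M (state \<alpha>1 \<alpha>2 r) = law M (state \<alpha>1' \<alpha>2' r)"
proof (rule law_cong_AE[OF prob_space_axioms])
  show "AE w in M. state \<alpha>1 \<alpha>2 r w = state \<alpha>1' \<alpha>2' r w"
    using state_unique[OF assms(1-7)] by eventually_elim (use r in auto)
qed (use r t assms in \<open>auto intro!: adapted_path_M adapted_path_state\<close>)

lemma expected_running_cong:
  assumes "\<alpha>1 \<in> ctrl A1" "\<alpha>2 \<in> ctrl A2"
    and "\<alpha>1' \<in> ctrl A1" "\<alpha>2' \<in> ctrl A2"
    and "agree_until M t0 t \<alpha>1 \<alpha>1'" "agree_until M t0 t \<alpha>2 \<alpha>2'" and t: "t \<in> {t0..T}" and r: "r \<in> {t0..t}"
  shows "(\<integral>w. running L (state \<alpha>1 \<alpha>2) \<alpha>1 \<alpha>2 r w \<partial>M) = (\<integral>w. running L (state \<alpha>1' \<alpha>2') \<alpha>1' \<alpha>2' r w \<partial>M)"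
proof (rule integral_cong_AE)
  show "AE w in M. running L (state \<alpha>1 \<alpha>2) \<alpha>1 \<alpha>2 r w = running L (state \<alpha>1' \<alpha>2') \<alpha>1' \<alpha>2' r w"
    using running_cong[OF L assms(1-7)] by eventually_elim (use r in auto)
qed (use r t assms in \<open>auto intro!: running_M[OF L]\<close>)

lemma payoff_cong:
  assumes "\<alpha>1 \<in> ctrl A1" "\<alpha>2 \<in> ctrl A2"
    and "\<alpha>1' \<in> ctrl A1" "\<alpha>2' \<in> ctrl A2"
    and "agree_until M t0 T \<alpha>1 \<alpha>1'" "agree_until M t0 T \<alpha>2 \<alpha>2'"
  shows "payoff M F W T b L G t0 \<xi> \<alpha>1 \<alpha>2 = payoff M F W T b L G t0 \<xi> \<alpha>1' \<alpha>2'"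
proof -
  have T: "T \<in> {t0..T}" using t0 by auto
  show ?thesis
    unfolding payoff_eq[OF L assms(1,2)] payoff_eq[OF L assms(3,4)]
    using expected_running_cong[OF assms T T] law_state_cong[OF assms T T] by simp
qed

lemma aiming_data_cong:
  assumes \<alpha>: "\<alpha>1 \<in> ctrl A1" "\<alpha>2 \<in> ctrl A2"
      "\<alpha>1' \<in> ctrl A1" "\<alpha>2' \<in> ctrl A2"
    and \<beta>: "\<beta>1 \<in> ctrl A1" "\<beta>2 \<in> ctrl A2"
      "\<beta>1' \<in> ctrl A1" "\<beta>2' \<in> ctrl A2"
    and a: "agree_until M t0 t \<alpha>1 \<alpha>1'" "agree_until M t0 t \<alpha>2 \<alpha>2'"
    and b': "agree_until M t0 t \<beta>1 \<beta>1'" "agree_until M t0 t \<beta>2 \<beta>2'"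
    and t: "t \<in> {t0..T}" and r: "r \<in> {t0..t}"
  shows "cost_gap \<alpha>1 \<alpha>2 \<beta>1 \<beta>2 r = cost_gap \<alpha>1' \<alpha>2' \<beta>1' \<beta>2' r"
    and "law M (state \<alpha>1 \<alpha>2 r) = law M (state \<alpha>1' \<alpha>2' r)"
    and "AE w in M. shift \<alpha>1 \<alpha>2 \<beta>1 \<beta>2 r w = shift \<alpha>1' \<alpha>2' \<beta>1' \<beta>2' r w \<and> state \<alpha>1 \<alpha>2 r w = state \<alpha>1' \<alpha>2' r w"
proof -
  show "cost_gap \<alpha>1 \<alpha>2 \<beta>1 \<beta>2 r = cost_gap \<alpha>1' \<alpha>2' \<beta>1' \<beta>2' r"
    unfolding cost_gap_def expected_running_cong[OF \<alpha> a t r] expected_running_cong[OF \<beta> b' t r] ..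
  show "law M (state \<alpha>1 \<alpha>2 r) = law M (state \<alpha>1' \<alpha>2' r)" by (rule law_state_cong[OF \<alpha> a t r])
  show "AE w in M. shift \<alpha>1 \<alpha>2 \<beta>1 \<beta>2 r w = shift \<alpha>1' \<alpha>2' \<beta>1' \<beta>2' r w \<and> state \<alpha>1 \<alpha>2 r w = state \<alpha>1' \<alpha>2' r w"
    using running_cong[OF b \<alpha> a t] running_cong[OF b \<beta> b' t] state_unique[OF \<alpha> a t]
    by eventually_elim (use r in \<open>auto simp: shift_def\<close>)
qed

text \<open>
  The controls are extended cell by cell. The new values are chosen from the data at the beginning of the
  cell, and by uniqueness the extension leaves the data at all earlier grid points as they were. The
  responses may look ahead within the cell, which is harmless since \<open>saddle\<close> allows for arbitrary controls of
  the opponents.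
\<close>

lemma aimed_controls_exist:
  assumes f: "f \<in> grid_responses N A2 A1" and g: "g \<in> grid_responses N A1 A2"
    and N: "N > 0" and \<epsilon>: "\<epsilon> > 0" and "k \<le> N"
  shows "\<exists>\<alpha>2\<in>ctrl A2. \<exists>\<beta>1\<in>ctrl A1.
    \<forall>j<k. aimed \<epsilon> (grid N j) (grid N (Suc j)) (f \<alpha>2) \<alpha>2 \<beta>1 (g \<beta>1)"
  using \<open>k \<le> N\<close>
proof (induction k)
  case 0
  obtain a1 a2 where "a1 \<in> A1" "a2 \<in> A2" using A1 A2 by blast
  then show ?case using const_controls[of a1 A1] const_controls[of a2 A2] by blast
next
  case (Suc k)
  then obtain \<alpha>2 \<beta>1 where c: "\<alpha>2 \<in> ctrl A2" "\<beta>1 \<in> ctrl A1"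
    and IH: "\<And>j. j < k \<Longrightarrow> aimed \<epsilon> (grid N j) (grid N (Suc j)) (f \<alpha>2) \<alpha>2 \<beta>1 (g \<beta>1)"
    by auto
  have k: "k \<le> N" using Suc by simp
  define r where "r = grid N k"
  have r: "r \<in> {t0..T}" unfolding r_def by (rule grid_mem[OF N k])
  have fc: "f \<alpha>2 \<in> ctrl A1" and gc: "g \<beta>1 \<in> ctrl A2"
    using f g c by (auto simp: grid_responses_def)
  define \<kappa> where "\<kappa> = max 0 (cost_gap (f \<alpha>2) \<alpha>2 \<beta>1 (g \<beta>1) r)"
  define X where "X = state (f \<alpha>2) \<alpha>2 r"
  define D where "D = shift (f \<alpha>2) \<alpha>2 \<beta>1 (g \<beta>1) r"
  obtain i :: "'n torus \<times> (real ^ 'n) \<Rightarrow> nat" and v u where i: "i \<in> borel \<rightarrow>\<^sub>M count_space UNIV"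
    and vu: "\<And>x p. saddle \<epsilon> \<kappa> p x (law M X) (v (i (x, p))) (u (i (x, p)))"
    using saddle_selection[of \<kappa> \<epsilon> "law M X"] \<epsilon> by (auto simp: \<kappa>_def)
  define n where "n w = i (X w, D w)" for w
  have [measurable]: "X \<in> F r \<rightarrow>\<^sub>M borel"
    unfolding X_def by (rule adapted_pathD(1)[OF adapted_path_state[OF fc c(1)] r])
  have [measurable]: "D \<in> F r \<rightarrow>\<^sub>M borel"
    unfolding D_def shift_def[abs_def]
    by (intro borel_measurable_diff running_measurable[OF b adapted_path_state] fc gc c r)
  have n: "n \<in> F r \<rightarrow>\<^sub>M count_space UNIV"
    unfolding n_def using measurable_compose[OF _ i, of "\<lambda>w. (X w, D w)"] by measurable
  have vu_mem: "v (n w) \<in> A1" "u (n w) \<in> A2" for w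
    using vu[of "D w" "X w"] by (auto simp: saddle_def n_def)
  have um: "(\<lambda>w. u (n w)) \<in> F r \<rightarrow>\<^sub>M restrict_space borel A2"
    using vu_mem(2) measurable_compose[OF n, of u borel] by (intro measurable_restrict_space2) simp_all
  have vm: "(\<lambda>w. v (n w)) \<in> F r \<rightarrow>\<^sub>M restrict_space borel A1"
    using vu_mem(1) measurable_compose[OF n, of v borel] by (intro measurable_restrict_space2) simp_all
  define \<alpha>2' where "\<alpha>2' = switch r \<alpha>2 (\<lambda>_ w. u (n w))"
  define \<beta>1' where "\<beta>1' = switch r \<beta>1 (\<lambda>_ w. v (n w))"
  have c': "\<alpha>2' \<in> ctrl A2" "\<beta>1' \<in> ctrl A1"
    unfolding \<alpha>2'_def \<beta>1'_def by (intro switch_controls_const c r um vm)+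
  have fc': "f \<alpha>2' \<in> ctrl A1" and gc': "g \<beta>1' \<in> ctrl A2"
    using f g c' by (auto simp: grid_responses_def)
  have ag: "agree_until M t0 r \<alpha>2' \<alpha>2" "agree_until M t0 r \<beta>1' \<beta>1"
    unfolding \<alpha>2'_def \<beta>1'_def by (rule agree_until_switch)+
  have agf: "agree_until M t0 r (f \<alpha>2') (f \<alpha>2)" "agree_until M t0 r (g \<beta>1') (g \<beta>1)"
    using f g c c' k ag unfolding grid_responses_def r_def by blast+
  note cong = aiming_data_cong[OF fc' c'(1) fc c(1) c'(2) gc' c(2) gc agf(1) ag(1) ag(2) agf(2) r]
  have "aimed \<epsilon> (grid N j) (grid N (Suc j)) (f \<alpha>2') \<alpha>2' \<beta>1' (g \<beta>1')" if "j < Suc k" for j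
  proof (cases "j = k")
    case True
    have rr: "r \<in> {t0..r}" using r by auto
    have "AE w in M. AE s in lborel. s \<in> {r..grid N (Suc j)} \<longrightarrow>
       saddle \<epsilon> (max 0 (cost_gap (f \<alpha>2') \<alpha>2' \<beta>1' (g \<beta>1') r)) (shift (f \<alpha>2') \<alpha>2' \<beta>1' (g \<beta>1') r w) (state (f \<alpha>2') \<alpha>2' r w)
         (law M (state (f \<alpha>2') \<alpha>2' r)) (\<beta>1' s w) (\<alpha>2' s w)"
      using cong(3)[OF rr]
    proof eventually_elim
      case (elim w)
      show ?case
      proof (rule AE_I2, rule impI)
        fix s assume "s \<in> {r..grid N (Suc j)}"
        then have ctrl: "\<alpha>2' s w = u (n w)" "\<beta>1' s w = v (n w)"
          by (simp_all add: \<alpha>2'_def \<beta>1'_def switch_def)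
        show "saddle \<epsilon> (max 0 (cost_gap (f \<alpha>2') \<alpha>2' \<beta>1' (g \<beta>1') r)) (shift (f \<alpha>2') \<alpha>2' \<beta>1' (g \<beta>1') r w) (state (f \<alpha>2') \<alpha>2' r w)
         (law M (state (f \<alpha>2') \<alpha>2' r)) (\<beta>1' s w) (\<alpha>2' s w)"
          using elim vu[of "D w" "X w"]
          by (simp add: cong(1,2)[OF rr] ctrl n_def X_def D_def \<kappa>_def)
      qed
    qed
    then show ?thesis unfolding aimed_def True r_def .
  next
    case False
    then have j: "j < k" using that by simp
    have jr: "grid N (Suc j) \<le> r" unfolding r_def using j by (intro grid_mono) simp
    have rj: "grid N j \<in> {t0..r}" using grid_mono[of 0 j N] grid_mono[of j k N] j by (simp add: r_def)
    from cong(3)[OF rj] IH[OF j, unfolded aimed_def] ag[unfolded agree_until_def] show ?thesis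
      unfolding aimed_def cong(1,2)[OF rj]
    proof eventually_elim
      case (elim w)
      from elim(2-4) show ?case
      proof eventually_elim
        case e: (elim s)
        show ?case
        proof
          assume s: "s \<in> {grid N j..grid N (Suc j)}"
          then have "\<alpha>2' s w = \<alpha>2 s w" "\<beta>1' s w = \<beta>1 s w" using e(2,3) jr rj by auto
          then show "saddle \<epsilon> (max 0 (cost_gap (f \<alpha>2) \<alpha>2 \<beta>1 (g \<beta>1) (grid N j)))
             (shift (f \<alpha>2') \<alpha>2' \<beta>1' (g \<beta>1') (grid N j) w) (state (f \<alpha>2') \<alpha>2' (grid N j) w)
             (law M (state (f \<alpha>2) \<alpha>2 (grid N j))) (\<beta>1' s w) (\<alpha>2' s w)"
            using e(1) s elim(1) by simp
        qed
      qed
    qed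
  qed
  then show ?case using c' by blast
qed

end

section \<open>The energy of coupled plays\<close>

lemma set_integral_inner_right:
  fixes f :: "'z \<Rightarrow> 'v::{real_inner, banach, second_countable_topology}"
  assumes "set_integrable N S f"
  shows "set_integrable N S (\<lambda>x. c \<bullet> f x)" "(LINT x:S|N. c \<bullet> f x) = c \<bullet> (LINT x:S|N. f x)"
proof -
  have i: "integrable N (\<lambda>x. indicator S x *\<^sub>R f x)" using assms by (simp add: set_integrable_def)
  have eq: "indicator S x *\<^sub>R (c \<bullet> f x) = c \<bullet> (indicator S x *\<^sub>R f x)" for x by simp
  show "set_integrable N S (\<lambda>x. c \<bullet> f x)"
    unfolding set_integrable_def eq using i by (intro integrable_inner_right)
  show "(LINT x:S|N. c \<bullet> f x) = c \<bullet> (LINT x:S|N. f x)"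
    unfolding set_lebesgue_integral_def eq using i by (intro integral_inner_right)
qed

context isaacs_game
begin

lemma running_rate:
  assumes \<alpha>: "\<alpha>1 \<in> ctrl A1" "\<alpha>2 \<in> ctrl A2" and w: "w \<in> space M"
    and r: "t0 \<le> r" "r \<le> r'" "r' \<le> T"
  defines "X \<equiv> state \<alpha>1 \<alpha>2"
  shows "set_integrable lborel {r..r'} (\<lambda>s. rate \<kappa> p (X s w) (\<alpha>1 s w) (\<alpha>2 s w) (law M (X s)))"
    and "(LINT s:{r..r'}|lborel. rate \<kappa> p (X s w) (\<alpha>1 s w) (\<alpha>2 s w) (law M (X s))) =
      \<kappa> * (running L X \<alpha>1 \<alpha>2 r' w - running L X \<alpha>1 \<alpha>2 r w) + p \<bullet> (running b X \<alpha>1 \<alpha>2 r' w - running b X \<alpha>1 \<alpha>2 r w)"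
proof -
  have X: "adapted_path X" unfolding X_def by (rule adapted_path_state[OF \<alpha>])
  have S: "{r..r'} \<in> sets borel" "{r..r'} \<subseteq> {t0..T}" using r by auto
  note i = running_set_integrable[OF L X \<alpha> w S] running_set_integrable[OF b X \<alpha> w S]
  have i': "set_integrable lborel {r..r'} (\<lambda>s. \<kappa> * L (X s w) (\<alpha>1 s w) (\<alpha>2 s w) (law M (X s)))"
    "set_integrable lborel {r..r'} (\<lambda>s. p \<bullet> b (X s w) (\<alpha>1 s w) (\<alpha>2 s w) (law M (X s)))"
    by (intro set_integrable_mult_right set_integral_inner_right i)+
  show "set_integrable lborel {r..r'} (\<lambda>s. rate \<kappa> p (X s w) (\<alpha>1 s w) (\<alpha>2 s w) (law M (X s)))"
    unfolding rate_def by (rule set_integral_add(1)[OF i'])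
  show "(LINT s:{r..r'}|lborel. rate \<kappa> p (X s w) (\<alpha>1 s w) (\<alpha>2 s w) (law M (X s))) =
      \<kappa> * (running L X \<alpha>1 \<alpha>2 r' w - running L X \<alpha>1 \<alpha>2 r w) + p \<bullet> (running b X \<alpha>1 \<alpha>2 r' w - running b X \<alpha>1 \<alpha>2 r w)"
    unfolding running_diff[OF L X \<alpha> w r] running_diff[OF b X \<alpha> w r] rate_def set_integral_add(2)[OF i']
      set_integral_mult_right set_integral_inner_right(2)[OF i(2)] ..
qed

lemma state_increment:
  assumes \<alpha>: "\<alpha>1 \<in> ctrl A1" "\<alpha>2 \<in> ctrl A2" and w: "w \<in> space M"
    and r: "t0 \<le> r" "r \<le> s" "s \<le> T"
  shows "dist (state \<alpha>1 \<alpha>2 s w) (state \<alpha>1 \<alpha>2 r w) \<le> dist (uncontrolled s w) (uncontrolled r w) + B * (s - r)"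
proof -
  have m: "s \<in> {t0..T}" "r \<in> {t0..T}" using r by auto
  let ?R = "running b (state \<alpha>1 \<alpha>2) \<alpha>1 \<alpha>2"
  have "dist (state \<alpha>1 \<alpha>2 s w) (state \<alpha>1 \<alpha>2 r w) \<le>
     dist (uncontrolled s w) (uncontrolled r w) + dist (to_torus (?R s w)) (to_torus (?R r w))"
    unfolding state_eq[OF \<alpha> w m(1)] state_eq[OF \<alpha> w m(2)] by (rule dist_torus_add_le)
  also have "dist (to_torus (?R s w)) (to_torus (?R r w)) \<le> norm (?R s w - ?R r w)" by (rule dist_to_torus_le)
  also have "\<dots> \<le> B * (s - r)" by (rule running_diff_bound[OF b adapted_path_state[OF \<alpha>] \<alpha> w r b_bound])
  finally show ?thesis by simp
qed

lemma law_increment: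
  assumes \<alpha>: "\<alpha>1 \<in> ctrl A1" "\<alpha>2 \<in> ctrl A2" and r: "t0 \<le> r" "r \<le> s" "s \<le> T"
    and \<rho>: "fluctuation s r \<le> \<rho>"
  shows "dist (law M (state \<alpha>1 \<alpha>2 s)) (law M (state \<alpha>1 \<alpha>2 r)) \<le> \<rho> + B * (s - r)"
proof -
  have m: "s \<in> {t0..T}" "r \<in> {t0..T}" using r by auto
  note X = adapted_path_M[OF adapted_path_state[OF \<alpha>] m(1)] adapted_path_M[OF adapted_path_state[OF \<alpha>] m(2)]
  have iu: "integrable M (\<lambda>w. dist (uncontrolled s w) (uncontrolled r w))"
    by (intro bounded_torus_dist_integrable prob_space_axioms adapted_path_M[OF adapted_path_uncontrolled] m)
  have "dist (law M (state \<alpha>1 \<alpha>2 s)) (law M (state \<alpha>1 \<alpha>2 r)) \<le> (\<integral>w. dist (state \<alpha>1 \<alpha>2 s w) (state \<alpha>1 \<alpha>2 r w) \<partial>M)"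
    by (rule dist_law_le[OF prob_space_axioms X])
  also have "\<dots> \<le> (\<integral>w. dist (uncontrolled s w) (uncontrolled r w) + B * (s - r) \<partial>M)"
    using iu by (intro integral_mono bounded_torus_dist_integrable[OF prob_space_axioms X] state_increment[OF \<alpha> _ r]) auto
  also have "\<dots> \<le> \<rho> + B * (s - r)" using iu \<rho> by (simp add: prob_space)
  finally show ?thesis .
qed

context
  fixes \<alpha>1 \<alpha>2 \<beta>1 \<beta>2
  assumes \<alpha>: "\<alpha>1 \<in> ctrl A1" "\<alpha>2 \<in> ctrl A2"
    and \<beta>: "\<beta>1 \<in> ctrl A1" "\<beta>2 \<in> ctrl A2"
begin

abbreviation (input) "D \<equiv> shift \<alpha>1 \<alpha>2 \<beta>1 \<beta>2"
abbreviation (input) "Z \<equiv> cost_gap \<alpha>1 \<alpha>2 \<beta>1 \<beta>2"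
abbreviation (input) "X \<equiv> state \<alpha>1 \<alpha>2"
abbreviation (input) "Y \<equiv> state \<beta>1 \<beta>2"

lemma shift_M: "t \<in> {t0..T} \<Longrightarrow> D t \<in> borel_measurable M"
  unfolding shift_def[abs_def] by (intro borel_measurable_diff running_M[OF b] \<alpha> \<beta>)

lemma shift_increment:
  assumes "w \<in> space M" "t0 \<le> r" "r \<le> r'" "r' \<le> T"
  shows "norm (D r' w - D r w) \<le> 2 * B * (r' - r)"
proof -
  let ?u = "running b X \<alpha>1 \<alpha>2 r' w - running b X \<alpha>1 \<alpha>2 r w"
  let ?v = "running b Y \<beta>1 \<beta>2 r' w - running b Y \<beta>1 \<beta>2 r w"
  have "D r' w - D r w = ?u - ?v" by (simp add: shift_def)
  then have "norm (D r' w - D r w) \<le> norm ?u + norm ?v" by (simp add: norm_triangle_ineq4)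
  also have "\<dots> \<le> B * (r' - r) + B * (r' - r)"
    using running_diff_bound[OF b adapted_path_state[OF \<alpha>] \<alpha> assms b_bound]
      running_diff_bound[OF b adapted_path_state[OF \<beta>] \<beta> assms b_bound] by (rule add_mono)
  finally show ?thesis by simp
qed

lemma shift_start: "D t0 w = 0"
  by (simp add: shift_def running_t0)

lemma shift_bound:
  assumes "w \<in> space M" "t \<in> {t0..T}"
  shows "norm (D t w) \<le> 2 * B * (T - t0)"
proof -
  have "norm (D t w) \<le> 2 * B * (t - t0)" using shift_increment[OF assms(1), of t0 t] assms(2) by (simp add: shift_start)
  also have "\<dots> \<le> 2 * B * (T - t0)" using assms B_pos by (intro mult_left_mono) auto
  finally show ?thesis .
qed

lemma running_L_integrable:
  assumes c: "\<gamma>1 \<in> ctrl A1" "\<gamma>2 \<in> ctrl A2" and t: "t \<in> {t0..T}"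
  shows "integrable M (running L (state \<gamma>1 \<gamma>2) \<gamma>1 \<gamma>2 t)"
proof (rule integrable_const_bound[where B="B * (t - t0)"])
  show "AE w in M. norm (running L (state \<gamma>1 \<gamma>2) \<gamma>1 \<gamma>2 t w) \<le> B * (t - t0)"
    using running_diff_bound[OF L adapted_path_state[OF c] c _ _ _ _ L_bound, of _ t0 t] t
    by (intro AE_I2) (auto simp: running_t0)
qed (rule running_M[OF L c t])

lemma cost_gap_increment_eq:
  assumes "r \<in> {t0..T}" "r' \<in> {t0..T}"
  shows "Z r' - Z r = (\<integral>w. (running L X \<alpha>1 \<alpha>2 r' w - running L X \<alpha>1 \<alpha>2 r w)
    - (running L Y \<beta>1 \<beta>2 r' w - running L Y \<beta>1 \<beta>2 r w) \<partial>M)"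
  using running_L_integrable[OF \<alpha> assms(1)] running_L_integrable[OF \<alpha> assms(2)]
    running_L_integrable[OF \<beta> assms(1)] running_L_integrable[OF \<beta> assms(2)]
  by (simp add: cost_gap_def)

lemma cost_gap_increment:
  assumes "t0 \<le> r" "r \<le> r'" "r' \<le> T"
  shows "\<bar>Z r' - Z r\<bar> \<le> 2 * B * (r' - r)"
proof -
  let ?u = "\<lambda>w. running L X \<alpha>1 \<alpha>2 r' w - running L X \<alpha>1 \<alpha>2 r w"
  let ?v = "\<lambda>w. running L Y \<beta>1 \<beta>2 r' w - running L Y \<beta>1 \<beta>2 r w"
  have m: "r \<in> {t0..T}" "r' \<in> {t0..T}" using assms by auto
  have "norm (\<integral>w. ?u w - ?v w \<partial>M) \<le> (\<integral>w. 2 * B * (r' - r) \<partial>M)"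
  proof (rule order_trans[OF integral_norm_bound], rule integral_mono)
    show "integrable M (\<lambda>w. norm (?u w - ?v w))"
      by (intro integrable_norm Bochner_Integration.integrable_diff running_L_integrable \<alpha> \<beta> m)
    show "norm (?u w - ?v w) \<le> 2 * B * (r' - r)" if "w \<in> space M" for w
      using running_diff_bound[OF L adapted_path_state[OF \<alpha>] \<alpha> that assms L_bound]
        running_diff_bound[OF L adapted_path_state[OF \<beta>] \<beta> that assms L_bound]
        norm_triangle_ineq4[of "?u w" "?v w"] by linarith
  qed simp
  then show ?thesis unfolding cost_gap_increment_eq[OF m] by (simp add: prob_space)
qed

lemma cost_gap_start: "Z t0 = 0"
  by (simp add: cost_gap_def running_t0)

lemma cost_gap_bound:
  assumes "t \<in> {t0..T}"
  shows "\<bar>Z t\<bar> \<le> 2 * B * (T - t0)"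
proof -
  have "\<bar>Z t\<bar> \<le> 2 * B * (t - t0)" using cost_gap_increment[of t0 t] assms by (simp add: cost_gap_start)
  also have "\<dots> \<le> 2 * B * (T - t0)" using assms B_pos by (intro mult_left_mono) auto
  finally show ?thesis .
qed

lemma dist_states_le_shift:
  assumes "w \<in> space M" "t \<in> {t0..T}"
  shows "dist (X t w) (Y t w) \<le> norm (D t w)"
  unfolding state_eq[OF \<alpha> assms] state_eq[OF \<beta> assms] dist_torus_add_left shift_def by (rule dist_to_torus_le)

lemma norm_shift_integrable:
  assumes "t \<in> {t0..T}"
  shows "integrable M (\<lambda>w. norm (D t w))" "integrable M (\<lambda>w. (norm (D t w))\<^sup>2)"
proof -
  note [measurable] = shift_M[OF assms]
  show "integrable M (\<lambda>w. norm (D t w))"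
    by (rule integrable_const_bound[where B="2 * B * (T - t0)"]) (auto intro!: AE_I2 shift_bound assms)
  show "integrable M (\<lambda>w. (norm (D t w))\<^sup>2)"
    by (rule integrable_const_bound[where B="(2 * B * (T - t0))\<^sup>2"]) (auto intro!: AE_I2 power_mono shift_bound assms)
qed

lemma dist_laws_le_shift:
  assumes "t \<in> {t0..T}"
  shows "dist (law M (X t)) (law M (Y t)) \<le> (\<integral>w. norm (D t w) \<partial>M)"
proof -
  note m = adapted_path_M[OF adapted_path_state[OF \<alpha>] assms] adapted_path_M[OF adapted_path_state[OF \<beta>] assms]
  have "dist (law M (X t)) (law M (Y t)) \<le> (\<integral>w. dist (X t w) (Y t w) \<partial>M)"
    by (rule dist_law_le[OF prob_space_axioms m])
  also have "\<dots> \<le> (\<integral>w. norm (D t w) \<partial>M)"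
    by (intro integral_mono bounded_torus_dist_integrable[OF prob_space_axioms m] norm_shift_integrable dist_states_le_shift assms)
  finally show ?thesis .
qed

text \<open>
  The variance of the norm is nonnegative.
\<close>

lemma expectation_norm_square:
  assumes "t \<in> {t0..T}"
  shows "(\<integral>w. norm (D t w) \<partial>M)\<^sup>2 \<le> (\<integral>w. (norm (D t w))\<^sup>2 \<partial>M)"
proof -
  let ?e = "\<integral>w. norm (D t w) \<partial>M"
  note i = norm_shift_integrable[OF assms]
  have "0 \<le> (\<integral>w. (norm (D t w) - ?e)\<^sup>2 \<partial>M)" by simp
  also have "\<dots> = (\<integral>w. (norm (D t w))\<^sup>2 - 2 * ?e * norm (D t w) + ?e\<^sup>2 \<partial>M)"
    by (intro Bochner_Integration.integral_cong refl) (simp add: power2_diff)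
  also have "\<dots> = (\<integral>w. (norm (D t w))\<^sup>2 \<partial>M) - 2 * ?e * ?e + ?e\<^sup>2"
    using i by (simp add: prob_space)
  finally show ?thesis by (simp add: power2_eq_square)
qed

text \<open>
  The square of the positive part: only an excess of the first cost over the second has to be prevented.
\<close>

definition "energy t = (\<integral>w. (norm (D t w))\<^sup>2 \<partial>M) + (max 0 (Z t))\<^sup>2"

text \<open>
  Three replacements connect the two rates. Freezing the first play at time \<open>r\<close> costs its oscillation since
  \<open>r\<close>; the saddle exchanges the controls; passing from the frozen first play to the second one costs the
  distance of the two plays at time \<open>r\<close> and the oscillation of the second. The factor \<open>\<kappa> + norm p\<close> is kept
  exact in front of the distance, where it leads to the energy, and is estimated by \<open>2 * R\<close> elsewhere.
\<close>

lemma rate_gap_pointwise: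
  assumes w: "w \<in> space M" and s: "t0 \<le> r" "r \<le> s" "s \<le> T"
    and \<kappa>: "\<kappa> = max 0 (Z r)" and p: "p = D r w" and e: "e = (\<integral>w. norm (D r w) \<partial>M)"
    and R: "R = 2 * B * (T - t0)"
    and \<rho>: "fluctuation s r \<le> \<rho>"
    and saddle: "saddle \<epsilon> \<kappa> p (X r w) (law M (X r)) (\<beta>1 s w) (\<alpha>2 s w)"
  shows "rate \<kappa> p (X s w) (\<alpha>1 s w) (\<alpha>2 s w) (law M (X s)) - rate \<kappa> p (Y s w) (\<beta>1 s w) (\<beta>2 s w) (law M (Y s))
    \<le> \<epsilon> + 4 * C * R * (\<rho> + 2 * B * (s - r)) + C * (\<kappa> + norm p) * (norm p + e)
      + 4 * C * R * dist (uncontrolled s w) (uncontrolled r w)"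
proof -
  have m: "r \<in> {t0..T}" "s \<in> {t0..T}" using s by auto
  have \<kappa>0: "\<kappa> \<ge> 0" by (simp add: \<kappa>)
  let ?d = "dist (uncontrolled s w) (uncontrolled r w)"
  define l where "l = B * (s - r)"
  have h: "l \<ge> 0" using B_pos s by (simp add: l_def)
  have a: "\<alpha>1 s w \<in> A1" "\<alpha>2 s w \<in> A2" "\<beta>1 s w \<in> A1" "\<beta>2 s w \<in> A2"
    by (intro controlsD(2)[OF _ m(2) w] \<alpha> \<beta>)+
  have 1: "rate \<kappa> p (X s w) (\<alpha>1 s w) (\<alpha>2 s w) (law M (X s))
    \<le> rate \<kappa> p (X r w) (\<alpha>1 s w) (\<alpha>2 s w) (law M (X r)) + C * (\<kappa> + norm p) * (dist (X s w) (X r w) + dist (law M (X s)) (law M (X r)))"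
    using rate_lipschitz[OF \<kappa>0 a(1,2), of p "X s w" "law M (X s)" "X r w" "law M (X r)"] by linarith
  have 2: "rate \<kappa> p (X r w) (\<alpha>1 s w) (\<alpha>2 s w) (law M (X r)) \<le> rate \<kappa> p (X r w) (\<beta>1 s w) (\<beta>2 s w) (law M (X r)) + \<epsilon>"
    using saddle a by (auto simp: saddle_def)
  have 3: "rate \<kappa> p (X r w) (\<beta>1 s w) (\<beta>2 s w) (law M (X r)) \<le> rate \<kappa> p (Y s w) (\<beta>1 s w) (\<beta>2 s w) (law M (Y s))
     + C * (\<kappa> + norm p) * (dist (X r w) (Y s w) + dist (law M (X r)) (law M (Y s)))"
    using rate_lipschitz[OF \<kappa>0 a(3,4), of p "X r w" "law M (X r)" "Y s w" "law M (Y s)"] by linarith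
  let ?S = "dist (X s w) (X r w) + dist (law M (X s)) (law M (X r)) + (dist (X r w) (Y s w) + dist (law M (X r)) (law M (Y s)))"
  have "dist (X s w) (X r w) \<le> ?d + l" unfolding l_def by (rule state_increment[OF \<alpha> w s])
  moreover have "dist (law M (X s)) (law M (X r)) \<le> \<rho> + l" unfolding l_def by (rule law_increment[OF \<alpha> s \<rho>])
  moreover have "dist (X r w) (Y s w) \<le> norm p + (?d + l)"
    using dist_triangle[of "X r w" "Y s w" "Y r w"] dist_states_le_shift[OF w m(1)] state_increment[OF \<beta> w s]
    by (simp add: p l_def dist_commute)
  moreover have "dist (law M (X r)) (law M (Y s)) \<le> e + (\<rho> + l)"
    using dist_triangle[of "law M (X r)" "law M (Y s)" "law M (Y r)"] dist_laws_le_shift[OF m(1)] law_increment[OF \<beta> s \<rho>]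
    by (simp add: e l_def dist_commute)
  ultimately have S: "?S \<le> (norm p + e) + 2 * (\<rho> + 2 * l + ?d)"
    unfolding distrib_left by linarith
  have \<rho>0: "\<rho> \<ge> 0" using order_trans[OF _ \<rho>, of 0] by simp
  have "\<kappa> \<le> R" "norm p \<le> R" "R \<ge> 0"
    using cost_gap_bound[OF m(1)] shift_bound[OF w m(1)] B_pos t0 by (auto simp: \<kappa> p R)
  then have \<kappa>p: "0 \<le> \<kappa> + norm p" "\<kappa> + norm p \<le> 2 * R" using \<kappa>0 by auto
  have "C * (\<kappa> + norm p) * ?S \<le> C * (\<kappa> + norm p) * ((norm p + e) + 2 * (\<rho> + 2 * l + ?d))"
    using S \<kappa>p Cb_nonneg by (intro mult_left_mono) auto
  also have "\<dots> = C * (\<kappa> + norm p) * (norm p + e) + C * (\<kappa> + norm p) * (2 * (\<rho> + 2 * l + ?d))"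
    by (rule distrib_left)
  also have "C * (\<kappa> + norm p) * (2 * (\<rho> + 2 * l + ?d)) \<le> C * (2 * R) * (2 * (\<rho> + 2 * l + ?d))"
    using \<kappa>p Cb_nonneg \<rho>0 h by (intro mult_right_mono mult_left_mono) auto
  finally have "C * (\<kappa> + norm p) * ?S \<le> C * (\<kappa> + norm p) * (norm p + e) + 4 * C * R * (\<rho> + 2 * B * (s - r)) + 4 * C * R * ?d"
    by (simp add: l_def algebra_simps)
  then show ?thesis using 1 2 3 by (simp add: distrib_left)
qed

text \<open>
  Expanding the two squares over one cell leaves as first order term the integrated difference of the rates
  with momentum \<open>D r\<close> and weight \<open>max 0 (Z r)\<close>, to which \<open>rate_gap_pointwise\<close> applies; the second order terms
  are of size \<open>h\<^sup>2\<close> because \<open>D\<close> and \<open>Z\<close> are Lipschitz in time.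
\<close>

lemma energy_step:
  assumes aim: "aimed \<epsilon> r r' \<alpha>1 \<alpha>2 \<beta>1 \<beta>2" and r: "t0 \<le> r" "r \<le> r'" "r' \<le> T"
    and h: "h = r' - r" and R: "R = 2 * B * (T - t0)"
    and \<rho>: "\<And>s. s \<in> {r..r'} \<Longrightarrow> fluctuation s r \<le> \<rho>"
  shows "energy r' \<le> (1 + 6 * C * h) * energy r + h * (2 * \<epsilon> + 16 * C * R * \<rho> + (16 * C * R * B + 8 * B\<^sup>2) * h)"
proof -
  have m: "r \<in> {t0..T}" "r' \<in> {t0..T}" using r by auto
  define \<kappa> where "\<kappa> = max 0 (Z r)"
  define e where "e = (\<integral>w. norm (D r w) \<partial>M)"
  define q where "q = (\<integral>w. (norm (D r w))\<^sup>2 \<partial>M)"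
  define I where "I w = (LINT s:{r..r'}|lborel. dist (uncontrolled s w) (uncontrolled r w))" for w
  define dL where "dL w = (running L X \<alpha>1 \<alpha>2 r' w - running L X \<alpha>1 \<alpha>2 r w)
    - (running L Y \<beta>1 \<beta>2 r' w - running L Y \<beta>1 \<beta>2 r w)" for w
  define K where "K = \<epsilon> + 4 * C * R * (\<rho> + 2 * B * h)"
  have \<kappa>0: "\<kappa> \<ge> 0" and h0: "h \<ge> 0" using r by (auto simp: \<kappa>_def h)
  have R0: "R \<ge> 0" using B_pos t0 by (simp add: R)
  note i = norm_shift_integrable[OF m(1)] norm_shift_integrable[OF m(2)]
  have iL: "integrable M dL"
    unfolding dL_def[abs_def] by (intro Bochner_Integration.integrable_diff running_L_integrable \<alpha> \<beta> m)
  have iI: "integrable M I" and EI: "(\<integral>w. I w \<partial>M) \<le> \<rho> * h"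
    using uncontrolled_fluctuation[OF r \<rho>] by (auto simp: I_def[abs_def] h)
  have dZ: "Z r' - Z r = (\<integral>w. dL w \<partial>M)"
    unfolding dL_def by (rule cost_gap_increment_eq[OF m])
  have first: "AE w in M. \<kappa> * dL w + D r w \<bullet> (D r' w - D r w)
    \<le> h * (K + C * (\<kappa> + norm (D r w)) * (norm (D r w) + e)) + 4 * C * R * I w"
    using aim[unfolded aimed_def] AE_space
  proof eventually_elim
    case (elim w)
    let ?p = "D r w"
    let ?fX = "\<lambda>s. rate \<kappa> ?p (X s w) (\<alpha>1 s w) (\<alpha>2 s w) (law M (X s))"
    let ?fY = "\<lambda>s. rate \<kappa> ?p (Y s w) (\<beta>1 s w) (\<beta>2 s w) (law M (Y s))"
    let ?c = "K + C * (\<kappa> + norm ?p) * (norm ?p + e)"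
    let ?d = "\<lambda>s. dist (uncontrolled s w) (uncontrolled r w)"
    note iX = running_rate[OF \<alpha> elim(2) r, of \<kappa> ?p] and iY = running_rate[OF \<beta> elim(2) r, of \<kappa> ?p]
    have id: "set_integrable lborel {r..r'} (\<lambda>s. 4 * C * R * ?d s)"
      by (intro set_integrable_mult_right uncontrolled_fluctuation(1)[OF r \<rho> elim(2)])
    have ic: "set_integrable lborel {r..r'} (\<lambda>s. ?c)"
      using r by (simp add: set_integrable_def)
    have "(LINT s:{r..r'}|lborel. ?fX s - ?fY s) \<le> (LINT s:{r..r'}|lborel. ?c + 4 * C * R * ?d s)"
    proof (rule set_integral_mono_AE)
      show "set_integrable lborel {r..r'} (\<lambda>s. ?fX s - ?fY s)" by (rule set_integral_diff(1)[OF iX(1) iY(1)])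
      show "set_integrable lborel {r..r'} (\<lambda>s. ?c + 4 * C * R * ?d s)" by (rule set_integral_add(1)[OF ic id])
      show "AE s \<in> {r..r'} in lborel. ?fX s - ?fY s \<le> ?c + 4 * C * R * ?d s"
        using elim(1)
      proof eventually_elim
        case (elim s)
        show ?case
        proof
          assume s: "s \<in> {r..r'}"
          then have "t0 \<le> r" "r \<le> s" "s \<le> T" using r by auto
          from rate_gap_pointwise[OF \<open>w \<in> space M\<close> this \<kappa>_def refl e_def R \<rho>[OF s], of \<epsilon>] elim s
          have "?fX s - ?fY s \<le> \<epsilon> + 4 * C * R * (\<rho> + 2 * B * (s - r)) + C * (\<kappa> + norm ?p) * (norm ?p + e) + 4 * C * R * ?d s"
            by (simp add: \<kappa>_def)
          moreover have "4 * C * R * (\<rho> + 2 * B * (s - r)) \<le> 4 * C * R * (\<rho> + 2 * B * h)"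
            using s R0 Cb_nonneg B_pos by (intro mult_left_mono add_left_mono) (auto simp: h)
          ultimately show "?fX s - ?fY s \<le> ?c + 4 * C * R * ?d s" unfolding K_def by linarith
        qed
      qed
    qed
    moreover have "(LINT s:{r..r'}|lborel. ?fX s - ?fY s) = \<kappa> * dL w + ?p \<bullet> (D r' w - D r w)"
      unfolding set_integral_diff(2)[OF iX(1) iY(1)] iX(2) iY(2)
      by (simp add: dL_def shift_def algebra_simps inner_diff_right inner_add_right)
    moreover have "(LINT s:{r..r'}|lborel. ?c + 4 * C * R * ?d s) = h * ?c + 4 * C * R * I w"
      unfolding set_integral_add(2)[OF ic id] set_integral_mult_right I_def
      using r by (simp add: set_lebesgue_integral_def h)
    ultimately show ?case by simp
  qed
  have quad: "AE w in M. (norm (D r' w))\<^sup>2 + 2 * \<kappa> * dL w \<le> (norm (D r w))\<^sup>2 + 4 * B\<^sup>2 * h\<^sup>2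
    + 2 * (h * (K + C * (\<kappa> * e + (\<kappa> + e) * norm (D r w) + (norm (D r w))\<^sup>2)) + 4 * C * R * I w)"
    using first AE_space
  proof eventually_elim
    case (elim w)
    let ?\<Delta> = "D r' w - D r w"
    have "(norm (D r' w))\<^sup>2 = (norm (D r w + ?\<Delta>))\<^sup>2" by simp
    also have "\<dots> = (norm (D r w))\<^sup>2 + 2 * (D r w \<bullet> ?\<Delta>) + (norm ?\<Delta>)\<^sup>2"
      by (simp only: power2_norm_eq_inner inner_add_left inner_add_right) (simp add: inner_commute)
    also have "(norm ?\<Delta>)\<^sup>2 \<le> (2 * B * h)\<^sup>2"
      using shift_increment[OF elim(2) r] by (intro power_mono) (auto simp: h)
    finally have "(norm (D r' w))\<^sup>2 + 2 * \<kappa> * dL w \<le> (norm (D r w))\<^sup>2 + 4 * B\<^sup>2 * h\<^sup>2 + 2 * (\<kappa> * dL w + D r w \<bullet> ?\<Delta>)"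
      by (simp add: power_mult_distrib)
    moreover have eq: "C * (\<kappa> + norm (D r w)) * (norm (D r w) + e) = C * (\<kappa> * e + (\<kappa> + e) * norm (D r w) + (norm (D r w))\<^sup>2)"
      by (simp add: algebra_simps power2_eq_square)
    ultimately show ?case
      using elim(1)[unfolded eq] by (meson add_left_mono mult_left_mono order_trans zero_le_numeral)
  qed
  have "(\<integral>w. (norm (D r' w))\<^sup>2 + 2 * \<kappa> * dL w \<partial>M) \<le> (\<integral>w. (norm (D r w))\<^sup>2 + 4 * B\<^sup>2 * h\<^sup>2
    + 2 * (h * (K + C * (\<kappa> * e + (\<kappa> + e) * norm (D r w) + (norm (D r w))\<^sup>2)) + 4 * C * R * I w) \<partial>M)"
    using i iL iI by (intro integral_mono_AE quad) auto
  also have "\<dots> = q + 4 * B\<^sup>2 * h\<^sup>2 + 2 * (h * (K + C * (\<kappa> * e + (\<kappa> + e) * e + q)) + 4 * C * R * (\<integral>w. I w \<partial>M))"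
    using i iI by (simp add: prob_space q_def e_def)
  also have "\<dots> \<le> q + 4 * B\<^sup>2 * h\<^sup>2 + 2 * (h * (K + C * (3 * energy r)) + 4 * C * R * (\<rho> * h))"
  proof -
    have "e\<^sup>2 \<le> q" unfolding e_def q_def by (rule expectation_norm_square[OF m(1)])
    moreover have "2 * (\<kappa> * e) \<le> \<kappa>\<^sup>2 + e\<^sup>2" using sum_squares_bound[of \<kappa> e] by simp
    moreover have "energy r = q + \<kappa>\<^sup>2" by (simp add: energy_def q_def \<kappa>_def)
    moreover have "\<kappa> * e + (\<kappa> + e) * e + q = 2 * (\<kappa> * e) + e\<^sup>2 + q"
      by (simp add: algebra_simps power2_eq_square)
    ultimately have "\<kappa> * e + (\<kappa> + e) * e + q \<le> 3 * energy r"
      using zero_le_power2[of \<kappa>] by linarith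
    then show ?thesis
      using h0 Cb_nonneg R0 EI by (intro add_left_mono mult_left_mono add_mono) auto
  qed
  finally have E1: "(\<integral>w. (norm (D r' w))\<^sup>2 \<partial>M) + 2 * \<kappa> * (Z r' - Z r)
    \<le> q + 4 * B\<^sup>2 * h\<^sup>2 + 2 * (h * (K + C * (3 * energy r)) + 4 * C * R * (\<rho> * h))"
    using i iL by (simp add: dZ)
  have "max 0 (Z r') \<le> \<bar>\<kappa> + (Z r' - Z r)\<bar>" by (auto simp: \<kappa>_def)
  then have "(max 0 (Z r'))\<^sup>2 \<le> (\<kappa> + (Z r' - Z r))\<^sup>2" by (metis abs_le_square_iff abs_of_nonneg max.cobounded1)
  also have "\<dots> = \<kappa>\<^sup>2 + 2 * \<kappa> * (Z r' - Z r) + \<bar>Z r' - Z r\<bar>\<^sup>2" by (simp add: power2_sum)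
  also have "\<bar>Z r' - Z r\<bar>\<^sup>2 \<le> (2 * B * h)\<^sup>2"
    using cost_gap_increment[OF r] by (intro power_mono) (auto simp: h)
  finally have E2: "(max 0 (Z r'))\<^sup>2 \<le> \<kappa>\<^sup>2 + 2 * \<kappa> * (Z r' - Z r) + 4 * B\<^sup>2 * h\<^sup>2"
    by (simp add: power_mult_distrib)
  have "energy r' \<le> energy r + 8 * B\<^sup>2 * h\<^sup>2 + 2 * (h * (K + C * (3 * energy r)) + 4 * C * R * (\<rho> * h))"
    using E1 E2 by (simp add: energy_def q_def \<kappa>_def)
  also have "\<dots> = (1 + 6 * C * h) * energy r + h * (2 * \<epsilon> + 16 * C * R * \<rho> + (16 * C * R * B + 8 * B\<^sup>2) * h)"
    by (simp add: K_def algebra_simps power2_eq_square)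
  finally show ?thesis .
qed

end

end

section \<open>Equality of the values\<close>

context isaacs_game
begin

text \<open>
  Discrete Gronwall inequality, starting from energy \<open>0\<close> since both plays have the same initial state.
\<close>

lemma energy_T_bound:
  assumes \<alpha>: "\<alpha>1 \<in> ctrl A1" "\<alpha>2 \<in> ctrl A2"
    and \<beta>: "\<beta>1 \<in> ctrl A1" "\<beta>2 \<in> ctrl A2"
    and N: "N > 0" and aim: "\<And>j. j < N \<Longrightarrow> aimed \<epsilon> (grid N j) (grid N (Suc j)) \<alpha>1 \<alpha>2 \<beta>1 \<beta>2"
    and \<rho>: "\<And>r s. r \<in> {t0..T} \<Longrightarrow> s \<in> {t0..T} \<Longrightarrow> \<bar>s - r\<bar> \<le> h \<Longrightarrow>
      fluctuation s r \<le> \<rho>"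
    and h: "h = (T - t0) / N" and R: "R = 2 * B * (T - t0)"
    and \<eta>: "\<eta> = 2 * \<epsilon> + 16 * C * R * \<rho> + (16 * C * R * B + 8 * B\<^sup>2) * h" "\<eta> \<ge> 0"
  shows "energy \<alpha>1 \<alpha>2 \<beta>1 \<beta>2 T \<le> (T - t0) * \<eta> * exp (6 * C * (T - t0))"
proof -
  let ?E = "energy \<alpha>1 \<alpha>2 \<beta>1 \<beta>2"
  let ?c = "1 + 6 * C * h"
  have h0: "h \<ge> 0" using t0 by (simp add: h)
  have c1: "?c \<ge> 1" using h0 Cb_nonneg by simp
  have E: "?E (grid N k) \<le> k * (h * \<eta>) * ?c ^ k" if "k \<le> N" for k
    using that
  proof (induction k)
    case 0
    show ?case by (simp add: energy_def[OF \<alpha> \<beta>] shift_start[OF \<alpha> \<beta>] cost_gap_start[OF \<alpha> \<beta>])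
  next
    case (Suc k)
    have len: "h = grid N (Suc k) - grid N k" by (simp add: grid_def h distrib_right del: times_divide_eq_right)
    have m: "grid N k \<in> {t0..T}" "grid N (Suc k) \<in> {t0..T}" using Suc.prems by (auto intro!: grid_mem N simp del: atLeastAtMost_iff)
    have "?E (grid N (Suc k)) \<le> ?c * ?E (grid N k) + h * \<eta>"
      unfolding \<eta>(1)
    proof (rule energy_step[OF \<alpha> \<beta> aim _ _ _ len R])
      fix s assume s: "s \<in> {grid N k..grid N (Suc k)}"
      show "(\<integral>w. dist (uncontrolled s w) (uncontrolled (grid N k) w) \<partial>M) \<le> \<rho>"
        using s m len by (intro \<rho>) auto
    qed (use Suc.prems m grid_mono in auto)
    also have "\<dots> \<le> ?c * (k * (h * \<eta>) * ?c ^ k) + (h * \<eta>) * ?c ^ Suc k"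
    proof (rule add_mono)
      show "?c * ?E (grid N k) \<le> ?c * (k * (h * \<eta>) * ?c ^ k)"
        using Suc c1 by (intro mult_left_mono) auto
      have "h * \<eta> * 1 \<le> (h * \<eta>) * ?c ^ Suc k"
        using c1 h0 \<eta>(2) by (intro mult_left_mono one_le_power) auto
      then show "h * \<eta> \<le> (h * \<eta>) * ?c ^ Suc k" by simp
    qed
    also have "\<dots> = Suc k * (h * \<eta>) * ?c ^ Suc k" by (simp add: algebra_simps)
    finally show ?case .
  qed
  have "?c ^ N \<le> exp (6 * C * h) ^ N"
    using c1 by (intro power_mono exp_ge_add_one_self) auto
  also have "\<dots> = exp (6 * C * (T - t0))" using N by (simp add: exp_of_nat_mult[symmetric] h)
  finally have le: "N * (h * \<eta>) * ?c ^ N \<le> N * (h * \<eta>) * exp (6 * C * (T - t0))"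
    using h0 \<eta>(2) by (intro mult_left_mono) auto
  have eq: "N * (h * \<eta>) = (T - t0) * \<eta>" using N by (simp add: h)
  from order_trans[OF E[OF order_refl] le] show ?thesis unfolding grid_last[OF N] eq .
qed

lemma payoff_gap:
  assumes \<alpha>: "\<alpha>1 \<in> ctrl A1" "\<alpha>2 \<in> ctrl A2"
    and \<beta>: "\<beta>1 \<in> ctrl A1" "\<beta>2 \<in> ctrl A2"
    and G: "CG-lipschitz_on UNIV G"
  shows "payoff M F W T b L G t0 \<xi> \<alpha>1 \<alpha>2 - payoff M F W T b L G t0 \<xi> \<beta>1 \<beta>2
    \<le> (1 + CG) * sqrt (energy \<alpha>1 \<alpha>2 \<beta>1 \<beta>2 T)"
proof -
  have T: "T \<in> {t0..T}" using t0 by auto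
  let ?D = "shift \<alpha>1 \<alpha>2 \<beta>1 \<beta>2 T" and ?Z = "cost_gap \<alpha>1 \<alpha>2 \<beta>1 \<beta>2 T"
  let ?q = "\<integral>w. (norm (?D w))\<^sup>2 \<partial>M" and ?e = "\<integral>w. norm (?D w) \<partial>M"
  have E: "energy \<alpha>1 \<alpha>2 \<beta>1 \<beta>2 T = ?q + (max 0 ?Z)\<^sup>2" by (rule energy_def[OF \<alpha> \<beta>])
  have q: "?q \<ge> 0" by simp
  have "max 0 ?Z = sqrt ((max 0 ?Z)\<^sup>2)" by simp
  also have "\<dots> \<le> sqrt (energy \<alpha>1 \<alpha>2 \<beta>1 \<beta>2 T)" unfolding E using q by (intro real_sqrt_le_mono) simp
  finally have 1: "?Z \<le> sqrt (energy \<alpha>1 \<alpha>2 \<beta>1 \<beta>2 T)" by simp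
  have "?e \<le> sqrt ?q" using expectation_norm_square[OF \<alpha> \<beta> T] by (rule real_le_rsqrt)
  also have "\<dots> \<le> sqrt (energy \<alpha>1 \<alpha>2 \<beta>1 \<beta>2 T)" unfolding E by (intro real_sqrt_le_mono) simp
  finally have 2: "?e \<le> sqrt (energy \<alpha>1 \<alpha>2 \<beta>1 \<beta>2 T)" .
  have CG: "CG \<ge> 0" by (rule lipschitz_on_nonneg[OF G])
  have "G (law M (state \<alpha>1 \<alpha>2 T)) - G (law M (state \<beta>1 \<beta>2 T)) \<le> CG * dist (law M (state \<alpha>1 \<alpha>2 T)) (law M (state \<beta>1 \<beta>2 T))"
    using lipschitz_onD[OF G, of "law M (state \<alpha>1 \<alpha>2 T)" "law M (state \<beta>1 \<beta>2 T)"] by (simp add: dist_real_def)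
  also have "\<dots> \<le> CG * ?e" by (intro mult_left_mono CG dist_laws_le_shift[OF \<alpha> \<beta> T])
  also have "\<dots> \<le> CG * sqrt (energy \<alpha>1 \<alpha>2 \<beta>1 \<beta>2 T)" by (intro mult_left_mono CG 2)
  finally have 3: "G (law M (state \<alpha>1 \<alpha>2 T)) - G (law M (state \<beta>1 \<beta>2 T)) \<le> CG * sqrt (energy \<alpha>1 \<alpha>2 \<beta>1 \<beta>2 T)" .
  have "payoff M F W T b L G t0 \<xi> \<alpha>1 \<alpha>2 - payoff M F W T b L G t0 \<xi> \<beta>1 \<beta>2
    = ?Z + (G (law M (state \<alpha>1 \<alpha>2 T)) - G (law M (state \<beta>1 \<beta>2 T)))"
    unfolding payoff_eq[OF L \<alpha>] payoff_eq[OF L \<beta>] cost_gap_def by simp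
  then show ?thesis using 1 3 by (simp add: distrib_right)
qed

text \<open>
  On a fine grid the aimed controls keep the energy small up to time \<open>T\<close>, uniformly in the responses, and
  \<open>payoff_gap\<close> translates this into payoffs.
\<close>

lemma coupled_play:
  assumes G: "CG-lipschitz_on UNIV G" and \<epsilon>: "\<epsilon> > 0"
  shows "\<exists>N>0. \<forall>f\<in>grid_responses N A2 A1. \<forall>g\<in>grid_responses N A1 A2.
    \<exists>\<alpha>2\<in>ctrl A2. \<exists>\<beta>1\<in>ctrl A1.
      payoff M F W T b L G t0 \<xi> (f \<alpha>2) \<alpha>2 \<le> payoff M F W T b L G t0 \<xi> \<beta>1 (g \<beta>1) + \<epsilon>"
proof -
  have CG: "CG \<ge> 0" by (rule lipschitz_on_nonneg[OF G])
  define \<tau> where "\<tau> = T - t0"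
  define E where "E = exp (6 * C * \<tau>)"
  define R where "R = 2 * B * (T - t0)"
  define \<kappa> where "\<kappa> = (\<epsilon> / (1 + CG))\<^sup>2"
  \<comment> \<open>\<open>\<eta>0\<close> is the admissible source term in the Gronwall inequality; saddle error, noise and mesh get a third each\<close>
  define \<eta>0 where "\<eta>0 = \<kappa> / (\<tau> * E + 1)"
  define \<epsilon>' where "\<epsilon>' = \<eta>0 / 6"
  define \<rho> where "\<rho> = \<eta>0 / (3 * (16 * C * R + 1))"
  define K where "K = 16 * C * R * B + 8 * B\<^sup>2"
  have \<tau>: "\<tau> \<ge> 0" using t0 by (simp add: \<tau>_def)
  have R0: "R \<ge> 0" using B_pos t0 by (simp add: R_def)
  have CR: "16 * C * R \<ge> 0" using R0 Cb_nonneg by simp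
  have K: "K \<ge> 0" using CR B_pos by (simp add: K_def)
  have E0: "E > 0" by (simp add: E_def)
  have \<kappa>: "\<kappa> > 0" using \<epsilon> CG by (simp add: \<kappa>_def)
  have den: "\<tau> * E + 1 > 0" using \<tau> E0 by (simp add: add_nonneg_pos)
  have \<eta>0: "\<eta>0 > 0" using \<kappa> den by (simp add: \<eta>0_def)
  have \<epsilon>': "\<epsilon>' > 0" using \<eta>0 by (simp add: \<epsilon>'_def)
  have \<rho>: "\<rho> > 0" using \<eta>0 CR by (simp add: \<rho>_def add_nonneg_pos)
  have C\<rho>: "16 * C * R * \<rho> \<le> \<eta>0 / 3"
  proof -
    have "16 * C * R * \<rho> \<le> (16 * C * R + 1) * \<rho>" using \<rho> by (intro mult_right_mono) auto
    also have "\<dots> = \<eta>0 / 3" using CR by (simp add: \<rho>_def field_simps)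
    finally show ?thesis .
  qed
  obtain \<delta> where \<delta>: "\<delta> > 0" "\<forall>r\<in>{t0..T}. \<forall>s\<in>{t0..T}. \<bar>s - r\<bar> < \<delta> \<longrightarrow>
    fluctuation s r \<le> \<rho>"
    using uncontrolled_modulus[OF \<rho>] by blast
  obtain N :: nat where N: "\<tau> / \<delta> + K * \<tau> * 3 / \<eta>0 < N" using reals_Archimedean2 by blast
  have nn: "\<tau> / \<delta> \<ge> 0" "K * \<tau> * 3 / \<eta>0 \<ge> 0" using \<tau> \<delta> K \<eta>0 by auto
  then have N0: "N > 0" using N by (metis add_nonneg_nonneg of_nat_0_less_iff order_le_less_trans)
  define h where "h = (T - t0) / N"
  have "\<tau> / \<delta> < N" "K * \<tau> * 3 / \<eta>0 \<le> N" using N nn by auto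
  then have h\<delta>: "h < \<delta>" and Kh: "K * h \<le> \<eta>0 / 3"
    using N0 \<delta> \<eta>0 by (auto simp: h_def \<tau>_def field_simps)
  define \<eta> where "\<eta> = 2 * \<epsilon>' + 16 * C * R * \<rho> + (16 * C * R * B + 8 * B\<^sup>2) * h"
  have \<eta>_le: "\<eta> \<le> \<eta>0" using C\<rho> Kh by (simp add: \<eta>_def \<epsilon>'_def K_def)
  have \<eta>_nonneg: "\<eta> \<ge> 0"
    using \<epsilon>' Cb_nonneg R0 \<rho> K \<tau> unfolding \<eta>_def K_def[symmetric] h_def \<tau>_def by (intro add_nonneg_nonneg mult_nonneg_nonneg) auto
  have E_le: "(T - t0) * \<eta> * exp (6 * C * (T - t0)) \<le> \<kappa>"
  proof -
    have "(T - t0) * \<eta> * exp (6 * C * (T - t0)) = (\<tau> * E) * \<eta>" by (simp add: \<tau>_def E_def)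
    also have "\<dots> \<le> (\<tau> * E + 1) * \<eta>0" using \<eta>_le \<eta>_nonneg \<tau> E0 by (intro mult_mono) auto
    also have "\<dots> = \<kappa>" using den by (simp add: \<eta>0_def)
    finally show ?thesis .
  qed
  show ?thesis
  proof (intro exI[of _ N] conjI N0 ballI)
    fix f g assume f: "f \<in> grid_responses N A2 A1" and g: "g \<in> grid_responses N A1 A2"
    obtain \<alpha>2 \<beta>1 where c: "\<alpha>2 \<in> ctrl A2" "\<beta>1 \<in> ctrl A1"
      and aim: "\<And>j. j < N \<Longrightarrow> aimed \<epsilon>' (grid N j) (grid N (Suc j)) (f \<alpha>2) \<alpha>2 \<beta>1 (g \<beta>1)"
      using aimed_controls_exist[OF f g N0 \<epsilon>' order_refl] by blast
    have fc: "f \<alpha>2 \<in> ctrl A1" and gc: "g \<beta>1 \<in> ctrl A2"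
      using f g c by (auto simp: grid_responses_def)
    have "energy (f \<alpha>2) \<alpha>2 \<beta>1 (g \<beta>1) T \<le> (T - t0) * \<eta> * exp (6 * C * (T - t0))"
      by (rule energy_T_bound[OF fc c(1) c(2) gc N0 aim _ h_def R_def \<eta>_def \<eta>_nonneg]) (use \<delta>(2) h\<delta> in auto)
    also note E_le
    finally have "sqrt (energy (f \<alpha>2) \<alpha>2 \<beta>1 (g \<beta>1) T) \<le> sqrt \<kappa>" by (rule real_sqrt_le_mono)
    also have "sqrt \<kappa> = \<epsilon> / (1 + CG)" using \<epsilon> CG by (simp add: \<kappa>_def)
    finally have "(1 + CG) * sqrt (energy (f \<alpha>2) \<alpha>2 \<beta>1 (g \<beta>1) T) \<le> (1 + CG) * (\<epsilon> / (1 + CG))"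
      using CG by (intro mult_left_mono) auto
    also have "\<dots> = \<epsilon>" using CG by simp
    finally have "payoff M F W T b L G t0 \<xi> (f \<alpha>2) \<alpha>2 \<le> payoff M F W T b L G t0 \<xi> \<beta>1 (g \<beta>1) + \<epsilon>"
      using payoff_gap[OF fc c(1) c(2) gc G] by linarith
    then show "\<exists>\<alpha>2\<in>ctrl A2. \<exists>\<beta>1\<in>ctrl A1.
      payoff M F W T b L G t0 \<xi> (f \<alpha>2) \<alpha>2 \<le> payoff M F W T b L G t0 \<xi> \<beta>1 (g \<beta>1) + \<epsilon>"
      using c by blast
  qed
qed

text \<open>
  Strategies of both players are responses, so two nearly optimal ones can be played against each other.
\<close>

lemma upper_le_lower:
  assumes G: "CG-lipschitz_on UNIV G"
  shows "upper_value M F W T A1 A2 b L G t0 \<xi> \<le> lower_value M F W T A1 A2 b L G t0 \<xi>"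
proof (rule ccontr)
  let ?J = "payoff M F W T b L G t0 \<xi>"
  assume "\<not> upper_value M F W T A1 A2 b L G t0 \<xi> \<le> lower_value M F W T A1 A2 b L G t0 \<xi>"
  then have gap: "lower_value M F W T A1 A2 b L G t0 \<xi> < upper_value M F W T A1 A2 b L G t0 \<xi>" by (simp only: not_le)
  obtain r1 where r1: "lower_value M F W T A1 A2 b L G t0 \<xi> < ereal r1" "ereal r1 < upper_value M F W T A1 A2 b L G t0 \<xi>"
    using ereal_dense2[OF gap] by blast
  obtain r2 where r2: "ereal r1 < ereal r2" "ereal r2 < upper_value M F W T A1 A2 b L G t0 \<xi>"
    using ereal_dense2[OF r1(2)] by blast
  have lt: "r1 < r2" using r2 by simp
  obtain g where g: "g \<in> strategies M F T A1 A2 t0" "(SUP \<beta>1\<in>ctrl A1. ereal (?J \<beta>1 (g \<beta>1))) < ereal r1"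
    using r1(1) unfolding lower_value_def INF_less_iff by blast
  obtain f where f: "f \<in> strategies M F T A2 A1 t0" "ereal r2 < (INF \<alpha>2\<in>ctrl A2. ereal (?J (f \<alpha>2) \<alpha>2))"
    using r2(2) unfolding upper_value_def less_SUP_iff by blast
  obtain N where N: "N > 0" "\<And>f g. f \<in> grid_responses N A2 A1 \<Longrightarrow> g \<in> grid_responses N A1 A2 \<Longrightarrow>
    \<exists>\<alpha>2\<in>ctrl A2. \<exists>\<beta>1\<in>ctrl A1. ?J (f \<alpha>2) \<alpha>2 \<le> ?J \<beta>1 (g \<beta>1) + (r2 - r1)"
    using coupled_play[OF G, of "r2 - r1"] lt by auto
  obtain \<alpha>2 \<beta>1 where c: "\<alpha>2 \<in> ctrl A2" "\<beta>1 \<in> ctrl A1" "?J (f \<alpha>2) \<alpha>2 \<le> ?J \<beta>1 (g \<beta>1) + (r2 - r1)"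
    using N(2)[OF subsetD[OF strategies_grid_responses[OF N(1)] f(1)] subsetD[OF strategies_grid_responses[OF N(1)] g(1)]]
    by blast
  have "ereal (?J \<beta>1 (g \<beta>1)) < ereal r1"
    using le_less_trans[OF SUP_upper[OF c(2)] g(2)] .
  moreover have "ereal r2 < ereal (?J (f \<alpha>2) \<alpha>2)"
    using less_le_trans[OF f(2) INF_lower[OF c(1)]] .
  ultimately show False using c(3) by simp
qed

text \<open>
  If no strategy of player 2 keeps the payoff at most \<open>r2\<close> and none of player 1 keeps it at least \<open>r1\<close>,
  determinacy provides responses of the respective opponents, which contradict \<open>coupled_play\<close>.
\<close>

lemma lower_le_upper:
  assumes G: "CG-lipschitz_on UNIV G"
  shows "lower_value M F W T A1 A2 b L G t0 \<xi> \<le> upper_value M F W T A1 A2 b L G t0 \<xi>"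
proof (rule ccontr)
  let ?J = "payoff M F W T b L G t0 \<xi>"
  assume "\<not> lower_value M F W T A1 A2 b L G t0 \<xi> \<le> upper_value M F W T A1 A2 b L G t0 \<xi>"
  then have gap: "upper_value M F W T A1 A2 b L G t0 \<xi> < lower_value M F W T A1 A2 b L G t0 \<xi>" by (simp only: not_le)
  obtain r1 where r1: "upper_value M F W T A1 A2 b L G t0 \<xi> < ereal r1" "ereal r1 < lower_value M F W T A1 A2 b L G t0 \<xi>"
    using ereal_dense2[OF gap] by blast
  obtain r2 where r2: "ereal r1 < ereal r2" "ereal r2 < lower_value M F W T A1 A2 b L G t0 \<xi>"
    using ereal_dense2[OF r1(2)] by blast
  have lt: "r1 < r2" using r2 by simp
  obtain N where N: "N > 0" "\<And>f g. f \<in> grid_responses N A2 A1 \<Longrightarrow> g \<in> grid_responses N A1 A2 \<Longrightarrow>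
    \<exists>\<alpha>2\<in>ctrl A2. \<exists>\<beta>1\<in>ctrl A1. ?J (f \<alpha>2) \<alpha>2 \<le> ?J \<beta>1 (g \<beta>1) + (r2 - r1)"
    using coupled_play[OF G, of "r2 - r1"] lt by auto
  have "\<not> (\<exists>S\<in>strategies M F T A1 A2 t0. \<forall>\<alpha>1\<in>ctrl A1. ?J \<alpha>1 (S \<alpha>1) \<le> r2)"
  proof
    assume "\<exists>S\<in>strategies M F T A1 A2 t0. \<forall>\<alpha>1\<in>ctrl A1. ?J \<alpha>1 (S \<alpha>1) \<le> r2"
    then obtain S where S: "S \<in> strategies M F T A1 A2 t0" "\<And>\<alpha>1. \<alpha>1 \<in> ctrl A1 \<Longrightarrow> ?J \<alpha>1 (S \<alpha>1) \<le> r2" by blast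
    have "lower_value M F W T A1 A2 b L G t0 \<xi> \<le> ereal r2"
      unfolding lower_value_def by (rule INF_lower2[OF S(1)], rule SUP_least) (simp add: S(2))
    then show False using r2(2) by simp
  qed
  moreover have "?J \<alpha> \<beta> \<le> r2 \<longleftrightarrow> ?J \<alpha>' \<beta>' \<le> r2"
    if "\<alpha> \<in> ctrl A1" "\<alpha>' \<in> ctrl A1" "\<beta> \<in> ctrl A2" "\<beta>' \<in> ctrl A2"
      "agree_until M t0 T \<alpha> \<alpha>'" "agree_until M t0 T \<beta> \<beta>'" for \<alpha> \<alpha>' \<beta> \<beta>'
    using payoff_cong[OF that(1,3,2,4-6)] by simp
  ultimately obtain f where f: "f \<in> grid_responses N A2 A1" "\<And>\<alpha>2. \<alpha>2 \<in> ctrl A2 \<Longrightarrow> \<not> ?J (f \<alpha>2) \<alpha>2 \<le> r2"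
    using determined[OF N(1) A1(2) A2(2), of "\<lambda>\<alpha> \<beta>. ?J \<alpha> \<beta> \<le> r2"] by blast
  have "\<not> (\<exists>S\<in>strategies M F T A2 A1 t0. \<forall>\<alpha>2\<in>ctrl A2. r1 \<le> ?J (S \<alpha>2) \<alpha>2)"
  proof
    assume "\<exists>S\<in>strategies M F T A2 A1 t0. \<forall>\<alpha>2\<in>ctrl A2. r1 \<le> ?J (S \<alpha>2) \<alpha>2"
    then obtain S where S: "S \<in> strategies M F T A2 A1 t0" "\<And>\<alpha>2. \<alpha>2 \<in> ctrl A2 \<Longrightarrow> r1 \<le> ?J (S \<alpha>2) \<alpha>2" by blast
    have "ereal r1 \<le> upper_value M F W T A1 A2 b L G t0 \<xi>"
      unfolding upper_value_def by (rule SUP_upper2[OF S(1)], rule INF_greatest) (simp add: S(2))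
    then show False using r1(1) by simp
  qed
  moreover have "r1 \<le> ?J \<beta> \<alpha> \<longleftrightarrow> r1 \<le> ?J \<beta>' \<alpha>'"
    if "\<alpha> \<in> ctrl A2" "\<alpha>' \<in> ctrl A2" "\<beta> \<in> ctrl A1" "\<beta>' \<in> ctrl A1"
      "agree_until M t0 T \<alpha> \<alpha>'" "agree_until M t0 T \<beta> \<beta>'" for \<alpha> \<alpha>' \<beta> \<beta>'
    using payoff_cong[OF that(3,1,4,2,6,5)] by simp
  ultimately obtain g where g: "g \<in> grid_responses N A1 A2" "\<And>\<alpha>1. \<alpha>1 \<in> ctrl A1 \<Longrightarrow> \<not> r1 \<le> ?J \<alpha>1 (g \<alpha>1)"
    using determined[OF N(1) A2(2) A1(2), of "\<lambda>\<alpha> \<beta>. r1 \<le> ?J \<beta> \<alpha>"] by blast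
  obtain \<alpha>2 \<beta>1 where "\<alpha>2 \<in> ctrl A2" "\<beta>1 \<in> ctrl A1" "?J (f \<alpha>2) \<alpha>2 \<le> ?J \<beta>1 (g \<beta>1) + (r2 - r1)"
    using N(2)[OF f(1) g(1)] by blast
  then show False using f(2)[of \<alpha>2] g(2)[of \<beta>1] by simp
qed

end

theorem corollary6p7:
  fixes M :: "'w measure"
    and F :: "real \<Rightarrow> 'w measure"
    and W :: "real \<Rightarrow> 'w \<Rightarrow> real ^ 'n::finite"
    and T :: real
    and A1 :: "'a::metric_space set"
    and A2 :: "'b::metric_space set"
    and b :: "'n torus \<Rightarrow> 'a \<Rightarrow> 'b \<Rightarrow> 'n torus_prob \<Rightarrow> real ^ 'n"
    and L :: "'n torus \<Rightarrow> 'a \<Rightarrow> 'b \<Rightarrow> 'n torus_prob \<Rightarrow> real"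
    and G :: "'n torus_prob \<Rightarrow> real"
  assumes "T > 0"
    and "stochastic_basis M T F W"
    and "compact A1" and "A1 \<noteq> {}"
    and "compact A2" and "A2 \<noteq> {}"
    and "continuous_on (UNIV \<times> A1 \<times> A2 \<times> UNIV) (\<lambda>(x, a1, a2, m). b x a1 a2 m)"
    and "continuous_on (UNIV \<times> A1 \<times> A2 \<times> UNIV) (\<lambda>(x, a1, a2, m). L x a1 a2 m)"
    and "\<exists>C. \<forall>a1\<in>A1. \<forall>a2\<in>A2. C-lipschitz_on UNIV (\<lambda>(x, m). b x a1 a2 m)"
    and "\<exists>C. \<forall>a1\<in>A1. \<forall>a2\<in>A2. C-lipschitz_on UNIV (\<lambda>(x, m). L x a1 a2 m)"
    and "\<exists>C. C-lipschitz_on UNIV G"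
    and "\<forall>x p m. hamiltonian_plus A1 A2 b L x p m = hamiltonian_minus A1 A2 b L x p m"
  shows "\<forall>t0\<in>{0..T}. \<forall>m0. \<forall>\<xi>\<in>initial_states M F m0.
    upper_value M F W T A1 A2 b L G t0 \<xi> = lower_value M F W T A1 A2 b L G t0 \<xi>"
proof (intro ballI allI)
  fix t0 :: real and m0 :: "'n torus_prob" and \<xi> :: "'w \<Rightarrow> 'n torus"
  assume t0: "t0 \<in> {0..T}" and \<xi>: "\<xi> \<in> initial_states M F m0"
  obtain Cb CL where Cb: "\<forall>a1\<in>A1. \<forall>a2\<in>A2. Cb-lipschitz_on UNIV (\<lambda>(x, m). b x a1 a2 m)"
    and CL: "\<forall>a1\<in>A1. \<forall>a2\<in>A2. CL-lipschitz_on UNIV (\<lambda>(x, m). L x a1 a2 m)"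
    using assms(9,10) by blast
  define C where "C = max Cb CL"
  have b: "lipschitz_data A1 A2 C b"
    unfolding lipschitz_data_def
  proof (intro conjI ballI assms(7))
    show "C-lipschitz_on UNIV (\<lambda>(x, m). b x a1 a2 m)" if "a1 \<in> A1" "a2 \<in> A2" for a1 a2
      by (rule lipschitz_on_le[OF Cb[rule_format, OF that]]) (simp add: C_def)
  qed
  have L: "lipschitz_data A1 A2 C L"
    unfolding lipschitz_data_def
  proof (intro conjI ballI assms(8))
    show "C-lipschitz_on UNIV (\<lambda>(x, m). L x a1 a2 m)" if "a1 \<in> A1" "a2 \<in> A2" for a1 a2
      by (rule lipschitz_on_le[OF CL[rule_format, OF that]]) (simp add: C_def)
  qed
  obtain B1 where B1: "B1 > 0" "\<forall>x. \<forall>a1\<in>A1. \<forall>a2\<in>A2. \<forall>m. norm (b x a1 a2 m) \<le> B1"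
    using lipschitz_data_bounded[OF b assms(3,5,4,6)] by blast
  obtain B2 where B2: "B2 > 0" "\<forall>x. \<forall>a1\<in>A1. \<forall>a2\<in>A2. \<forall>m. norm (L x a1 a2 m) \<le> B2"
    using lipschitz_data_bounded[OF L assms(3,5,4,6)] by blast
  obtain CG where G: "CG-lipschitz_on UNIV G" using assms(11) by blast
  interpret stochastic_basis M T F W by fact
  interpret isaacs_game M T F W A1 A2 b C t0 \<xi> L "max B1 B2"
  proof unfold_locales
    show "\<xi> \<in> F 0 \<rightarrow>\<^sub>M borel" using \<xi> by (simp add: initial_states_def)
    show "\<forall>x. \<forall>a1\<in>A1. \<forall>a2\<in>A2. \<forall>m. norm (b x a1 a2 m) \<le> max B1 B2" using B1(2) by (meson max.coboundedI1)
    show "\<forall>x. \<forall>a1\<in>A1. \<forall>a2\<in>A2. \<forall>m. norm (L x a1 a2 m) \<le> max B1 B2" using B2(2) by (meson max.coboundedI2)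
  qed (use t0 assms b L B1 in auto)
  show "upper_value M F W T A1 A2 b L G t0 \<xi> = lower_value M F W T A1 A2 b L G t0 \<xi>"
    by (rule antisym[OF upper_le_lower[OF G] lower_le_upper[OF G]])
qed

end
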